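(* Let $H$ be a Hopf algebra over a field $\Bbbk$, let $A$ be a unital algebra, let $\rho:A\to A\otimes H$ and $\lambda:A\to H\otimes A$ be linear maps, and let $\triangleright:H^0\otimes A\to A$ and $\triangleleft:A\otimes H^0\to A$ be the respective induced maps $f\triangleright a=(I_A\otimes f)\rho(a)$ and $a\triangleleft f=(f\otimes I_A)\lambda(a)$. (a) If $(\lambda,A,\rho)$ is a partial $H$-bicomodule algebra, then $(\triangleright,A,\triangleleft)$ is a partial $H^0$-bimodule algebra; and if $(\lambda,A,\rho)$ is a (global) $H$-bicomodule algebra, then $(\triangleright,A,\triangleleft)$ is a (global) $H^0$-bimodule algebra. (b) If $H^0$ separates points, the converses of both implications in (a) also hold.
   Context: Algebras are over $\Bbbk$ and associative; $\otimes=\otimes_\Bbbk$. $\Delta(h)=h_1\otimes h_2$ and $\varepsilon$ denote comultiplication and counit. $H^0$ is the finite dual Hopf algebra of $H$; it separates points if for every nonzero $h\in H$ there is $f\in H^0$ with $f(h)\ne0$. For a Hopf algebra $K$: a partial $K$-bimodule algebra $(\rightharpoonup,A,\leftharpoonup)$ is an algebra $A$ with linear maps $\rightharpoonup:K\otimes A\to A$, $\leftharpoonup:A\otimes K\to A$ such that for all $a,b\in A$, $g,h\in K$: $1_K\rightharpoonup a=a$; $h\rightharpoonup[a(g\rightharpoonup b)]=(h_1\rightharpoonup a)(h_2g\rightharpoonup b)$; $a\leftharpoonup 1_K=a$; $[(b\leftharpoonup g)a]\leftharpoonup h=(b\leftharpoonup gh_1)(a\leftharpoonup h_2)$; $h\rightharpoonup(a\leftharpoonup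 g)=(h\rightharpoonup a)\leftharpoonup g$. A (global) $K$-bimodule algebra is an algebra $A$ that is a $K$-bimodule via $\triangleright,\triangleleft$ with $h\triangleright(ab)=(h_1\triangleright a)(h_2\triangleright b)$ and $(ab)\triangleleft h=(a\triangleleft h_1)(b\triangleleft h_2)$. A partial $H$-bicomodule algebra $(\lambda,A,\rho)$ is a unital algebra $A$ with multiplicative linear maps $\rho:A\to A\otimes H$, $\lambda:A\to H\otimes A$ such that for all $a\in A$: $(I_A\otimes\varepsilon)\rho(a)=a$; $(\rho\otimes I_H)\rho(a)=(\rho(1_A)\otimes 1_H)[(I_A\otimes\Delta)\rho(a)]$; $(\varepsilon\otimes I_A)\lambda(a)=a$; $(I_H\otimes\lambda)\lambda(a)=[(\Delta\otimes I_A)\lambda(a)](1_H\otimes\lambda(1_A))$; and $(I_H\otimes\rho)\lambda=(\lambda\otimes I_H)\rho$. A (global) $H$-bicomodule algebra is defined in the same way but with the coassociativity axioms $(\rho\otimes I_H)\rho=(I_A\otimes\Delta)\rho$ and $(I_H\otimes\lambda)\lambda=(\Delta\otimes I_A)\lambda$ in place of the partial ones. *)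

theory Defs
  imports "HOL-Algebra.Module" "HOL-Algebra.QuotRing"
begin

section \<open>Linear algebra over a field given as a HOL-Algebra structure\<close>

text \<open>Unit elements are not part of an associative algebra; \<open>unital_algebra\<close> adds one.
  A unital algebra may be zero.\<close>

locale assoc_algebra = field F + module F A for F (structure) and A (structure) +
  assumes mult_closed:
      "\<lbrakk>x \<in> carrier A; y \<in> carrier A\<rbrakk> \<Longrightarrow> x \<otimes>\<^bsub>A\<^esub> y \<in> carrier A"
    and mult_assoc:
      "\<lbrakk>x \<in> carrier A; y \<in> carrier A; z \<in> carrier A\<rbrakk>
        \<Longrightarrow> (x \<otimes>\<^bsub>A\<^esub> y) \<otimes>\<^bsub>A\<^esub> z = x \<otimes>\<^bsub>A\<^esub> (y \<otimes>\<^bsub>A\<^esub> z)"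
    and mult_distrib_right:
      "\<lbrakk>x \<in> carrier A; y \<in> carrier A; z \<in> carrier A\<rbrakk>
        \<Longrightarrow> (x \<oplus>\<^bsub>A\<^esub> y) \<otimes>\<^bsub>A\<^esub> z = x \<otimes>\<^bsub>A\<^esub> z \<oplus>\<^bsub>A\<^esub> y \<otimes>\<^bsub>A\<^esub> z"
    and mult_distrib_left:
      "\<lbrakk>x \<in> carrier A; y \<in> carrier A; z \<in> carrier A\<rbrakk>
        \<Longrightarrow> z \<otimes>\<^bsub>A\<^esub> (x \<oplus>\<^bsub>A\<^esub> y) = z \<otimes>\<^bsub>A\<^esub> x \<oplus>\<^bsub>A\<^esub> z \<otimes>\<^bsub>A\<^esub> y"
    and smult_mult_left:
      "\<lbrakk>c \<in> carrier F; x \<in> carrier A; y \<in> carrier A\<rbrakk>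
        \<Longrightarrow> (c \<odot>\<^bsub>A\<^esub> x) \<otimes>\<^bsub>A\<^esub> y = c \<odot>\<^bsub>A\<^esub> (x \<otimes>\<^bsub>A\<^esub> y)"
    and smult_mult_right:
      "\<lbrakk>c \<in> carrier F; x \<in> carrier A; y \<in> carrier A\<rbrakk>
        \<Longrightarrow> x \<otimes>\<^bsub>A\<^esub> (c \<odot>\<^bsub>A\<^esub> y) = c \<odot>\<^bsub>A\<^esub> (x \<otimes>\<^bsub>A\<^esub> y)"

locale unital_algebra = assoc_algebra F A + ring A for F (structure) and A (structure)

definition linear_map ::
  "('k, 'r) ring_scheme \<Rightarrow> ('k, 'a, 'm) module_scheme \<Rightarrow> ('k, 'b, 'n) module_scheme
    \<Rightarrow> ('a \<Rightarrow> 'b) \<Rightarrow> bool" where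
  "linear_map F V W \<phi> \<longleftrightarrow>
     \<phi> \<in> carrier V \<rightarrow> carrier W \<and>
     (\<forall>x \<in> carrier V. \<forall>y \<in> carrier V. \<phi> (x \<oplus>\<^bsub>V\<^esub> y) = \<phi> x \<oplus>\<^bsub>W\<^esub> \<phi> y) \<and>
     (\<forall>c \<in> carrier F. \<forall>x \<in> carrier V. \<phi> (c \<odot>\<^bsub>V\<^esub> x) = c \<odot>\<^bsub>W\<^esub> \<phi> x)"

definition bilinear_map ::
  "('k, 'r) ring_scheme \<Rightarrow> ('k, 'a, 'm) module_scheme \<Rightarrow> ('k, 'b, 'n) module_scheme
    \<Rightarrow> ('k, 'c, 'l) module_scheme \<Rightarrow> ('a \<Rightarrow> 'b \<Rightarrow> 'c) \<Rightarrow> bool" where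
  "bilinear_map F V W U f \<longleftrightarrow>
     (\<forall>x \<in> carrier V. linear_map F W U (\<lambda>y. f x y)) \<and>
     (\<forall>y \<in> carrier W. linear_map F V U (\<lambda>x. f x y))"

definition self_module :: "('k, 'r) ring_scheme \<Rightarrow> ('k, 'k) module" where
  "self_module F = \<lparr>carrier = carrier F, mult = mult F, one = one F,
     zero = zero F, add = add F, smult = mult F\<rparr>"

definition generated_submodule ::
  "('k, 'r) ring_scheme \<Rightarrow> ('k, 'a, 'm) module_scheme \<Rightarrow> 'a set \<Rightarrow> 'a set" where
  "generated_submodule F V X = \<Inter>{S. submodule S F V \<and> X \<subseteq> S}"

definition finite_dimensional ::
  "('k, 'r) ring_scheme \<Rightarrow> ('k, 'a, 'm) module_scheme \<Rightarrow> bool" where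
  "finite_dimensional F V \<longleftrightarrow>
     (\<exists>X. finite X \<and> X \<subseteq> carrier V \<and> generated_submodule F V X = carrier V)"

text \<open>The multiplication inherited from \<open>Quot\<close> is meaningful only if \<open>N\<close> is an ideal; for a
  mere submodule \<open>N\<close> only the vector space structure is used.\<close>

definition quotient_module ::
  "('k, 'a, 'm) module_scheme \<Rightarrow> 'a set \<Rightarrow> ('k, 'a set) module" where
  "quotient_module V N = ring.extend (V Quot N)
     (module.fields (\<lambda>c S. \<Union>x \<in> S. N +>\<^bsub>V\<^esub> (c \<odot>\<^bsub>V\<^esub> x)))"


section \<open>Tensor products\<close>

text \<open>\<open>A \<otimes> B\<close> is the free vector space on \<open>carrier A \<times> carrier B\<close> modulo the bilinearity
  relations. Elements of the free vector space are finitely supported coefficient functions,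
  so an element of \<open>A \<otimes> B\<close> is a coset of such functions.\<close>

type_synonym ('k, 'a, 'b) tensor = "('a \<times> 'b \<Rightarrow> 'k) set"

definition free_module :: "('k, 'r) ring_scheme \<Rightarrow> 'x set \<Rightarrow> ('k, 'x \<Rightarrow> 'k) module" where
  "free_module F X =
     \<lparr>carrier = {u. u \<in> X \<rightarrow> carrier F \<and> (\<forall>x. x \<notin> X \<longrightarrow> u x = \<zero>\<^bsub>F\<^esub>) \<and> finite {x. u x \<noteq> \<zero>\<^bsub>F\<^esub>}},
      mult = undefined, one = undefined,
      zero = (\<lambda>x. \<zero>\<^bsub>F\<^esub>), add = (\<lambda>u v x. u x \<oplus>\<^bsub>F\<^esub> v x),
      smult = (\<lambda>c u x. c \<otimes>\<^bsub>F\<^esub> u x)\<rparr>"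

definition free_basis :: "('k, 'r) ring_scheme \<Rightarrow> 'x \<Rightarrow> 'x \<Rightarrow> 'k" where
  "free_basis F x = (\<lambda>y. if y = x then \<one>\<^bsub>F\<^esub> else \<zero>\<^bsub>F\<^esub>)"

context
  fixes F :: "('k, 'r) ring_scheme"
    and A :: "('k, 'a, 'm) module_scheme"
    and B :: "('k, 'b, 'n) module_scheme"
begin

definition tensor_free :: "('k, 'a \<times> 'b \<Rightarrow> 'k) module" where
  "tensor_free = free_module F (carrier A \<times> carrier B)"

definition tensor_relators :: "('a \<times> 'b \<Rightarrow> 'k) set" where
  "tensor_relators =
     {free_basis F (x \<oplus>\<^bsub>A\<^esub> y, z) \<ominus>\<^bsub>tensor_free\<^esub>
        (free_basis F (x, z) \<oplus>\<^bsub>tensor_free\<^esub> free_basis F (y, z)) | x y z.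
        x \<in> carrier A \<and> y \<in> carrier A \<and> z \<in> carrier B} \<union>
     {free_basis F (x, y \<oplus>\<^bsub>B\<^esub> z) \<ominus>\<^bsub>tensor_free\<^esub>
        (free_basis F (x, y) \<oplus>\<^bsub>tensor_free\<^esub> free_basis F (x, z)) | x y z.
        x \<in> carrier A \<and> y \<in> carrier B \<and> z \<in> carrier B} \<union>
     {free_basis F (c \<odot>\<^bsub>A\<^esub> x, y) \<ominus>\<^bsub>tensor_free\<^esub> c \<odot>\<^bsub>tensor_free\<^esub> free_basis F (x, y) | c x y.
        c \<in> carrier F \<and> x \<in> carrier A \<and> y \<in> carrier B} \<union>
     {free_basis F (x, c \<odot>\<^bsub>B\<^esub> y) \<ominus>\<^bsub>tensor_free\<^esub> c \<odot>\<^bsub>tensor_free\<^esub> free_basis F (x, y) | c x y.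
        c \<in> carrier F \<and> x \<in> carrier A \<and> y \<in> carrier B}"

definition tensor_null :: "('a \<times> 'b \<Rightarrow> 'k) set" where
  "tensor_null = generated_submodule F tensor_free tensor_relators"

definition tensor_space :: "('k, ('k, 'a, 'b) tensor) module" where
  "tensor_space = quotient_module tensor_free tensor_null"

definition pure_tensor :: "'a \<Rightarrow> 'b \<Rightarrow> ('k, 'a, 'b) tensor" where
  "pure_tensor a b = tensor_null +>\<^bsub>tensor_free\<^esub> free_basis F (a, b)"

end

text \<open>\<open>tensor_lift F V f\<close> is the map \<open>A \<otimes> B \<rightarrow> V\<close> sending \<open>a \<otimes> b\<close> to \<open>f a b\<close>, evaluated on an
  arbitrary representative; it is independent of that choice when \<open>f\<close> is bilinear.
  Sweedler-type expressions are written with it: \<open>tensor_lift F V f (comult H h)\<close> stands for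
  the sum of all \<open>f h\<^sub>1 h\<^sub>2\<close>.\<close>

definition tensor_lift ::
  "('k, 'r) ring_scheme \<Rightarrow> ('k, 'c, 'm) module_scheme \<Rightarrow> ('a \<Rightarrow> 'b \<Rightarrow> 'c)
    \<Rightarrow> ('k, 'a, 'b) tensor \<Rightarrow> 'c" where
  "tensor_lift F V f t =
     (let u = (SOME u. u \<in> t)
      in \<Oplus>\<^bsub>V\<^esub>p \<in> {p. u p \<noteq> \<zero>\<^bsub>F\<^esub>}. u p \<odot>\<^bsub>V\<^esub> f (fst p) (snd p))"

text \<open>The tensor product algebra: \<open>(a \<otimes> b)(a' \<otimes> b') = aa' \<otimes> bb'\<close>.\<close>

definition tensor ::
  "('k, 'r) ring_scheme \<Rightarrow> ('k, 'a, 'm) module_scheme \<Rightarrow> ('k, 'b, 'n) module_scheme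
    \<Rightarrow> ('k, ('k, 'a, 'b) tensor) module" where
  "tensor F A B = (tensor_space F A B)
     \<lparr>mult := (\<lambda>s t. tensor_lift F (tensor_space F A B)
        (\<lambda>a b. tensor_lift F (tensor_space F A B)
          (\<lambda>a' b'. pure_tensor F A B (a \<otimes>\<^bsub>A\<^esub> a') (b \<otimes>\<^bsub>B\<^esub> b')) t) s),
      one := pure_tensor F A B \<one>\<^bsub>A\<^esub> \<one>\<^bsub>B\<^esub>\<rparr>"

text \<open>\<open>tensor_map F C D \<phi> \<psi>\<close> is \<open>\<phi> \<otimes> \<psi>\<close> with target \<open>C \<otimes> D\<close>.\<close>

definition tensor_map ::
  "('k, 'r) ring_scheme \<Rightarrow> ('k, 'c, 'm) module_scheme \<Rightarrow> ('k, 'd, 'n) module_scheme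
    \<Rightarrow> ('a \<Rightarrow> 'c) \<Rightarrow> ('b \<Rightarrow> 'd) \<Rightarrow> ('k, 'a, 'b) tensor \<Rightarrow> ('k, 'c, 'd) tensor" where
  "tensor_map F C D \<phi> \<psi> =
     tensor_lift F (tensor F C D) (\<lambda>a b. pure_tensor F C D (\<phi> a) (\<psi> b))"

text \<open>The canonical map \<open>(A \<otimes> B) \<otimes> C \<rightarrow> A \<otimes> (B \<otimes> C)\<close>, an identification left implicit on paper.\<close>

definition tensor_assoc ::
  "('k, 'r) ring_scheme \<Rightarrow> ('k, 'a, 'm) module_scheme \<Rightarrow> ('k, 'b, 'n) module_scheme
    \<Rightarrow> ('k, 'c, 'l) module_scheme
    \<Rightarrow> ('k, ('k, 'a, 'b) tensor, 'c) tensor \<Rightarrow> ('k, 'a, ('k, 'b, 'c) tensor) tensor" where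
  "tensor_assoc F A B C =
     tensor_lift F (tensor F A (tensor F B C))
       (\<lambda>t c. tensor_lift F (tensor F A (tensor F B C))
         (\<lambda>a b. pure_tensor F A (tensor F B C) a (pure_tensor F B C b c)) t)"

text \<open>\<open>I \<otimes> f\<close> and \<open>f \<otimes> I\<close> for a functional \<open>f\<close>, with \<open>V \<otimes> \<Bbbk>\<close> and \<open>\<Bbbk> \<otimes> V\<close> identified with \<open>V\<close>.\<close>

definition slice_right ::
  "('k, 'r) ring_scheme \<Rightarrow> ('k, 'a, 'm) module_scheme \<Rightarrow> ('b \<Rightarrow> 'k) \<Rightarrow> ('k, 'a, 'b) tensor \<Rightarrow> 'a"
  where "slice_right F V f = tensor_lift F V (\<lambda>a b. f b \<odot>\<^bsub>V\<^esub> a)"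

definition slice_left ::
  "('k, 'r) ring_scheme \<Rightarrow> ('k, 'b, 'm) module_scheme \<Rightarrow> ('a \<Rightarrow> 'k) \<Rightarrow> ('k, 'a, 'b) tensor \<Rightarrow> 'b"
  where "slice_left F V f = tensor_lift F V (\<lambda>a b. f a \<odot>\<^bsub>V\<^esub> b)"


section \<open>Hopf algebras and the finite dual\<close>

record ('k, 'a) hopf = "('k, 'a) module" +
  comult :: "'a \<Rightarrow> ('k, 'a, 'a) tensor"
  counit :: "'a \<Rightarrow> 'k"
  antipode :: "'a \<Rightarrow> 'a"

locale hopf_algebra = unital_algebra F H for F (structure) and H (structure) +
  assumes comult_linear: "linear_map F H (tensor F H H) (comult H)"
    and counit_linear: "linear_map F H (self_module F) (counit H)"
    and coassociative:
      "h \<in> carrier H \<Longrightarrow>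
        tensor_assoc F H H H (tensor_map F (tensor F H H) H (comult H) id (comult H h)) =
        tensor_map F H (tensor F H H) id (comult H) (comult H h)"
    and counit_right: "h \<in> carrier H \<Longrightarrow> slice_right F H (counit H) (comult H h) = h"
    and counit_left: "h \<in> carrier H \<Longrightarrow> slice_left F H (counit H) (comult H h) = h"
    and comult_mult:
      "\<lbrakk>g \<in> carrier H; h \<in> carrier H\<rbrakk> \<Longrightarrow>
        comult H (g \<otimes>\<^bsub>H\<^esub> h) = comult H g \<otimes>\<^bsub>tensor F H H\<^esub> comult H h"
    and comult_one: "comult H \<one>\<^bsub>H\<^esub> = \<one>\<^bsub>tensor F H H\<^esub>"
    and counit_mult:
      "\<lbrakk>g \<in> carrier H; h \<in> carrier H\<rbrakk> \<Longrightarrow>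
        counit H (g \<otimes>\<^bsub>H\<^esub> h) = counit H g \<otimes>\<^bsub>F\<^esub> counit H h"
    and counit_one: "counit H \<one>\<^bsub>H\<^esub> = \<one>\<^bsub>F\<^esub>"
    and antipode_linear: "linear_map F H H (antipode H)"
    and antipode_left:
      "h \<in> carrier H \<Longrightarrow>
        tensor_lift F H (\<lambda>x y. antipode H x \<otimes>\<^bsub>H\<^esub> y) (comult H h) = counit H h \<odot>\<^bsub>H\<^esub> \<one>\<^bsub>H\<^esub>"
    and antipode_right:
      "h \<in> carrier H \<Longrightarrow>
        tensor_lift F H (\<lambda>x y. x \<otimes>\<^bsub>H\<^esub> antipode H y) (comult H h) = counit H h \<odot>\<^bsub>H\<^esub> \<one>\<^bsub>H\<^esub>"

text \<open>Functionals are taken extensional (\<open>undefined\<close> off \<open>carrier H\<close>), so that equality of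
  elements of the finite dual is equality of functionals. The product is convolution. An ideal
  in the sense of \<open>ideal\<close> is two-sided, and it is a subspace because \<open>H\<close> is unital.\<close>

definition finite_dual_algebra ::
  "('k, 'r) ring_scheme \<Rightarrow> ('k, 'h, 'm) hopf_scheme \<Rightarrow> ('k, 'h \<Rightarrow> 'k) module" where
  "finite_dual_algebra F H =
     \<lparr>carrier = {f \<in> carrier H \<rightarrow>\<^sub>E carrier F. linear_map F H (self_module F) f \<and>
        (\<exists>I. ideal I H \<and> finite_dimensional F (quotient_module H I) \<and> (\<forall>x \<in> I. f x = \<zero>\<^bsub>F\<^esub>))},
      mult = (\<lambda>f g. \<lambda>h \<in> carrier H.
        tensor_lift F (self_module F) (\<lambda>x y. f x \<otimes>\<^bsub>F\<^esub> g y) (comult H h)),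
      one = (\<lambda>h \<in> carrier H. counit H h),
      zero = (\<lambda>h \<in> carrier H. \<zero>\<^bsub>F\<^esub>),
      add = (\<lambda>f g. \<lambda>h \<in> carrier H. f h \<oplus>\<^bsub>F\<^esub> g h),
      smult = (\<lambda>c f. \<lambda>h \<in> carrier H. c \<otimes>\<^bsub>F\<^esub> f h)\<rparr>"

text \<open>The comultiplication of \<open>f\<close> is the unique \<open>f\<^sub>1 \<otimes> f\<^sub>2\<close> in \<open>H\<^sup>0 \<otimes> H\<^sup>0\<close> with
  \<open>f\<^sub>1(x) f\<^sub>2(y) = f(xy)\<close> for all \<open>x\<close> and \<open>y\<close>.\<close>

definition finite_dual ::
  "('k, 'r) ring_scheme \<Rightarrow> ('k, 'h, 'm) hopf_scheme \<Rightarrow> ('k, 'h \<Rightarrow> 'k) hopf" where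
  "finite_dual F H = module.extend (finite_dual_algebra F H)
     (hopf.fields
       (\<lambda>f. THE t. t \<in> carrier (tensor F (finite_dual_algebra F H) (finite_dual_algebra F H)) \<and>
          (\<forall>x \<in> carrier H. \<forall>y \<in> carrier H.
            tensor_lift F (self_module F) (\<lambda>f\<^sub>1 f\<^sub>2. f\<^sub>1 x \<otimes>\<^bsub>F\<^esub> f\<^sub>2 y) t = f (x \<otimes>\<^bsub>H\<^esub> y)))
       (\<lambda>f. f \<one>\<^bsub>H\<^esub>)
       (\<lambda>f. \<lambda>h \<in> carrier H. f (antipode H h)))"

definition finite_dual_separates_points ::
  "('k, 'r) ring_scheme \<Rightarrow> ('k, 'h, 'm) hopf_scheme \<Rightarrow> bool" where
  "finite_dual_separates_points F H \<longleftrightarrow>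
     (\<forall>h \<in> carrier H. h \<noteq> \<zero>\<^bsub>H\<^esub> \<longrightarrow> (\<exists>f \<in> carrier (finite_dual F H). f h \<noteq> \<zero>\<^bsub>F\<^esub>))"


section \<open>Partial and global bimodule algebras and bicomodule algebras\<close>

text \<open>In the following four locales \<open>K\<close> and \<open>H\<close> are meant to be Hopf algebras; the axioms refer
  only to their operations. Actions \<open>K \<otimes> A \<rightarrow> A\<close> and \<open>A \<otimes> K \<rightarrow> A\<close> are given as curried bilinear
  maps.\<close>

locale partial_bimodule_algebra = assoc_algebra F A
  for F :: "('k, 'r) ring_scheme" (structure)
    and K :: "('k, 'h, 'n) hopf_scheme" (structure)
    and lact :: "'h \<Rightarrow> 'a \<Rightarrow> 'a"
    and A :: "('k, 'a, 'm) module_scheme" (structure)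
    and ract :: "'a \<Rightarrow> 'h \<Rightarrow> 'a" +
  assumes lact_bilinear: "bilinear_map F K A A lact"
    and ract_bilinear: "bilinear_map F A K A ract"
    and lact_one: "a \<in> carrier A \<Longrightarrow> lact \<one>\<^bsub>K\<^esub> a = a"
    and lact_partial:
      "\<lbrakk>a \<in> carrier A; b \<in> carrier A; g \<in> carrier K; h \<in> carrier K\<rbrakk> \<Longrightarrow>
        lact h (a \<otimes>\<^bsub>A\<^esub> lact g b) =
        tensor_lift F A (\<lambda>h\<^sub>1 h\<^sub>2. lact h\<^sub>1 a \<otimes>\<^bsub>A\<^esub> lact (h\<^sub>2 \<otimes>\<^bsub>K\<^esub> g) b) (comult K h)"
    and ract_one: "a \<in> carrier A \<Longrightarrow> ract a \<one>\<^bsub>K\<^esub> = a"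
    and ract_partial:
      "\<lbrakk>a \<in> carrier A; b \<in> carrier A; g \<in> carrier K; h \<in> carrier K\<rbrakk> \<Longrightarrow>
        ract (ract b g \<otimes>\<^bsub>A\<^esub> a) h =
        tensor_lift F A (\<lambda>h\<^sub>1 h\<^sub>2. ract b (g \<otimes>\<^bsub>K\<^esub> h\<^sub>1) \<otimes>\<^bsub>A\<^esub> ract a h\<^sub>2) (comult K h)"
    and lact_ract:
      "\<lbrakk>a \<in> carrier A; g \<in> carrier K; h \<in> carrier K\<rbrakk> \<Longrightarrow>
        lact h (ract a g) = ract (lact h a) g"

locale global_bimodule_algebra = assoc_algebra F A
  for F :: "('k, 'r) ring_scheme" (structure)
    and K :: "('k, 'h, 'n) hopf_scheme" (structure)
    and lact :: "'h \<Rightarrow> 'a \<Rightarrow> 'a"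
    and A :: "('k, 'a, 'm) module_scheme" (structure)
    and ract :: "'a \<Rightarrow> 'h \<Rightarrow> 'a" +
  assumes lact_bilinear: "bilinear_map F K A A lact"
    and ract_bilinear: "bilinear_map F A K A ract"
    and lact_one: "a \<in> carrier A \<Longrightarrow> lact \<one>\<^bsub>K\<^esub> a = a"
    and lact_assoc:
      "\<lbrakk>a \<in> carrier A; g \<in> carrier K; h \<in> carrier K\<rbrakk> \<Longrightarrow>
        lact h (lact g a) = lact (h \<otimes>\<^bsub>K\<^esub> g) a"
    and ract_one: "a \<in> carrier A \<Longrightarrow> ract a \<one>\<^bsub>K\<^esub> = a"
    and ract_assoc:
      "\<lbrakk>a \<in> carrier A; g \<in> carrier K; h \<in> carrier K\<rbrakk> \<Longrightarrow>
        ract (ract a g) h = ract a (g \<otimes>\<^bsub>K\<^esub> h)"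
    and lact_ract:
      "\<lbrakk>a \<in> carrier A; g \<in> carrier K; h \<in> carrier K\<rbrakk> \<Longrightarrow>
        lact h (ract a g) = ract (lact h a) g"
    and lact_mult:
      "\<lbrakk>a \<in> carrier A; b \<in> carrier A; h \<in> carrier K\<rbrakk> \<Longrightarrow>
        lact h (a \<otimes>\<^bsub>A\<^esub> b) =
        tensor_lift F A (\<lambda>h\<^sub>1 h\<^sub>2. lact h\<^sub>1 a \<otimes>\<^bsub>A\<^esub> lact h\<^sub>2 b) (comult K h)"
    and ract_mult:
      "\<lbrakk>a \<in> carrier A; b \<in> carrier A; h \<in> carrier K\<rbrakk> \<Longrightarrow>
        ract (a \<otimes>\<^bsub>A\<^esub> b) h =
        tensor_lift F A (\<lambda>h\<^sub>1 h\<^sub>2. ract a h\<^sub>1 \<otimes>\<^bsub>A\<^esub> ract b h\<^sub>2) (comult K h)"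

text \<open>Triple tensor products are compared in their right-nested form \<open>X \<otimes> (Y \<otimes> Z)\<close>.\<close>

locale partial_bicomodule_algebra = unital_algebra F A
  for F :: "('k, 'r) ring_scheme" (structure)
    and H :: "('k, 'h, 'n) hopf_scheme" (structure)
    and lcoact :: "'a \<Rightarrow> ('k, 'h, 'a) tensor"
    and A :: "('k, 'a, 'm) module_scheme" (structure)
    and rcoact :: "'a \<Rightarrow> ('k, 'a, 'h) tensor" +
  assumes rcoact_linear: "linear_map F A (tensor F A H) rcoact"
    and rcoact_mult:
      "\<lbrakk>a \<in> carrier A; b \<in> carrier A\<rbrakk> \<Longrightarrow>
        rcoact (a \<otimes>\<^bsub>A\<^esub> b) = rcoact a \<otimes>\<^bsub>tensor F A H\<^esub> rcoact b"
    and lcoact_linear: "linear_map F A (tensor F H A) lcoact"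
    and lcoact_mult:
      "\<lbrakk>a \<in> carrier A; b \<in> carrier A\<rbrakk> \<Longrightarrow>
        lcoact (a \<otimes>\<^bsub>A\<^esub> b) = lcoact a \<otimes>\<^bsub>tensor F H A\<^esub> lcoact b"
    and rcoact_counit: "a \<in> carrier A \<Longrightarrow> slice_right F A (counit H) (rcoact a) = a"
    and rcoact_partial:
      "a \<in> carrier A \<Longrightarrow>
        tensor_assoc F A H H (tensor_map F (tensor F A H) H rcoact id (rcoact a)) =
        tensor_assoc F A H H (pure_tensor F (tensor F A H) H (rcoact \<one>\<^bsub>A\<^esub>) \<one>\<^bsub>H\<^esub>)
          \<otimes>\<^bsub>tensor F A (tensor F H H)\<^esub>
        tensor_map F A (tensor F H H) id (comult H) (rcoact a)"
    and lcoact_counit: "a \<in> carrier A \<Longrightarrow> slice_left F A (counit H) (lcoact a) = a"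
    and lcoact_partial:
      "a \<in> carrier A \<Longrightarrow>
        tensor_map F H (tensor F H A) id lcoact (lcoact a) =
        tensor_assoc F H H A (tensor_map F (tensor F H H) A (comult H) id (lcoact a))
          \<otimes>\<^bsub>tensor F H (tensor F H A)\<^esub>
        pure_tensor F H (tensor F H A) \<one>\<^bsub>H\<^esub> (lcoact \<one>\<^bsub>A\<^esub>)"
    and coact_compat:
      "a \<in> carrier A \<Longrightarrow>
        tensor_map F H (tensor F A H) id rcoact (lcoact a) =
        tensor_assoc F H A H (tensor_map F (tensor F H A) H lcoact id (rcoact a))"

locale global_bicomodule_algebra = unital_algebra F A
  for F :: "('k, 'r) ring_scheme" (structure)
    and H :: "('k, 'h, 'n) hopf_scheme" (structure)
    and lcoact :: "'a \<Rightarrow> ('k, 'h, 'a) tensor"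
    and A :: "('k, 'a, 'm) module_scheme" (structure)
    and rcoact :: "'a \<Rightarrow> ('k, 'a, 'h) tensor" +
  assumes rcoact_linear: "linear_map F A (tensor F A H) rcoact"
    and rcoact_mult:
      "\<lbrakk>a \<in> carrier A; b \<in> carrier A\<rbrakk> \<Longrightarrow>
        rcoact (a \<otimes>\<^bsub>A\<^esub> b) = rcoact a \<otimes>\<^bsub>tensor F A H\<^esub> rcoact b"
    and lcoact_linear: "linear_map F A (tensor F H A) lcoact"
    and lcoact_mult:
      "\<lbrakk>a \<in> carrier A; b \<in> carrier A\<rbrakk> \<Longrightarrow>
        lcoact (a \<otimes>\<^bsub>A\<^esub> b) = lcoact a \<otimes>\<^bsub>tensor F H A\<^esub> lcoact b"
    and rcoact_counit: "a \<in> carrier A \<Longrightarrow> slice_right F A (counit H) (rcoact a) = a"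
    and rcoact_coassoc:
      "a \<in> carrier A \<Longrightarrow>
        tensor_assoc F A H H (tensor_map F (tensor F A H) H rcoact id (rcoact a)) =
        tensor_map F A (tensor F H H) id (comult H) (rcoact a)"
    and lcoact_counit: "a \<in> carrier A \<Longrightarrow> slice_left F A (counit H) (lcoact a) = a"
    and lcoact_coassoc:
      "a \<in> carrier A \<Longrightarrow>
        tensor_map F H (tensor F H A) id lcoact (lcoact a) =
        tensor_assoc F H H A (tensor_map F (tensor F H H) A (comult H) id (lcoact a))"
    and coact_compat:
      "a \<in> carrier A \<Longrightarrow>
        tensor_map F H (tensor F A H) id rcoact (lcoact a) =
        tensor_assoc F H A H (tensor_map F (tensor F H A) H lcoact id (rcoact a))"

definition induced_lact ::
  "('k, 'r) ring_scheme \<Rightarrow> ('k, 'a, 'm) module_scheme \<Rightarrow> ('a \<Rightarrow> ('k, 'a, 'h) tensor)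
    \<Rightarrow> ('h \<Rightarrow> 'k) \<Rightarrow> 'a \<Rightarrow> 'a" where
  "induced_lact F A rcoact f a = slice_right F A f (rcoact a)"

definition induced_ract ::
  "('k, 'r) ring_scheme \<Rightarrow> ('k, 'a, 'm) module_scheme \<Rightarrow> ('a \<Rightarrow> ('k, 'h, 'a) tensor)
    \<Rightarrow> 'a \<Rightarrow> ('h \<Rightarrow> 'k) \<Rightarrow> 'a" where
  "induced_ract F A lcoact a f = slice_left F A f (lcoact a)"

end

theory Submission
  imports Defs
begin

text \<open>
  Let \<open>S\<^sub>f = I \<otimes> f : A \<otimes> H \<rightarrow> A\<close> and \<open>L\<^sub>f = f \<otimes> I : H \<otimes> A \<rightarrow> A\<close> be the slice maps of a functional
  \<open>f\<close> on \<open>H\<close>, so that the induced actions are \<open>S\<^sub>f(\<rho> a)\<close> and \<open>L\<^sub>f(\<lambda> a)\<close>. Every axiom of a (partial)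
  bicomodule algebra is an equation in \<open>A\<close>, \<open>A \<otimes> H\<close>, \<open>H \<otimes> A\<close> or a triple tensor product, and
  evaluating its \<open>H\<close>-components at functionals from \<open>H\<^sup>0\<close> turns it into an equation between
  induced actions. Part (a) applies functionals; part (b) cancels them.

  The evaluations rest on a few identities, each proved by linear extension from pure tensors.
  Let \<open>R\<^sub>g = I \<otimes> (I \<otimes> g) : A \<otimes> (H \<otimes> H) \<rightarrow> A \<otimes> H\<close> (\<open>slice_last\<close>). Modulo associativity,
  \<open>R\<^sub>g((\<rho> \<otimes> I)t) = \<rho>(S\<^sub>g t)\<close> (\<open>slice_last_coaction\<close>), \<open>S\<^sub>f(R\<^sub>g((I \<otimes> \<Delta>)t)) = S\<^bsub>f*g\<^esub>(t)\<close>
  (\<open>slice_last_comult\<close>) and \<open>R\<^sub>g((s \<otimes> 1)w) = s R\<^sub>g(w)\<close> (\<open>slice_last_mult\<close>). Finally, if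
  \<open>f(xy) = \<Sum> u(x) v(y)\<close>, then \<open>S\<^sub>f(s r) = \<Sum> S\<^sub>u(s) S\<^sub>v(r)\<close> (\<open>slice_right_mult\<close>). There are analogous
  identities for \<open>L\<^sub>f\<close>. For a partial coaction they give
    \<open>f \<triangleright> (a (g \<triangleright> b)) = S\<^sub>f(\<rho>(a) \<rho>(1) R\<^sub>g((I \<otimes> \<Delta>)\<rho>(b))) = S\<^sub>f(\<rho>(a) R\<^sub>g((I \<otimes> \<Delta>)\<rho>(b)))
      = \<Sum> (f\<^sub>1 \<triangleright> a)((f\<^sub>2 * g) \<triangleright> b)\<close>,
  and with \<open>a = 1\<close> the same computation read backwards recovers the partial coassociativity of
  \<open>\<rho>\<close> up to slicing. In the global case the identities turn coassociativity into
  \<open>f \<triangleright> (g \<triangleright> a) = (f * g) \<triangleright> a\<close> and back. In the converse of the partial case, the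
  multiplicativity of \<open>\<rho>\<close> comes from the partial action axiom with \<open>g = \<epsilon>\<close>.

  Two facts of linear algebra are needed. First, the comultiplication of \<open>f\<close> in \<open>H\<^sup>0\<close> exists and is
  unique (\<open>comult_finite_dual\<close>): if \<open>f\<close> vanishes on an ideal \<open>I\<close> of finite codimension and
  \<open>y \<equiv> \<Sum> \<phi>\<^sub>i(y) e\<^sub>i\<close> modulo \<open>I\<close>, then \<open>f(xy) = \<Sum> f(x e\<^sub>i) \<phi>\<^sub>i(y)\<close>. Second, a set of functionals that
  separates the points of \<open>B\<close> separates, by slicing, the points of \<open>A \<otimes> B\<close>
  (\<open>slice_right_separates\<close>); applied twice, this cancels functionals in triple tensor products.
\<close>

section \<open>Linear and bilinear maps\<close>

lemma (in abelian_group) diff_eq_zero_iff: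
  assumes "a \<in> carrier G" "b \<in> carrier G"
  shows "a \<ominus> b = \<zero> \<longleftrightarrow> a = b"
  using assms minus_equality[of a "\<ominus> b"] by (auto simp: a_minus_def r_neg)

lemma (in abelian_group) diff_zero:
  assumes "a \<in> carrier G"
  shows "a \<ominus> \<zero> = a"
  using assms minus_equality[of \<zero> \<zero>] by (simp add: a_minus_def)

lemma linear_mapI:
  assumes "\<And>x. x \<in> carrier V \<Longrightarrow> \<phi> x \<in> carrier W"
    and "\<And>x y. x \<in> carrier V \<Longrightarrow> y \<in> carrier V \<Longrightarrow> \<phi> (x \<oplus>\<^bsub>V\<^esub> y) = \<phi> x \<oplus>\<^bsub>W\<^esub> \<phi> y"
    and "\<And>c x. c \<in> carrier F \<Longrightarrow> x \<in> carrier V \<Longrightarrow> \<phi> (c \<odot>\<^bsub>V\<^esub> x) = c \<odot>\<^bsub>W\<^esub> \<phi> x"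
  shows "linear_map F V W \<phi>"
  using assms by (auto simp: linear_map_def)

lemma linear_mapD:
  assumes "linear_map F V W \<phi>"
  shows "x \<in> carrier V \<Longrightarrow> \<phi> x \<in> carrier W"
    and "x \<in> carrier V \<Longrightarrow> y \<in> carrier V \<Longrightarrow> \<phi> (x \<oplus>\<^bsub>V\<^esub> y) = \<phi> x \<oplus>\<^bsub>W\<^esub> \<phi> y"
    and "c \<in> carrier F \<Longrightarrow> x \<in> carrier V \<Longrightarrow> \<phi> (c \<odot>\<^bsub>V\<^esub> x) = c \<odot>\<^bsub>W\<^esub> \<phi> x"
  using assms by (auto simp: linear_map_def)

lemma linear_map_zero:
  assumes "module F V" "module F W" "linear_map F V W \<phi>"
  shows "\<phi> \<zero>\<^bsub>V\<^esub> = \<zero>\<^bsub>W\<^esub>"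
proof -
  interpret V: module F V by fact
  interpret W: module F W by fact
  have "\<phi> (\<zero>\<^bsub>F\<^esub> \<odot>\<^bsub>V\<^esub> \<zero>\<^bsub>V\<^esub>) = \<zero>\<^bsub>F\<^esub> \<odot>\<^bsub>W\<^esub> \<phi> \<zero>\<^bsub>V\<^esub>"
    by (rule linear_mapD(3)[OF assms(3)]) simp_all
  then show ?thesis
    using linear_mapD(1)[OF assms(3)] by simp
qed

lemma linear_map_neg:
  assumes "module F V" "module F W" "linear_map F V W \<phi>" "x \<in> carrier V"
  shows "\<phi> (\<ominus>\<^bsub>V\<^esub> x) = \<ominus>\<^bsub>W\<^esub> \<phi> x"
proof -
  interpret V: module F V by fact
  interpret W: module F W by fact
  have "\<phi> (\<ominus>\<^bsub>V\<^esub> x) \<oplus>\<^bsub>W\<^esub> \<phi> x = \<phi> (\<ominus>\<^bsub>V\<^esub> x \<oplus>\<^bsub>V\<^esub> x)"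
    using assms by (simp add: linear_mapD(2)[OF assms(3)])
  also have "\<dots> = \<zero>\<^bsub>W\<^esub>"
    using assms by (simp add: V.M.l_neg linear_map_zero[OF assms(1-3)])
  finally show ?thesis
    using W.M.minus_equality[of "\<phi> (\<ominus>\<^bsub>V\<^esub> x)" "\<phi> x"] linear_mapD(1)[OF assms(3)] assms(4) by simp
qed

lemma linear_map_diff:
  assumes "module F V" "module F W" "linear_map F V W \<phi>" "x \<in> carrier V" "y \<in> carrier V"
  shows "\<phi> (x \<ominus>\<^bsub>V\<^esub> y) = \<phi> x \<ominus>\<^bsub>W\<^esub> \<phi> y"
proof -
  interpret V: module F V by fact
  show ?thesis
    using assms by (simp add: a_minus_def linear_mapD(2)[OF assms(3)] linear_map_neg)
qed

lemma linear_map_comp: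
  assumes "linear_map F V W \<psi>" "linear_map F U V \<phi>"
  shows "linear_map F U W (\<lambda>x. \<psi> (\<phi> x))"
  using assms by (auto simp: linear_map_def Pi_iff)

lemma linear_map_id: "linear_map F V V (\<lambda>x. x)"
  by (rule linear_mapI) simp_all

lemma linear_map_add:
  assumes "module F W" "linear_map F V W \<phi>" "linear_map F V W \<psi>"
  shows "linear_map F V W (\<lambda>x. \<phi> x \<oplus>\<^bsub>W\<^esub> \<psi> x)"
proof -
  interpret W: module F W by fact
  show ?thesis
    by (rule linear_mapI)
      (simp_all add: linear_mapD[OF assms(2)] linear_mapD[OF assms(3)] W.M.a_ac W.smult_r_distr)
qed

lemma linear_map_scale:
  assumes "module F W" "linear_map F V W \<phi>" "c \<in> carrier F"
  shows "linear_map F V W (\<lambda>x. c \<odot>\<^bsub>W\<^esub> \<phi> x)"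
proof -
  interpret W: module F W by fact
  show ?thesis
    by (rule linear_mapI)
      (simp_all add: assms(3) linear_mapD[OF assms(2)] W.smult_r_distr
        W.smult_assoc1[symmetric] W.R.m_comm)
qed

lemma linear_map_const_zero:
  assumes "module F W"
  shows "linear_map F V W (\<lambda>x. \<zero>\<^bsub>W\<^esub>)"
proof -
  interpret W: module F W by fact
  show ?thesis by (rule linear_mapI) simp_all
qed

lemma bilinear_mapI:
  assumes "\<And>x. x \<in> carrier V \<Longrightarrow> linear_map F W U (\<lambda>y. f x y)"
    and "\<And>y. y \<in> carrier W \<Longrightarrow> linear_map F V U (\<lambda>x. f x y)"
  shows "bilinear_map F V W U f"
  using assms by (auto simp: bilinear_map_def)

lemma bilinear_mapD:
  assumes "bilinear_map F V W U f"
  shows "x \<in> carrier V \<Longrightarrow> linear_map F W U (\<lambda>y. f x y)"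
    and "y \<in> carrier W \<Longrightarrow> linear_map F V U (\<lambda>x. f x y)"
  using assms by (auto simp: bilinear_map_def)

lemma bilinear_map_simps:
  assumes "bilinear_map F V W U f"
  shows "x \<in> carrier V \<Longrightarrow> y \<in> carrier W \<Longrightarrow> f x y \<in> carrier U"
    and "x \<in> carrier V \<Longrightarrow> x' \<in> carrier V \<Longrightarrow> y \<in> carrier W \<Longrightarrow>
      f (x \<oplus>\<^bsub>V\<^esub> x') y = f x y \<oplus>\<^bsub>U\<^esub> f x' y"
    and "x \<in> carrier V \<Longrightarrow> y \<in> carrier W \<Longrightarrow> y' \<in> carrier W \<Longrightarrow>
      f x (y \<oplus>\<^bsub>W\<^esub> y') = f x y \<oplus>\<^bsub>U\<^esub> f x y'"
    and "c \<in> carrier F \<Longrightarrow> x \<in> carrier V \<Longrightarrow> y \<in> carrier W \<Longrightarrow> f (c \<odot>\<^bsub>V\<^esub> x) y = c \<odot>\<^bsub>U\<^esub> f x y"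
    and "c \<in> carrier F \<Longrightarrow> x \<in> carrier V \<Longrightarrow> y \<in> carrier W \<Longrightarrow> f x (c \<odot>\<^bsub>W\<^esub> y) = c \<odot>\<^bsub>U\<^esub> f x y"
  using bilinear_mapD[OF assms] by (auto simp: linear_map_def Pi_iff)

lemma bilinear_map_comp:
  assumes "bilinear_map F V W U f" "linear_map F V' V \<phi>" "linear_map F W' W \<psi>"
  shows "bilinear_map F V' W' U (\<lambda>x y. f (\<phi> x) (\<psi> y))"
  by (rule bilinear_mapI)
    (auto intro!: linear_map_comp[OF bilinear_mapD(1)[OF assms(1)] assms(3)]
      linear_map_comp[OF bilinear_mapD(2)[OF assms(1)] assms(2)] linear_mapD(1)[OF assms(2)]
      linear_mapD(1)[OF assms(3)])

lemma linear_map_cong: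
  assumes "module F V" "linear_map F V W \<phi>" "\<And>x. x \<in> carrier V \<Longrightarrow> \<psi> x = \<phi> x"
  shows "linear_map F V W \<psi>"
proof -
  interpret V: module F V by fact
  show ?thesis
    using linear_mapD[OF assms(2)] by (intro linear_mapI) (simp_all add: assms(3))
qed

lemma bilinear_map_cong:
  assumes "module F V" "module F W" "bilinear_map F V W U f"
    and "\<And>x y. x \<in> carrier V \<Longrightarrow> y \<in> carrier W \<Longrightarrow> g x y = f x y"
  shows "bilinear_map F V W U g"
  using assms
  by (auto intro!: bilinear_mapI linear_map_cong[OF assms(1) bilinear_mapD(2)[OF assms(3)]]
      linear_map_cong[OF assms(2) bilinear_mapD(1)[OF assms(3)]])

lemma bilinear_map_flip:
  assumes "bilinear_map F V W U f"
  shows "bilinear_map F W V U (\<lambda>y x. f x y)"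
  using assms by (auto simp: bilinear_map_def)

lemma bilinear_map_smult:
  assumes "module F V"
  shows "bilinear_map F (self_module F) V V (smult V)"
proof -
  interpret V: module F V by fact
  show ?thesis
    by (intro bilinear_mapI linear_mapI)
      (auto simp: self_module_def V.smult_l_distr V.smult_r_distr V.smult_assoc1[symmetric]
        V.R.m_comm)
qed

lemma self_module_simps [simp]:
  "carrier (self_module F) = carrier F"
  "add (self_module F) = add F"
  "zero (self_module F) = zero F"
  "smult (self_module F) = mult F"
  "mult (self_module F) = mult F"
  by (simp_all add: self_module_def)

lemma module_cong:
  assumes "module F V"
    and "carrier W = carrier V" "add W = add V" "zero W = zero V" "smult W = smult V"
  shows "module F W"
proof -
  interpret V: module F V by fact
  show ?thesis
  proof (rule moduleI)
    show "cring F" by (rule V.R.is_cring)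
    show "abelian_group W"
      by (rule abelian_groupI) (use V.M.l_neg V.M.a_inv_closed in \<open>auto simp: assms(2-) V.M.a_ac\<close>)
  qed (auto simp: assms(2-) V.smult_l_distr V.smult_r_distr V.smult_assoc1)
qed

lemma (in cring) module_self_module: "module R (self_module R)"
proof (rule moduleI)
  show "abelian_group (self_module R)"
    by (rule abelian_groupI) (use l_neg a_inv_closed in \<open>auto simp: a_ac\<close>)
qed (auto simp: is_cring l_distr r_distr m_assoc)

section \<open>Quotient modules\<close>

lemma quotient_module_simps:
  "carrier (quotient_module V N) = a_rcosets\<^bsub>V\<^esub> N"
  "zero (quotient_module V N) = N"
  "add (quotient_module V N) = set_add V"
  "smult (quotient_module V N) = (\<lambda>c S. \<Union>x \<in> S. N +>\<^bsub>V\<^esub> (c \<odot>\<^bsub>V\<^esub> x))"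
  by (simp_all add: quotient_module_def ring.extend_def module.fields_def FactRing_def)

context module
begin

lemma submodule_abelian_subgroup: "submodule N R M \<Longrightarrow> abelian_subgroup N M"
  by (meson abelian_subgroupI3 additive_subgroupI submodule.axioms(1) M.abelian_group_axioms)

lemma submodule_zero: "submodule N R M \<Longrightarrow> \<zero>\<^bsub>M\<^esub> \<in> N"
  by (drule submodule.axioms(1), drule subgroup.one_closed) simp

lemma submodule_Inter:
  assumes "\<And>S. S \<in> \<S> \<Longrightarrow> submodule S R M" "\<S> \<noteq> {}"
  shows "submodule (\<Inter>\<S>) R M"
proof (rule submoduleI)
  show "\<zero>\<^bsub>M\<^esub> \<in> \<Inter>\<S>"
    using assms(1) by (auto intro: submodule_zero)
  show "\<Inter>\<S> \<subseteq> carrier M"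
    using submoduleE(1)[OF assms(1)] assms(2) by blast
qed (use submoduleE(3-5)[OF assms(1)] in blast)+

lemma generated_submodule_is_submodule:
  assumes "X \<subseteq> carrier M"
  shows "submodule (generated_submodule R M X) R M"
  unfolding generated_submodule_def
  by (rule submodule_Inter) (use assms carrier_is_submodule in auto)

lemma submodule_diff: "submodule N R M \<Longrightarrow> x \<in> N \<Longrightarrow> y \<in> N \<Longrightarrow> x \<ominus>\<^bsub>M\<^esub> y \<in> N"
  unfolding a_minus_def by (blast dest: submoduleE)

lemma coset_eq_iff:
  assumes "submodule N R M" "x \<in> carrier M" "y \<in> carrier M"
  shows "N +>\<^bsub>M\<^esub> x = N +>\<^bsub>M\<^esub> y \<longleftrightarrow> x \<ominus>\<^bsub>M\<^esub> y \<in> N"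
proof -
  interpret N: abelian_subgroup N M by (rule submodule_abelian_subgroup[OF assms(1)])
  show ?thesis
    unfolding a_minus_def N.a_rcos_module[OF assms(3,2), symmetric]
    using N.a_repr_independence' N.a_rcos_self assms by blast
qed

lemma quotient_smult_coset:
  assumes "submodule N R M" "x \<in> carrier M" "c \<in> carrier R"
  shows "c \<odot>\<^bsub>quotient_module M N\<^esub> (N +>\<^bsub>M\<^esub> x) = N +>\<^bsub>M\<^esub> (c \<odot>\<^bsub>M\<^esub> x)"
proof -
  interpret N: abelian_subgroup N M by (rule submodule_abelian_subgroup[OF assms(1)])
  have "N +>\<^bsub>M\<^esub> (c \<odot>\<^bsub>M\<^esub> y) = N +>\<^bsub>M\<^esub> (c \<odot>\<^bsub>M\<^esub> x)" if "y \<in> N +>\<^bsub>M\<^esub> x" for y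
  proof -
    have y: "y \<in> carrier M" using N.a_elemrcos_carrier[OF assms(2) that] .
    have "y \<oplus>\<^bsub>M\<^esub> \<ominus>\<^bsub>M\<^esub> x \<in> N" by (rule N.a_rcos_module_imp[OF assms(2) that])
    then have "c \<odot>\<^bsub>M\<^esub> (y \<oplus>\<^bsub>M\<^esub> \<ominus>\<^bsub>M\<^esub> x) \<in> N"
      by (rule submoduleE(4)[OF assms(1,3)])
    then show ?thesis
      using assms y by (simp add: coset_eq_iff a_minus_def smult_r_distr smult_r_minus)
  qed
  moreover have "x \<in> N +>\<^bsub>M\<^esub> x" by (rule N.a_rcos_self[OF assms(2)])
  ultimately have "(\<Union>y \<in> N +>\<^bsub>M\<^esub> x. N +>\<^bsub>M\<^esub> (c \<odot>\<^bsub>M\<^esub> y)) = N +>\<^bsub>M\<^esub> (c \<odot>\<^bsub>M\<^esub> x)"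
    by blast
  then show ?thesis by (simp add: quotient_module_simps)
qed

lemma quotient_add_coset:
  assumes "submodule N R M" "x \<in> carrier M" "y \<in> carrier M"
  shows "(N +>\<^bsub>M\<^esub> x) \<oplus>\<^bsub>quotient_module M N\<^esub> (N +>\<^bsub>M\<^esub> y) = N +>\<^bsub>M\<^esub> (x \<oplus>\<^bsub>M\<^esub> y)"
  using abelian_subgroup.a_rcos_sum[OF submodule_abelian_subgroup[OF assms(1)] assms(2,3)]
  by (simp add: quotient_module_simps)

lemma quotient_carrier_iff:
  "S \<in> carrier (quotient_module M N) \<longleftrightarrow> (\<exists>x \<in> carrier M. S = N +>\<^bsub>M\<^esub> x)"
  by (auto simp: quotient_module_simps A_RCOSETS_def')

lemma quotient_zero:
  assumes "submodule N R M"
  shows "\<zero>\<^bsub>quotient_module M N\<^esub> = N +>\<^bsub>M\<^esub> \<zero>\<^bsub>M\<^esub>"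
  using abelian_subgroup.a_rcos_const[OF submodule_abelian_subgroup[OF assms] submodule_zero[OF assms]]
  by (simp add: quotient_module_simps)

lemma module_quotient:
  assumes N: "submodule N R M"
  shows "module R (quotient_module M N)"
proof (rule moduleI)
  show "cring R" by (rule R.is_cring)
  note simps = quotient_carrier_iff quotient_add_coset[OF N] quotient_smult_coset[OF N]
    quotient_zero[OF N]
  show "abelian_group (quotient_module M N)"
  proof (rule abelian_groupI)
    fix S assume "S \<in> carrier (quotient_module M N)"
    then obtain x where "x \<in> carrier M" "S = N +>\<^bsub>M\<^esub> x" by (auto simp: simps)
    then show "\<exists>T \<in> carrier (quotient_module M N).
        T \<oplus>\<^bsub>quotient_module M N\<^esub> S = \<zero>\<^bsub>quotient_module M N\<^esub>"
      by (intro bexI[of _ "N +>\<^bsub>M\<^esub> (\<ominus>\<^bsub>M\<^esub> x)"]) (auto simp: simps M.l_neg)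
  qed (auto simp: simps M.a_ac)
qed (auto simp: quotient_carrier_iff quotient_add_coset[OF N] quotient_smult_coset[OF N]
    smult_l_distr smult_r_distr smult_assoc1)

lemma linear_map_coset:
  assumes "submodule N R M"
  shows "linear_map R M (quotient_module M N) (\<lambda>x. N +>\<^bsub>M\<^esub> x)"
  by (rule linear_mapI)
    (auto simp: quotient_carrier_iff quotient_add_coset[OF assms] quotient_smult_coset[OF assms])

lemma linear_map_submodule_vimage:
  assumes "module R W" "linear_map R M W \<phi>" "submodule S R W"
  shows "submodule {x \<in> carrier M. \<phi> x \<in> S} R M"
proof -
  interpret W: module R W by fact
  have "module R M" by (rule module_axioms)
  note lin = linear_map_zero[OF this assms(1,2)] linear_map_neg[OF this assms(1,2)]
    linear_mapD[OF assms(2)]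
  show ?thesis
    by (rule submoduleI)
      (auto simp: lin W.submodule_zero[OF assms(3)] W.submoduleE(3-5)[OF assms(3)])
qed

lemma linear_map_submodule_image:
  assumes "module R W" "linear_map R M W \<phi>" "submodule S R M"
  shows "submodule (\<phi> ` S) R W"
proof -
  interpret W: module R W by fact
  have "module R M" by (rule module_axioms)
  note lin = linear_map_zero[OF this assms(1,2)] linear_map_neg[OF this assms(1,2), symmetric]
    linear_mapD(1)[OF assms(2)] linear_mapD(2,3)[OF assms(2), symmetric]
  have S: "S \<subseteq> carrier M" by (rule submoduleE(1)[OF assms(3)])
  show ?thesis
  proof (rule W.submoduleI)
    show "\<zero>\<^bsub>W\<^esub> \<in> \<phi> ` S"
      using lin(1) submodule_zero[OF assms(3)] by force
    show "\<And>a. a \<in> \<phi> ` S \<Longrightarrow> \<ominus>\<^bsub>W\<^esub> a \<in> \<phi> ` S"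
      using S submoduleE(3)[OF assms(3)] by (auto simp: lin(2) subset_iff)
    show "\<And>a b. a \<in> \<phi> ` S \<Longrightarrow> b \<in> \<phi> ` S \<Longrightarrow> a \<oplus>\<^bsub>W\<^esub> b \<in> \<phi> ` S"
      using S submoduleE(5)[OF assms(3)] by (auto simp: lin(4) subset_iff)
    show "\<And>c a. c \<in> carrier R \<Longrightarrow> a \<in> \<phi> ` S \<Longrightarrow> c \<odot>\<^bsub>W\<^esub> a \<in> \<phi> ` S"
      using S submoduleE(4)[OF assms(3)] by (auto simp: lin(5) subset_iff)
  qed (use S lin(3) in auto)
qed

end

section \<open>Free modules\<close>

lemma free_module_simps:
  "u \<in> carrier (free_module F X) \<longleftrightarrow>
     u \<in> X \<rightarrow> carrier F \<and> (\<forall>x. x \<notin> X \<longrightarrow> u x = \<zero>\<^bsub>F\<^esub>) \<and> finite {x. u x \<noteq> \<zero>\<^bsub>F\<^esub>}"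
  "zero (free_module F X) = (\<lambda>x. \<zero>\<^bsub>F\<^esub>)"
  "add (free_module F X) = (\<lambda>u v x. u x \<oplus>\<^bsub>F\<^esub> v x)"
  "smult (free_module F X) = (\<lambda>c u x. c \<otimes>\<^bsub>F\<^esub> u x)"
  by (simp_all add: free_module_def)

text \<open>The linear extension to a free module of a map \<open>g\<close> defined on the basis.\<close>

definition free_lift ::
  "('k, 'r) ring_scheme \<Rightarrow> ('k, 'c, 'm) module_scheme \<Rightarrow> ('x \<Rightarrow> 'c) \<Rightarrow> ('x \<Rightarrow> 'k) \<Rightarrow> 'c" where
  "free_lift F V g u = (\<Oplus>\<^bsub>V\<^esub>p \<in> {p. u p \<noteq> \<zero>\<^bsub>F\<^esub>}. u p \<odot>\<^bsub>V\<^esub> g p)"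

lemma (in cring) free_module_mem:
  assumes "u \<in> carrier (free_module R X)"
  shows "u x \<in> carrier R"
  using assms by (cases "x \<in> X") (auto simp: free_module_simps)

lemma (in cring) module_free_module: "module R (free_module R X)"
proof (rule moduleI)
  let ?M = "free_module R X"
  have add_supp: "finite {x. u x \<oplus> v x \<noteq> \<zero>}"
    if "finite {x. u x \<noteq> \<zero>}" "finite {x. v x \<noteq> \<zero>}" for u v :: "'c \<Rightarrow> 'a"
    by (rule finite_subset[OF _ finite_UnI[OF that]]) auto
  have smult_supp: "finite {x. c \<otimes> u x \<noteq> \<zero>}"
    if "finite {x. u x \<noteq> \<zero>}" "c \<in> carrier R" for c and u :: "'c \<Rightarrow> 'a"
    by (rule finite_subset[OF _ that(1)]) (use that(2) in auto)
  note mem = free_module_mem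
  show "abelian_group ?M"
  proof (rule abelian_groupI)
    fix u assume u: "u \<in> carrier ?M"
    then have "(\<lambda>x. \<ominus> u x) \<in> carrier ?M"
      by (auto simp: free_module_simps Pi_iff elim!: finite_subset[rotated])
    then show "\<exists>v \<in> carrier ?M. v \<oplus>\<^bsub>?M\<^esub> u = \<zero>\<^bsub>?M\<^esub>"
      by (intro bexI[of _ "\<lambda>x. \<ominus> u x"]) (auto simp: free_module_simps(2-) l_neg mem[OF u])
  qed (auto simp: free_module_simps Pi_iff add_supp mem fun_eq_iff a_ac dest: mem)
  fix c u assume "c \<in> carrier R" "u \<in> carrier ?M"
  then show "c \<odot>\<^bsub>?M\<^esub> u \<in> carrier ?M"
    by (auto simp: free_module_simps Pi_iff smult_supp)
qed (auto simp: is_cring free_module_simps(2-) fun_eq_iff l_distr r_distr m_assoc free_module_mem)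

lemma (in cring) free_basis_mem [simp]:
  "x \<in> X \<Longrightarrow> free_basis R x \<in> carrier (free_module R X)"
  by (auto simp: free_module_simps free_basis_def elim!: finite_subset[rotated])

lemma free_module_induct [consumes 2, case_names zero add]:
  assumes "cring F" "u \<in> carrier (free_module F X)"
    and zero: "P (\<zero>\<^bsub>free_module F X\<^esub>)"
    and add: "\<And>c x u. c \<in> carrier F \<Longrightarrow> x \<in> X \<Longrightarrow> u \<in> carrier (free_module F X) \<Longrightarrow> P u \<Longrightarrow>
      P (c \<odot>\<^bsub>free_module F X\<^esub> free_basis F x \<oplus>\<^bsub>free_module F X\<^esub> u)"
  shows "P u"
proof -
  interpret cring F by fact
  have "P u" if "finite S" "{x. u x \<noteq> \<zero>\<^bsub>F\<^esub>} \<subseteq> S" "u \<in> carrier (free_module F X)" for S u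
    using that
  proof (induction S arbitrary: u rule: finite_induct)
    case empty
    then have "u = \<zero>\<^bsub>free_module F X\<^esub>" by (auto simp: free_module_simps)
    then show ?case using zero by simp
  next
    case (insert x S)
    show ?case
    proof (cases "u x = \<zero>\<^bsub>F\<^esub>")
      case True
      then show ?thesis using insert by (intro insert.IH) auto
    next
      case False
      let ?v = "u(x := \<zero>\<^bsub>F\<^esub>)"
      have x: "x \<in> X" "u x \<in> carrier F"
        using False insert.prems(2) by (auto simp: free_module_simps)
      have v: "?v \<in> carrier (free_module F X)"
        using insert.prems(2) by (auto simp: free_module_simps elim!: finite_subset[rotated])
      have eq: "u = u x \<odot>\<^bsub>free_module F X\<^esub> free_basis F x \<oplus>\<^bsub>free_module F X\<^esub> ?v"
        using free_module_mem[OF insert.prems(2)]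
        by (auto simp: free_module_simps(2-) free_basis_def fun_eq_iff)
      have "P ?v"
        using insert.prems by (intro insert.IH v) auto
      from add[OF x(2,1) v this] show ?thesis using eq by simp
    qed
  qed
  then show ?thesis
    using assms(2) by (auto simp: free_module_simps)
qed

context
  fixes F :: "('k, 'r) ring_scheme" and V :: "('k, 'c, 'm) module_scheme"
    and g :: "'x \<Rightarrow> 'c" and X :: "'x set"
  assumes V: "module F V" and g: "g \<in> X \<rightarrow> carrier V"
begin

interpretation V: module F V by (rule V)

lemma free_lift_superset:
  assumes "u \<in> carrier (free_module F X)" "finite S" "{p. u p \<noteq> \<zero>\<^bsub>F\<^esub>} \<subseteq> S" "S \<subseteq> X"
  shows "free_lift F V g u = (\<Oplus>\<^bsub>V\<^esub>p \<in> S. u p \<odot>\<^bsub>V\<^esub> g p)"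
proof -
  have "g p \<in> carrier V" if "p \<in> S" for p
    using g assms(4) that by auto
  then show ?thesis
    unfolding free_lift_def
    by (intro V.M.add.finprod_mono_neutral_cong_left)
      (use assms(2,3) V.R.free_module_mem[OF assms(1)] in auto)
qed

lemma free_module_support:
  "u \<in> carrier (free_module F X) \<Longrightarrow> finite {p. u p \<noteq> \<zero>\<^bsub>F\<^esub>} \<and> {p. u p \<noteq> \<zero>\<^bsub>F\<^esub>} \<subseteq> X"
  by (auto simp: free_module_simps)

lemma linear_map_free_lift: "linear_map F (free_module F X) V (free_lift F V g)"
proof (rule linear_mapI)
  let ?M = "free_module F X"
  interpret M: module F ?M by (rule V.R.module_free_module)
  note mem = V.R.free_module_mem
  fix u assume u: "u \<in> carrier ?M"
  note supp_u = free_module_support[OF u]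
  have gu: "(\<lambda>p. u p \<odot>\<^bsub>V\<^esub> g p) \<in> S \<rightarrow> carrier V" if "S \<subseteq> X" for S
    using g mem[OF u] that by auto
  show "free_lift F V g u \<in> carrier V"
    unfolding free_lift_def using gu supp_u by (intro V.M.finsum_closed) auto
  {
    fix v assume v: "v \<in> carrier ?M"
    note supp_v = free_module_support[OF v]
    let ?S = "{p. u p \<noteq> \<zero>\<^bsub>F\<^esub>} \<union> {p. v p \<noteq> \<zero>\<^bsub>F\<^esub>}"
    have S: "finite ?S" "?S \<subseteq> X" using supp_u supp_v by auto
    have gS: "g p \<in> carrier V" if "p \<in> ?S" for p using g S(2) that by blast
    have uv: "u \<oplus>\<^bsub>?M\<^esub> v \<in> carrier ?M" using u v by simp
    have "free_lift F V g (u \<oplus>\<^bsub>?M\<^esub> v) = (\<Oplus>\<^bsub>V\<^esub>p \<in> ?S. (u \<oplus>\<^bsub>?M\<^esub> v) p \<odot>\<^bsub>V\<^esub> g p)"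
      by (rule free_lift_superset[OF uv S(1) _ S(2)]) (auto simp: free_module_simps)
    also have "\<dots> = (\<Oplus>\<^bsub>V\<^esub>p \<in> ?S. u p \<odot>\<^bsub>V\<^esub> g p \<oplus>\<^bsub>V\<^esub> v p \<odot>\<^bsub>V\<^esub> g p)"
      by (rule V.M.finsum_cong')
        (use gS mem[OF u] mem[OF v] in \<open>simp_all add: free_module_simps(3) V.smult_l_distr Pi_iff\<close>)
    also have "\<dots> = (\<Oplus>\<^bsub>V\<^esub>p \<in> ?S. u p \<odot>\<^bsub>V\<^esub> g p) \<oplus>\<^bsub>V\<^esub> (\<Oplus>\<^bsub>V\<^esub>p \<in> ?S. v p \<odot>\<^bsub>V\<^esub> g p)"
      by (rule V.M.finsum_addf) (use gS mem[OF u] mem[OF v] in \<open>simp_all add: Pi_iff\<close>)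
    also have "\<dots> = free_lift F V g u \<oplus>\<^bsub>V\<^esub> free_lift F V g v"
      using free_lift_superset[OF u S(1) _ S(2)] free_lift_superset[OF v S(1) _ S(2)] by auto
    finally show "free_lift F V g (u \<oplus>\<^bsub>?M\<^esub> v) = free_lift F V g u \<oplus>\<^bsub>V\<^esub> free_lift F V g v" .
  }
  fix c assume c: "c \<in> carrier F"
  let ?S = "{p. u p \<noteq> \<zero>\<^bsub>F\<^esub>}"
  have S: "finite ?S" "?S \<subseteq> X" using supp_u by auto
  have gS: "g p \<in> carrier V" if "u p \<noteq> \<zero>\<^bsub>F\<^esub>" for p using g S(2) that by blast
  have cu: "c \<odot>\<^bsub>?M\<^esub> u \<in> carrier ?M" using u c by simp
  have "free_lift F V g (c \<odot>\<^bsub>?M\<^esub> u) = (\<Oplus>\<^bsub>V\<^esub>p \<in> ?S. (c \<odot>\<^bsub>?M\<^esub> u) p \<odot>\<^bsub>V\<^esub> g p)"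
    by (rule free_lift_superset[OF cu S(1) _ S(2)]) (use c in \<open>auto simp: free_module_simps\<close>)
  also have "\<dots> = (\<Oplus>\<^bsub>V\<^esub>p \<in> ?S. c \<odot>\<^bsub>V\<^esub> (u p \<odot>\<^bsub>V\<^esub> g p))"
    by (rule V.M.finsum_cong')
      (use gS mem[OF u] c in \<open>simp_all add: free_module_simps(4) V.smult_assoc1 Pi_iff\<close>)
  also have "\<dots> = c \<odot>\<^bsub>V\<^esub> free_lift F V g u"
    unfolding free_lift_def
    by (rule V.finsum_smult_ldistr[symmetric, OF S(1) c gu[OF S(2)]])
  finally show "free_lift F V g (c \<odot>\<^bsub>?M\<^esub> u) = c \<odot>\<^bsub>V\<^esub> free_lift F V g u" .
qed

lemma free_lift_basis:
  assumes "x \<in> X"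
  shows "free_lift F V g (free_basis F x) = g x"
proof -
  have gx: "g x \<in> carrier V" using g assms by auto
  have "free_lift F V g (free_basis F x) = (\<Oplus>\<^bsub>V\<^esub>p \<in> {x}. free_basis F x p \<odot>\<^bsub>V\<^esub> g p)"
    using assms by (intro free_lift_superset V.R.free_basis_mem) (auto simp: free_basis_def)
  also have "\<dots> = g x"
    using gx by (simp add: free_basis_def)
  finally show ?thesis .
qed

end

section \<open>The universal property of the tensor product\<close>

lemma tensor_simps [simp]:
  "carrier (tensor F A B) = carrier (tensor_space F A B)"
  "add (tensor F A B) = add (tensor_space F A B)"
  "zero (tensor F A B) = zero (tensor_space F A B)"
  "smult (tensor F A B) = smult (tensor_space F A B)"
  by (simp_all add: tensor_def)

lemma linear_map_tensor_cong:
  "linear_map F (tensor F A B) V \<phi> \<longleftrightarrow> linear_map F (tensor_space F A B) V \<phi>"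
  "linear_map F V (tensor F A B) \<psi> \<longleftrightarrow> linear_map F V (tensor_space F A B) \<psi>"
  by (simp_all add: linear_map_def)

lemma tensor_lift_eq_free_lift:
  "tensor_lift F V f t = free_lift F V (\<lambda>p. f (fst p) (snd p)) (SOME u. u \<in> t)"
  by (simp add: tensor_lift_def free_lift_def Let_def)

context
  fixes F :: "('k, 'r) ring_scheme" and A :: "('k, 'a, 'm) module_scheme"
    and B :: "('k, 'b, 'n) module_scheme"
  assumes A: "module F A" and B: "module F B"
begin

text \<open>\<open>cls u\<close> is the tensor represented by the element \<open>u\<close> of the free module.\<close>

private abbreviation (input) "TF \<equiv> tensor_free F A B"
private abbreviation (input) "TR \<equiv> tensor_relators F A B"
private abbreviation (input) "TN \<equiv> tensor_null F A B"
private abbreviation (input) "TV \<equiv> tensor_space F A B"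
private abbreviation (input) "AB \<equiv> tensor F A B"
private abbreviation (input) "pure \<equiv> pure_tensor F A B"
private abbreviation (input) "cls u \<equiv> TN +>\<^bsub>TF\<^esub> u"

interpretation A: module F A by (rule A)
interpretation B: module F B by (rule B)

lemma module_tensor_free: "module F TF"
  unfolding tensor_free_def by (rule A.R.module_free_module)

interpretation T: module F TF by (rule module_tensor_free)

lemma tensor_free_basis_mem:
  "a \<in> carrier A \<Longrightarrow> b \<in> carrier B \<Longrightarrow> free_basis F (a, b) \<in> carrier TF"
  by (simp add: tensor_free_def)

lemma tensor_relators_subset: "TR \<subseteq> carrier TF"
  by (auto simp: tensor_relators_def tensor_free_basis_mem)

lemma submodule_tensor_null: "submodule TN F TF"
  unfolding tensor_null_def
  by (rule T.generated_submodule_is_submodule[OF tensor_relators_subset])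

lemma tensor_relators_null: "TR \<subseteq> TN"
  by (auto simp: tensor_null_def generated_submodule_def)

lemma module_tensor_space: "module F TV"
  unfolding tensor_space_def by (rule T.module_quotient[OF submodule_tensor_null])

lemma module_tensor: "module F AB"
  by (rule module_cong[OF module_tensor_space]) simp_all

interpretation S: module F TV by (rule module_tensor_space)

lemma tensor_coset_linear:
  "linear_map F TF TV cls"
  unfolding tensor_space_def by (rule T.linear_map_coset[OF submodule_tensor_null])

lemma tensor_coset_eqI:
  assumes "u \<ominus>\<^bsub>TF\<^esub> v \<in> TR"
    and "u \<in> carrier TF" "v \<in> carrier TF"
  shows "cls u = cls v"
  using assms tensor_relators_null T.coset_eq_iff[OF submodule_tensor_null assms(2,3)] by blast

lemma tensor_coset_addI:
  assumes "u \<ominus>\<^bsub>TF\<^esub> (v \<oplus>\<^bsub>TF\<^esub> w) \<in> TR"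
    and "u \<in> carrier TF" "v \<in> carrier TF"
    and "w \<in> carrier TF"
  shows "cls u =
    (cls v) \<oplus>\<^bsub>TV\<^esub>
    (cls w)"
  unfolding linear_mapD(2)[OF tensor_coset_linear assms(3,4), symmetric]
  using assms by (intro tensor_coset_eqI) simp_all

lemma tensor_coset_smultI:
  assumes "u \<ominus>\<^bsub>TF\<^esub> (c \<odot>\<^bsub>TF\<^esub> v) \<in> TR"
    and "u \<in> carrier TF" "c \<in> carrier F" "v \<in> carrier TF"
  shows "cls u =
    c \<odot>\<^bsub>TV\<^esub> (cls v)"
  unfolding linear_mapD(3)[OF tensor_coset_linear assms(3,4), symmetric]
  using assms by (intro tensor_coset_eqI) simp_all

lemma bilinear_pure_tensor_space: "bilinear_map F A B TV (pure)"
proof (intro bilinear_mapI linear_mapI)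
  note coset = linear_mapD[OF tensor_coset_linear]
  fix x assume x: "x \<in> carrier A"
  show "pure x y \<in> carrier TV" if "y \<in> carrier B" for y
    unfolding pure_tensor_def using x that by (intro coset tensor_free_basis_mem)
  show "pure x (y \<oplus>\<^bsub>B\<^esub> z) =
      pure x y \<oplus>\<^bsub>TV\<^esub> pure x z"
    if "y \<in> carrier B" "z \<in> carrier B" for y z
    unfolding pure_tensor_def using x that
    by (intro tensor_coset_addI tensor_free_basis_mem) (auto simp: tensor_relators_def)
  show "pure x (c \<odot>\<^bsub>B\<^esub> y) = c \<odot>\<^bsub>TV\<^esub> pure x y"
    if "c \<in> carrier F" "y \<in> carrier B" for c y
    unfolding pure_tensor_def using x that
    by (intro tensor_coset_smultI tensor_free_basis_mem) (auto simp: tensor_relators_def)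
next
  note coset = linear_mapD[OF tensor_coset_linear]
  fix z assume z: "z \<in> carrier B"
  show "pure x z \<in> carrier TV" if "x \<in> carrier A" for x
    unfolding pure_tensor_def using z that by (intro coset tensor_free_basis_mem)
  show "pure (x \<oplus>\<^bsub>A\<^esub> y) z =
      pure x z \<oplus>\<^bsub>TV\<^esub> pure y z"
    if "x \<in> carrier A" "y \<in> carrier A" for x y
    unfolding pure_tensor_def using z that
    by (intro tensor_coset_addI tensor_free_basis_mem) (auto simp: tensor_relators_def)
  show "pure (c \<odot>\<^bsub>A\<^esub> x) z = c \<odot>\<^bsub>TV\<^esub> pure x z"
    if "c \<in> carrier F" "x \<in> carrier A" for c x
    unfolding pure_tensor_def using z that
    by (intro tensor_coset_smultI tensor_free_basis_mem) (auto simp: tensor_relators_def)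
qed

lemma bilinear_pure_tensor: "bilinear_map F A B AB (pure)"
  using bilinear_pure_tensor_space by (simp add: bilinear_map_def linear_map_tensor_cong)

lemma tensor_induct [consumes 1, case_names zero add]:
  assumes "t \<in> carrier AB"
    and zero: "P \<zero>\<^bsub>AB\<^esub>"
    and add: "\<And>a b t. a \<in> carrier A \<Longrightarrow> b \<in> carrier B \<Longrightarrow> t \<in> carrier AB \<Longrightarrow> P t \<Longrightarrow>
      P (pure a b \<oplus>\<^bsub>AB\<^esub> t)"
  shows "P t"
proof -
    note coset = linear_mapD[OF tensor_coset_linear]
  obtain u where u: "u \<in> carrier TF" "t = cls u"
    using assms(1) by (auto simp: tensor_space_def T.quotient_carrier_iff)
  have "P (cls u)"
    using A.R.is_cring u(1)[unfolded tensor_free_def]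
  proof (induction u rule: free_module_induct)
    case zero
    show ?case
      using linear_map_zero[OF module_tensor_free module_tensor_space tensor_coset_linear]
        assms(2) by (simp add: tensor_free_def)
  next
    case (add c x u)
    obtain a b where x: "x = (a, b)" "a \<in> carrier A" "b \<in> carrier B" using add(2) by auto
    have "cls (c \<odot>\<^bsub>TF\<^esub> free_basis F x \<oplus>\<^bsub>TF\<^esub> u)
        = pure (c \<odot>\<^bsub>A\<^esub> a) b \<oplus>\<^bsub>AB\<^esub> cls u"
      using add x tensor_free_basis_mem[OF x(2,3)]
      by (simp add: coset tensor_free_def[symmetric] bilinear_map_simps(4)[OF bilinear_pure_tensor_space]
          pure_tensor_def[symmetric])
    then show ?case
      using assms(3)[of "c \<odot>\<^bsub>A\<^esub> a" b "cls u"] add x coset(1)[of u]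
      by (simp add: tensor_free_def)
  qed
  then show ?thesis using u by simp
qed

context
  fixes V :: "('k, 'c, 'l) module_scheme" and f :: "'a \<Rightarrow> 'b \<Rightarrow> 'c"
  assumes V: "module F V" and f: "bilinear_map F A B V f"
begin

interpretation V: module F V by (rule V)

private abbreviation (input) "g \<equiv> \<lambda>p. f (fst p) (snd p)"

lemma free_lift_linear: "linear_map F TF V (free_lift F V g)"
  unfolding tensor_free_def
  by (rule linear_map_free_lift[OF V]) (auto simp: bilinear_map_simps(1)[OF f])

lemma free_lift_tensor_basis:
  "a \<in> carrier A \<Longrightarrow> b \<in> carrier B \<Longrightarrow> free_lift F V g (free_basis F (a, b)) = f a b"
  by (subst free_lift_basis[OF V, of _ "carrier A \<times> carrier B"])
    (auto simp: bilinear_map_simps(1)[OF f])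

lemma free_lift_null:
  assumes "u \<in> TN"
  shows "free_lift F V g u = \<zero>\<^bsub>V\<^esub>"
proof -
  note lin = linear_mapD[OF free_lift_linear]
  note diff = linear_map_diff[OF module_tensor_free V free_lift_linear]
  have zero: "submodule {\<zero>\<^bsub>V\<^esub>} F V"
    by (rule V.submoduleI) auto
  let ?K = "{u \<in> carrier TF. free_lift F V g u \<in> {\<zero>\<^bsub>V\<^esub>}}"
  have "submodule ?K F TF"
    by (rule T.linear_map_submodule_vimage[OF V free_lift_linear zero])
  moreover have "TR \<subseteq> ?K"
    unfolding tensor_relators_def
    by (auto simp: tensor_free_basis_mem lin diff free_lift_tensor_basis
        bilinear_map_simps[OF f] V.M.diff_eq_zero_iff)
  ultimately have "TN \<subseteq> ?K"
    unfolding tensor_null_def generated_submodule_def by blast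
  then show ?thesis using assms by auto
qed

lemma tensor_lift_coset:
  assumes u: "u \<in> carrier TF"
  shows "tensor_lift F V f (cls u) = free_lift F V g u"
proof -
  interpret N: abelian_subgroup "TN" "TF"
    by (rule T.submodule_abelian_subgroup[OF submodule_tensor_null])
  define v where "v = (SOME v. v \<in> cls u)"
  have v: "v \<in> cls u"
    unfolding v_def
    by (rule someI[of "\<lambda>v. v \<in> cls u", OF N.a_rcos_self[OF u]])
  have vc: "v \<in> carrier TF"
    by (rule N.a_elemrcos_carrier[OF u v])
  have "v \<ominus>\<^bsub>TF\<^esub> u \<in> TN"
    unfolding a_minus_def by (rule N.a_rcos_module_imp[OF u v])
  from free_lift_null[OF this]
  have "free_lift F V g v \<ominus>\<^bsub>V\<^esub> free_lift F V g u = \<zero>\<^bsub>V\<^esub>"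
    using linear_map_diff[OF module_tensor_free V free_lift_linear vc u] by simp
  then have "free_lift F V g v = free_lift F V g u"
    using linear_mapD(1)[OF free_lift_linear] u vc by (simp add: V.M.diff_eq_zero_iff)
  then show ?thesis
    by (simp add: tensor_lift_eq_free_lift v_def)
qed

lemma linear_map_tensor_lift_space: "linear_map F TV V (tensor_lift F V f)"
proof -
  note coset = linear_mapD[OF tensor_coset_linear]
  note lift = linear_mapD[OF free_lift_linear]
  have *: "\<exists>u. u \<in> carrier TF \<and> t = cls u"
    if "t \<in> carrier TV" for t
    using that by (auto simp: tensor_space_def T.quotient_carrier_iff)
  show ?thesis
  proof (rule linear_mapI)
    show "tensor_lift F V f t \<in> carrier V" if "t \<in> carrier TV" for t
      using *[OF that] lift by (auto simp: tensor_lift_coset)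
    show "tensor_lift F V f (s \<oplus>\<^bsub>TV\<^esub> t) = tensor_lift F V f s \<oplus>\<^bsub>V\<^esub> tensor_lift F V f t"
      if "s \<in> carrier TV" "t \<in> carrier TV" for s t
      using *[OF that(1)] *[OF that(2)]
      by (auto simp: tensor_lift_coset lift coset(2)[symmetric])
    show "tensor_lift F V f (c \<odot>\<^bsub>TV\<^esub> t) = c \<odot>\<^bsub>V\<^esub> tensor_lift F V f t"
      if "c \<in> carrier F" "t \<in> carrier TV" for c t
      using *[OF that(2)] that(1)
      by (auto simp: tensor_lift_coset lift coset(3)[symmetric])
  qed
qed

lemma linear_map_tensor_lift: "linear_map F AB V (tensor_lift F V f)"
  using linear_map_tensor_lift_space by (simp add: linear_map_tensor_cong)

lemma tensor_lift_pure:
  assumes "a \<in> carrier A" "b \<in> carrier B"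
  shows "tensor_lift F V f (pure a b) = f a b"
  using assms tensor_free_basis_mem[OF assms]
  by (simp add: pure_tensor_def tensor_lift_coset free_lift_tensor_basis)

end

text \<open>Linear extension from pure tensors: the identities between slice maps below are proved by it.\<close>

lemma tensor_ext:
  assumes V: "module F V"
    and "linear_map F AB V \<phi>" "linear_map F AB V \<psi>"
    and pure: "\<And>a b. a \<in> carrier A \<Longrightarrow> b \<in> carrier B \<Longrightarrow>
      \<phi> (pure a b) = \<psi> (pure a b)"
    and "t \<in> carrier AB"
  shows "\<phi> t = \<psi> t"
  using assms(5)
proof (induction t rule: tensor_induct)
  case zero
  show ?case
    using linear_map_zero[OF module_tensor V assms(2)] linear_map_zero[OF module_tensor V assms(3)]
    by simp
next
  case (add a b t)
  then show ?case
    using linear_mapD(2)[OF assms(2)] linear_mapD(2)[OF assms(3)] pure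
      bilinear_map_simps(1)[OF bilinear_pure_tensor]
    by simp
qed

end

lemma tensor_lift_cong:
  assumes "module F A" "module F B" "module F V" "bilinear_map F A B V f"
    and eq: "\<And>a b. a \<in> carrier A \<Longrightarrow> b \<in> carrier B \<Longrightarrow> g a b = f a b"
    and t: "t \<in> carrier (tensor F A B)"
  shows "tensor_lift F V g t = tensor_lift F V f t"
proof -
  have g: "bilinear_map F A B V g"
    by (rule bilinear_map_cong[OF assms(1,2,4)]) (rule eq)
  show ?thesis
    by (rule tensor_ext[OF assms(1-3) _ _ _ t])
      (simp_all add: linear_map_tensor_lift[OF assms(1-3)] tensor_lift_pure[OF assms(1-3)]
        g assms(4) eq)
qed

text \<open>Linear dependence on a parameter: if the bilinear map \<open>g c\<close> depends linearly on \<open>c\<close>, then so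
  does the induced map on the tensor product, at each tensor.\<close>

lemma linear_map_tensor_lift_param:
  assumes A: "module F A" and B: "module F B" and V: "module F V"
    and C: "module F C"
    and g: "\<And>c. c \<in> carrier C \<Longrightarrow> bilinear_map F A B V (g c)"
    and lin: "\<And>a b. a \<in> carrier A \<Longrightarrow> b \<in> carrier B \<Longrightarrow> linear_map F C V (\<lambda>c. g c a b)"
    and t: "t \<in> carrier (tensor F A B)"
  shows "linear_map F C V (\<lambda>c. tensor_lift F V (g c) t)"
proof -
  interpret C: module F C by fact
  note lift = linear_map_tensor_lift[OF A B V g]
  note pure = tensor_lift_pure[OF A B V g]
  show ?thesis
  proof (rule linear_mapI)
    show "tensor_lift F V (g c) t \<in> carrier V" if "c \<in> carrier C" for c
      by (rule linear_mapD(1)[OF lift[OF that] t])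
    show "tensor_lift F V (g (c \<oplus>\<^bsub>C\<^esub> d)) t = tensor_lift F V (g c) t \<oplus>\<^bsub>V\<^esub> tensor_lift F V (g d) t"
      if "c \<in> carrier C" "d \<in> carrier C" for c d
      by (rule tensor_ext[OF A B V _ _ _ t])
        (use that in \<open>auto intro!: lift linear_map_add[OF V] simp: pure linear_mapD(2)[OF lin]\<close>)
    show "tensor_lift F V (g (k \<odot>\<^bsub>C\<^esub> c)) t = k \<odot>\<^bsub>V\<^esub> tensor_lift F V (g c) t"
      if "k \<in> carrier F" "c \<in> carrier C" for k c
      by (rule tensor_ext[OF A B V _ _ _ t])
        (use that in \<open>auto intro!: lift linear_map_scale[OF V] simp: pure linear_mapD(3)[OF lin]\<close>)
  qed
qed

section \<open>Tensor products of algebras\<close>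

lemma assoc_algebraD:
  assumes "assoc_algebra F A"
  shows "field F" "module F A" "bilinear_map F A A A (mult A)"
    and "x \<in> carrier A \<Longrightarrow> y \<in> carrier A \<Longrightarrow> z \<in> carrier A \<Longrightarrow>
      (x \<otimes>\<^bsub>A\<^esub> y) \<otimes>\<^bsub>A\<^esub> z = x \<otimes>\<^bsub>A\<^esub> (y \<otimes>\<^bsub>A\<^esub> z)"
proof -
  interpret assoc_algebra F A by fact
  show "field F" "module F A" by (rule field_axioms module_axioms)+
  show "bilinear_map F A A A (mult A)"
    by (intro bilinear_mapI linear_mapI)
      (simp_all add: mult_closed mult_distrib_left mult_distrib_right smult_mult_left smult_mult_right)
  show "x \<in> carrier A \<Longrightarrow> y \<in> carrier A \<Longrightarrow> z \<in> carrier A \<Longrightarrow>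
      (x \<otimes>\<^bsub>A\<^esub> y) \<otimes>\<^bsub>A\<^esub> z = x \<otimes>\<^bsub>A\<^esub> (y \<otimes>\<^bsub>A\<^esub> z)"
    by (rule mult_assoc)
qed

lemma assoc_algebraI:
  assumes "field F" "module F A" "bilinear_map F A A A (mult A)"
    and "\<And>x y z. x \<in> carrier A \<Longrightarrow> y \<in> carrier A \<Longrightarrow> z \<in> carrier A \<Longrightarrow>
      (x \<otimes>\<^bsub>A\<^esub> y) \<otimes>\<^bsub>A\<^esub> z = x \<otimes>\<^bsub>A\<^esub> (y \<otimes>\<^bsub>A\<^esub> z)"
  shows "assoc_algebra F A"
  by (intro assoc_algebra.intro assoc_algebra_axioms.intro)
    (simp_all add: assms bilinear_map_simps[OF assms(3)])

context
  fixes F :: "('k, 'r) ring_scheme" and A :: "('k, 'a, 'm) module_scheme"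
    and B :: "('k, 'b, 'n) module_scheme"
  assumes alg_A: "assoc_algebra F A" and alg_B: "assoc_algebra F B"
begin

private lemmas A = assoc_algebraD(2)[OF alg_A] and B = assoc_algebraD(2)[OF alg_B]

private lemmas mult_A = assoc_algebraD(3)[OF alg_A] and mult_B = assoc_algebraD(3)[OF alg_B]

private abbreviation (input) "T \<equiv> tensor F A B"

private abbreviation (input) "TS \<equiv> tensor_space F A B"

private lemmas TS = module_tensor_space[OF A B]

text \<open>The multiplication of the tensor product algebra is a nested lift; the inner one is taken
  over the second argument, the outer one over the first.\<close>

lemma bilinear_tensor_mult_inner:
  assumes "a \<in> carrier A" "b \<in> carrier B"
  shows "bilinear_map F A B TS (\<lambda>a' b'. pure_tensor F A B (a \<otimes>\<^bsub>A\<^esub> a') (b \<otimes>\<^bsub>B\<^esub> b'))"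
  by (rule bilinear_map_comp[OF bilinear_pure_tensor_space[OF A B] bilinear_mapD(1)[OF mult_A assms(1)]
    bilinear_mapD(1)[OF mult_B assms(2)]])

lemma bilinear_tensor_mult_outer:
  assumes t: "t \<in> carrier T"
  shows "bilinear_map F A B TS
    (\<lambda>a b. tensor_lift F TS (\<lambda>a' b'. pure_tensor F A B (a \<otimes>\<^bsub>A\<^esub> a') (b \<otimes>\<^bsub>B\<^esub> b')) t)"
proof (rule bilinear_mapI)
  note pure = bilinear_pure_tensor_space[OF A B]
  fix a assume a: "a \<in> carrier A"
  show "linear_map F B TS
      (\<lambda>b. tensor_lift F TS (\<lambda>a' b'. pure_tensor F A B (a \<otimes>\<^bsub>A\<^esub> a') (b \<otimes>\<^bsub>B\<^esub> b')) t)"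
    by (rule linear_map_tensor_lift_param[OF A B TS B bilinear_tensor_mult_inner[OF a] _ t])
      (auto intro!: linear_map_comp[OF bilinear_mapD(1)[OF pure] bilinear_mapD(2)[OF mult_B]]
        bilinear_map_simps(1)[OF mult_A] a)
next
  note pure = bilinear_pure_tensor_space[OF A B]
  fix b assume b: "b \<in> carrier B"
  show "linear_map F A TS
      (\<lambda>a. tensor_lift F TS (\<lambda>a' b'. pure_tensor F A B (a \<otimes>\<^bsub>A\<^esub> a') (b \<otimes>\<^bsub>B\<^esub> b')) t)"
    by (rule linear_map_tensor_lift_param[OF A B TS A bilinear_tensor_mult_inner[OF _ b] _ t])
      (auto intro!: linear_map_comp[OF bilinear_mapD(2)[OF pure] bilinear_mapD(2)[OF mult_A]]
        bilinear_map_simps(1)[OF mult_B] b)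
qed

lemma tensor_mult_eq:
  "s \<otimes>\<^bsub>T\<^esub> t = tensor_lift F TS
    (\<lambda>a b. tensor_lift F TS (\<lambda>a' b'. pure_tensor F A B (a \<otimes>\<^bsub>A\<^esub> a') (b \<otimes>\<^bsub>B\<^esub> b')) t) s"
  by (simp add: tensor_def)

lemma bilinear_tensor_mult: "bilinear_map F T T T (mult T)"
proof (rule bilinear_mapI)
  fix s assume s: "s \<in> carrier T"
  have "linear_map F T TS (\<lambda>t. s \<otimes>\<^bsub>T\<^esub> t)"
    unfolding tensor_mult_eq
    by (rule linear_map_tensor_lift_param[OF A B TS module_tensor[OF A B] bilinear_tensor_mult_outer _ s])
      (auto intro!: linear_map_tensor_lift[OF A B TS bilinear_tensor_mult_inner])
  then show "linear_map F T T (\<lambda>t. s \<otimes>\<^bsub>T\<^esub> t)"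
    by (simp add: linear_map_tensor_cong)
next
  fix t assume t: "t \<in> carrier T"
  have "linear_map F T TS (\<lambda>s. s \<otimes>\<^bsub>T\<^esub> t)"
    unfolding tensor_mult_eq
    by (rule linear_map_tensor_lift[OF A B TS bilinear_tensor_mult_outer[OF t]])
  then show "linear_map F T T (\<lambda>s. s \<otimes>\<^bsub>T\<^esub> t)"
    by (simp add: linear_map_tensor_cong)
qed

lemma tensor_mult_pure:
  assumes "a \<in> carrier A" "b \<in> carrier B" "a' \<in> carrier A" "b' \<in> carrier B"
  shows "pure_tensor F A B a b \<otimes>\<^bsub>T\<^esub> pure_tensor F A B a' b' =
    pure_tensor F A B (a \<otimes>\<^bsub>A\<^esub> a') (b \<otimes>\<^bsub>B\<^esub> b')"
proof -
  have "pure_tensor F A B a' b' \<in> carrier T"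
    using assms bilinear_map_simps(1)[OF bilinear_pure_tensor[OF A B]] by simp
  then show ?thesis
    unfolding tensor_mult_eq using assms
    by (simp add: tensor_lift_pure[OF A B TS bilinear_tensor_mult_outer]
        tensor_lift_pure[OF A B TS bilinear_tensor_mult_inner])
qed

lemma assoc_algebra_tensor: "assoc_algebra F T"
proof (rule assoc_algebraI)
  show "field F" by (rule assoc_algebraD(1)[OF alg_A])
  show T: "module F T" by (rule module_tensor[OF A B])
  show mult: "bilinear_map F T T T (mult T)" by (rule bilinear_tensor_mult)
  note lin = bilinear_mapD[OF mult] and closed = bilinear_map_simps(1)[OF mult]
    and pure_closed = bilinear_map_simps(1)[OF bilinear_pure_tensor[OF A B]]
  let ?p = "pure_tensor F A B"
  have 1: "(?p a b \<otimes>\<^bsub>T\<^esub> ?p a' b') \<otimes>\<^bsub>T\<^esub> r = ?p a b \<otimes>\<^bsub>T\<^esub> (?p a' b' \<otimes>\<^bsub>T\<^esub> r)"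
    if "a \<in> carrier A" "b \<in> carrier B" "a' \<in> carrier A" "b' \<in> carrier B" "r \<in> carrier T"
    for a b a' b' r
    by (rule tensor_ext[OF A B T _ _ _ that(5)])
      (use that in \<open>auto intro!: lin linear_map_comp[OF lin(1) lin(1)] closed pure_closed
         simp: tensor_mult_pure bilinear_map_simps(1)[OF mult_A] bilinear_map_simps(1)[OF mult_B]
           assoc_algebraD(4)[OF alg_A] assoc_algebraD(4)[OF alg_B] simp del: tensor_simps\<close>)
  have 2: "(?p a b \<otimes>\<^bsub>T\<^esub> t) \<otimes>\<^bsub>T\<^esub> r = ?p a b \<otimes>\<^bsub>T\<^esub> (t \<otimes>\<^bsub>T\<^esub> r)"
    if "a \<in> carrier A" "b \<in> carrier B" "t \<in> carrier T" "r \<in> carrier T" for a b t r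
    by (rule tensor_ext[OF A B T _ _ _ that(3)])
      (use that in \<open>auto intro!: linear_map_comp[OF lin(2) lin(1)] linear_map_comp[OF lin(1) lin(2)]
         closed pure_closed simp: 1 simp del: tensor_simps\<close>)
  show "(s \<otimes>\<^bsub>T\<^esub> t) \<otimes>\<^bsub>T\<^esub> r = s \<otimes>\<^bsub>T\<^esub> (t \<otimes>\<^bsub>T\<^esub> r)"
    if "s \<in> carrier T" "t \<in> carrier T" "r \<in> carrier T" for s t r
    by (rule tensor_ext[OF A B T _ _ _ that(1)])
      (use that in \<open>auto intro!: linear_map_comp[OF lin(2) lin(2)] lin
         closed pure_closed simp: 2 simp del: tensor_simps\<close>)
qed

end

section \<open>Tensors as sums of pure tensors\<close>

text \<open>The finite sum of \<open>f a b\<close> over a list of pairs. Lists instead of finite index sets make every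
  statement about sums of pure tensors an induction on the list; repetitions count.\<close>

definition lsum :: "('k, 'c, 'm) module_scheme \<Rightarrow> ('a \<Rightarrow> 'b \<Rightarrow> 'c) \<Rightarrow> ('a \<times> 'b) list \<Rightarrow> 'c" where
  "lsum V f xs = foldr (\<lambda>p s. f (fst p) (snd p) \<oplus>\<^bsub>V\<^esub> s) xs \<zero>\<^bsub>V\<^esub>"

lemma lsum_simps [simp]:
  "lsum V f [] = \<zero>\<^bsub>V\<^esub>"
  "lsum V f (p # xs) = f (fst p) (snd p) \<oplus>\<^bsub>V\<^esub> lsum V f xs"
  by (simp_all add: lsum_def)

lemma lsum_closed:
  assumes "module F V" "\<And>a b. (a, b) \<in> set xs \<Longrightarrow> f a b \<in> carrier V"
  shows "lsum V f xs \<in> carrier V"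
proof -
  interpret V: module F V by fact
  show ?thesis using assms(2) by (induction xs) auto
qed

lemma lsum_cong:
  assumes "\<And>a b. (a, b) \<in> set xs \<Longrightarrow> f a b = g a b"
  shows "lsum V f xs = lsum V g xs"
  using assms by (induction xs) auto

lemma linear_map_lsum:
  assumes V: "module F V" and W: "module F W" and \<phi>: "linear_map F V W \<phi>"
    and "\<And>a b. (a, b) \<in> set xs \<Longrightarrow> f a b \<in> carrier V"
  shows "\<phi> (lsum V f xs) = lsum W (\<lambda>a b. \<phi> (f a b)) xs"
  using assms(4)
  by (induction xs)
    (auto simp: linear_map_zero[OF V W \<phi>] linear_mapD(2)[OF \<phi>] lsum_closed[OF V])

lemma linear_map_lsum_param:
  assumes W: "module F W" and "\<And>a b. (a, b) \<in> set xs \<Longrightarrow> linear_map F V W (\<lambda>x. f x a b)"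
  shows "linear_map F V W (\<lambda>x. lsum W (f x) xs)"
  using assms(2)
  by (induction xs) (auto intro!: linear_map_const_zero[OF W] linear_map_add[OF W])

lemma tensor_eq_lsum:
  assumes A: "module F A" and B: "module F B" and t: "t \<in> carrier (tensor F A B)"
  shows "\<exists>xs. set xs \<subseteq> carrier A \<times> carrier B \<and> t = lsum (tensor F A B) (pure_tensor F A B) xs"
  using t
proof (induction t rule: tensor_induct[OF A B, consumes 1, case_names zero add])
  case zero
  show ?case by (rule exI[of _ "[]"]) simp
next
  case (add a b t)
  then obtain xs where "set xs \<subseteq> carrier A \<times> carrier B"
      "t = lsum (tensor F A B) (pure_tensor F A B) xs"
    by blast
  with add.hyps show ?case by (intro exI[of _ "(a, b) # xs"]) simp
qed

lemma tensor_lift_lsum: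
  assumes A: "module F A" and B: "module F B" and V: "module F V"
    and f: "bilinear_map F A B V f" and xs: "set xs \<subseteq> carrier A \<times> carrier B"
  shows "tensor_lift F V f (lsum (tensor F A B) (pure_tensor F A B) xs) = lsum V f xs"
proof -
  have "tensor_lift F V f (lsum (tensor F A B) (pure_tensor F A B) xs)
      = lsum V (\<lambda>a b. tensor_lift F V f (pure_tensor F A B a b)) xs"
    by (rule linear_map_lsum[OF module_tensor[OF A B] V linear_map_tensor_lift[OF A B V f]])
      (use xs in \<open>auto intro!: bilinear_map_simps(1)[OF bilinear_pure_tensor[OF A B]] simp del: tensor_simps\<close>)
  also have "\<dots> = lsum V f xs"
    by (rule lsum_cong) (use xs in \<open>auto simp: tensor_lift_pure[OF A B V f]\<close>)
  finally show ?thesis .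
qed

section \<open>Slice maps\<close>

context
  fixes F :: "('k, 'r) ring_scheme" and A :: "('k, 'a, 'm) module_scheme"
    and B :: "('k, 'b, 'n) module_scheme"
  assumes A: "module F A" and B: "module F B"
begin

lemma bilinear_slice_right:
  assumes "linear_map F B (self_module F) f"
  shows "bilinear_map F A B A (\<lambda>a b. f b \<odot>\<^bsub>A\<^esub> a)"
  by (rule bilinear_map_flip[OF bilinear_map_comp[OF bilinear_map_smult[OF A] assms linear_map_id]])

lemma bilinear_slice_left:
  assumes "linear_map F A (self_module F) f"
  shows "bilinear_map F A B B (\<lambda>a b. f a \<odot>\<^bsub>B\<^esub> b)"
  by (rule bilinear_map_comp[OF bilinear_map_smult[OF B] assms linear_map_id])

lemma linear_slice_right:
  "linear_map F B (self_module F) f \<Longrightarrow> linear_map F (tensor F A B) A (slice_right F A f)"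
  unfolding slice_right_def by (rule linear_map_tensor_lift[OF A B A bilinear_slice_right])

lemma linear_slice_left:
  "linear_map F A (self_module F) f \<Longrightarrow> linear_map F (tensor F A B) B (slice_left F B f)"
  unfolding slice_left_def by (rule linear_map_tensor_lift[OF A B B bilinear_slice_left])

lemma slice_right_pure:
  "linear_map F B (self_module F) f \<Longrightarrow> a \<in> carrier A \<Longrightarrow> b \<in> carrier B \<Longrightarrow>
    slice_right F A f (pure_tensor F A B a b) = f b \<odot>\<^bsub>A\<^esub> a"
  unfolding slice_right_def by (rule tensor_lift_pure[OF A B A bilinear_slice_right])

lemma slice_left_pure:
  "linear_map F A (self_module F) f \<Longrightarrow> a \<in> carrier A \<Longrightarrow> b \<in> carrier B \<Longrightarrow>
    slice_left F B f (pure_tensor F A B a b) = f a \<odot>\<^bsub>B\<^esub> b"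
  unfolding slice_left_def by (rule tensor_lift_pure[OF A B B bilinear_slice_left])

lemma slice_right_cong:
  assumes "linear_map F B (self_module F) f" "\<And>b. b \<in> carrier B \<Longrightarrow> g b = f b"
    and "t \<in> carrier (tensor F A B)"
  shows "slice_right F A g t = slice_right F A f t"
  unfolding slice_right_def
  by (rule tensor_lift_cong[OF A B A bilinear_slice_right[OF assms(1)] _ assms(3)])
    (simp add: assms(2))

lemma slice_left_cong:
  assumes "linear_map F A (self_module F) f" "\<And>a. a \<in> carrier A \<Longrightarrow> g a = f a"
    and "t \<in> carrier (tensor F A B)"
  shows "slice_left F B g t = slice_left F B f t"
  unfolding slice_left_def
  by (rule tensor_lift_cong[OF A B B bilinear_slice_left[OF assms(1)] _ assms(3)])
    (simp add: assms(2))

text \<open>The shear \<open>b \<mapsto> b + d f(b) b\<^sub>0\<close> of the second components changes a sum of pure tensors by the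
  pure tensor of \<open>d\<close> times its \<open>f\<close>-slice with \<open>b\<^sub>0\<close>.\<close>

lemma lsum_shear:
  assumes f: "linear_map F B (self_module F) f" and d: "d \<in> carrier F" and b0: "b0 \<in> carrier B"
    and xs: "set xs \<subseteq> carrier A \<times> carrier B"
  shows "lsum (tensor F A B) (pure_tensor F A B)
      (map (\<lambda>p. (fst p, snd p \<oplus>\<^bsub>B\<^esub> (d \<otimes>\<^bsub>F\<^esub> f (snd p)) \<odot>\<^bsub>B\<^esub> b0)) xs) =
    pure_tensor F A B (d \<odot>\<^bsub>A\<^esub> lsum A (\<lambda>a b. f b \<odot>\<^bsub>A\<^esub> a) xs) b0 \<oplus>\<^bsub>tensor F A B\<^esub>
    lsum (tensor F A B) (pure_tensor F A B) xs"
proof -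
  interpret A: module F A by (rule A)
  interpret B: module F B by (rule B)
  interpret T: module F "tensor F A B" by (rule module_tensor[OF A B])
  note pure = bilinear_map_simps[OF bilinear_pure_tensor[OF A B]]
  show ?thesis
    using xs
  proof (induction xs)
    case Nil
    show ?case
      using linear_map_zero[OF A module_tensor[OF A B] bilinear_mapD(2)[OF bilinear_pure_tensor[OF A B] b0]] d
        T.M.l_zero[OF T.M.zero_closed]
      by simp
  next
    case (Cons p xs)
    obtain a b where p: "p = (a, b)" by (cases p)
    have ab: "a \<in> carrier A" "b \<in> carrier B" and xs: "set xs \<subseteq> carrier A \<times> carrier B"
      using Cons.prems p by auto
    have fb: "f b \<in> carrier F" using linear_mapD(1)[OF f ab(2)] by simp
    let ?s = "lsum A (\<lambda>a b. f b \<odot>\<^bsub>A\<^esub> a) xs" and ?t = "lsum (tensor F A B) (pure_tensor F A B) xs"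
    have s: "?s \<in> carrier A"
      by (rule lsum_closed[OF A]) (use xs linear_mapD(1)[OF f] in auto)
    have t: "?t \<in> carrier (tensor F A B)"
      by (rule lsum_closed[OF module_tensor[OF A B]]) (use xs pure(1) in auto)
    show ?case
      using Cons.IH[OF xs] ab fb s t d b0
      by (simp add: p pure T.M.a_ac A.smult_r_distr A.smult_assoc1[symmetric] T.smult_r_distr
        del: tensor_simps)
  qed
qed

text \<open>Functionals that separate the points of the second factor separate, by slicing, the points
  of the tensor product. The proof shortens a sum of pure tensors: if \<open>f(b\<^sub>0) \<noteq> 0\<close>, the vanishing
  \<open>f\<close>-slice expresses \<open>a\<^sub>0\<close> through the other first components, and by shearing the summand
  \<open>a\<^sub>0 \<otimes> b\<^sub>0\<close> is absorbed by the others. No basis is needed, and the functionals need not form a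
  subspace.\<close>

lemma slice_right_separates:
  assumes F: "field F"
    and D: "\<And>f. f \<in> D \<Longrightarrow> linear_map F B (self_module F) f"
    and sep: "\<And>b. b \<in> carrier B \<Longrightarrow> (\<And>f. f \<in> D \<Longrightarrow> f b = \<zero>\<^bsub>F\<^esub>) \<Longrightarrow> b = \<zero>\<^bsub>B\<^esub>"
    and t: "t \<in> carrier (tensor F A B)"
    and zero: "\<And>f. f \<in> D \<Longrightarrow> slice_right F A f t = \<zero>\<^bsub>A\<^esub>"
  shows "t = \<zero>\<^bsub>tensor F A B\<^esub>"
proof -
  interpret field F by fact
  interpret A: module F A by (rule A)
  interpret B: module F B by (rule B)
  interpret T: module F "tensor F A B" by (rule module_tensor[OF A B])
  note pure = bilinear_map_simps[OF bilinear_pure_tensor[OF A B]]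
  let ?T = "lsum (tensor F A B) (pure_tensor F A B)"
  have "?T xs = \<zero>\<^bsub>tensor F A B\<^esub>"
    if "set xs \<subseteq> carrier A \<times> carrier B" "\<And>f. f \<in> D \<Longrightarrow> slice_right F A f (?T xs) = \<zero>\<^bsub>A\<^esub>" for xs
    using that
  proof (induction "length xs" arbitrary: xs)
    case 0
    then show ?case by simp
  next
    case (Suc n ys)
    obtain a0 b0 xs where ys: "ys = (a0, b0) # xs"
      using Suc.hyps(2) by (metis Suc_length_conv surj_pair)
    have a0: "a0 \<in> carrier A" and b0: "b0 \<in> carrier B"
      and xs: "set xs \<subseteq> carrier A \<times> carrier B"
      using Suc.prems(1) ys by auto
    have Txs: "?T xs \<in> carrier (tensor F A B)"
      by (rule lsum_closed[OF module_tensor[OF A B]]) (use xs pure(1) in auto)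
    show ?case
    proof (cases "b0 = \<zero>\<^bsub>B\<^esub>")
      case True
      have "pure_tensor F A B a0 b0 = \<zero>\<^bsub>tensor F A B\<^esub>"
        using linear_map_zero[OF B module_tensor[OF A B]
            bilinear_mapD(1)[OF bilinear_pure_tensor[OF A B] a0]] True by simp
      then have eq: "?T ys = ?T xs" using Txs T.M.l_zero by (simp add: ys)
      show ?thesis
        unfolding eq
        by (rule Suc.hyps(1)[OF _ xs Suc.prems(2)[unfolded eq]]) (use Suc.hyps(2) in \<open>simp_all add: ys\<close>)
    next
      case False
      then obtain f where f: "f \<in> D" "f b0 \<noteq> \<zero>\<^bsub>F\<^esub>" using sep[OF b0] by blast
      note lin = D[OF f(1)]
      have fb0: "f b0 \<in> carrier F" using linear_mapD(1)[OF lin b0] by simp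
      then have unit: "f b0 \<in> Units F" using f(2) field_Units by blast
      let ?s = "lsum A (\<lambda>a b. f b \<odot>\<^bsub>A\<^esub> a) xs"
      define d where "d = \<ominus>\<^bsub>F\<^esub> (inv\<^bsub>F\<^esub> f b0)"
      have d: "d \<in> carrier F" using unit by (simp add: d_def)
      have s: "?s \<in> carrier A"
        by (rule lsum_closed[OF A]) (use xs linear_mapD(1)[OF lin] in auto)
      have "f b0 \<odot>\<^bsub>A\<^esub> a0 \<oplus>\<^bsub>A\<^esub> ?s = \<zero>\<^bsub>A\<^esub>"
        using Suc.prems(2)[OF f(1)] tensor_lift_lsum[OF A B A bilinear_slice_right[OF lin] Suc.prems(1)]
        by (simp add: slice_right_def ys)
      then have "?s = \<ominus>\<^bsub>A\<^esub> (f b0 \<odot>\<^bsub>A\<^esub> a0)"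
        using s fb0 a0 A.M.minus_equality[of ?s "f b0 \<odot>\<^bsub>A\<^esub> a0"] by (simp add: A.M.a_comm)
      then have "d \<odot>\<^bsub>A\<^esub> ?s = inv\<^bsub>F\<^esub> f b0 \<odot>\<^bsub>A\<^esub> (f b0 \<odot>\<^bsub>A\<^esub> a0)"
        using unit fb0 a0 by (simp add: d_def A.smult_l_minus A.smult_r_minus)
      also have "\<dots> = (inv\<^bsub>F\<^esub> f b0 \<otimes>\<^bsub>F\<^esub> f b0) \<odot>\<^bsub>A\<^esub> a0"
        using unit fb0 a0 by (simp only: A.smult_assoc1 Units_inv_closed)
      finally have a0_eq: "d \<odot>\<^bsub>A\<^esub> ?s = a0" using unit a0 by simp
      define zs where "zs = map (\<lambda>p. (fst p, snd p \<oplus>\<^bsub>B\<^esub> (d \<otimes>\<^bsub>F\<^esub> f (snd p)) \<odot>\<^bsub>B\<^esub> b0)) xs"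
      have eq: "?T ys = ?T zs"
        unfolding zs_def lsum_shear[OF lin d b0 xs] a0_eq by (simp add: ys)
      have zs: "set zs \<subseteq> carrier A \<times> carrier B"
        using xs d b0 linear_mapD(1)[OF lin] by (fastforce simp: zs_def)
      show ?thesis
        unfolding eq
        by (rule Suc.hyps(1)[OF _ zs Suc.prems(2)[unfolded eq]])
          (use Suc.hyps(2) in \<open>simp_all add: zs_def ys\<close>)
    qed
  qed
  then show ?thesis using tensor_eq_lsum[OF A B t] zero by blast
qed

end

text \<open>The mirror image, obtained by exchanging the tensor factors.\<close>

lemma slice_left_separates:
  assumes A: "module F A" and B: "module F B" and F: "field F"
    and D: "\<And>f. f \<in> D \<Longrightarrow> linear_map F A (self_module F) f"
    and sep: "\<And>a. a \<in> carrier A \<Longrightarrow> (\<And>f. f \<in> D \<Longrightarrow> f a = \<zero>\<^bsub>F\<^esub>) \<Longrightarrow> a = \<zero>\<^bsub>A\<^esub>"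
    and t: "t \<in> carrier (tensor F A B)"
    and zero: "\<And>f. f \<in> D \<Longrightarrow> slice_left F B f t = \<zero>\<^bsub>B\<^esub>"
  shows "t = \<zero>\<^bsub>tensor F A B\<^esub>"
proof -
  note AB = module_tensor[OF A B] and BA = module_tensor[OF B A]
  note pure_AB = bilinear_pure_tensor[OF A B] and pure_BA = bilinear_pure_tensor[OF B A]
  define flip where "flip = tensor_lift F (tensor F B A) (\<lambda>a b. pure_tensor F B A b a)"
  define flop where "flop = tensor_lift F (tensor F A B) (\<lambda>b a. pure_tensor F A B a b)"
  have flip: "linear_map F (tensor F A B) (tensor F B A) flip"
    unfolding flip_def by (rule linear_map_tensor_lift[OF A B BA bilinear_map_flip[OF pure_BA]])
  have flop: "linear_map F (tensor F B A) (tensor F A B) flop"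
    unfolding flop_def by (rule linear_map_tensor_lift[OF B A AB bilinear_map_flip[OF pure_AB]])
  have flip_pure: "flip (pure_tensor F A B a b) = pure_tensor F B A b a"
    if "a \<in> carrier A" "b \<in> carrier B" for a b
    unfolding flip_def by (rule tensor_lift_pure[OF A B BA bilinear_map_flip[OF pure_BA] that])
  have flop_pure: "flop (pure_tensor F B A b a) = pure_tensor F A B a b"
    if "a \<in> carrier A" "b \<in> carrier B" for a b
    unfolding flop_def by (rule tensor_lift_pure[OF B A AB bilinear_map_flip[OF pure_AB] that(2,1)])
  have "flop (flip t) = t"
    by (rule tensor_ext[OF A B AB _ _ _ t])
      (auto intro!: linear_map_comp[OF flop flip] linear_map_id simp: flip_pure flop_pure)
  moreover have "flip t = \<zero>\<^bsub>tensor F B A\<^esub>"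
  proof (rule slice_right_separates[OF B A F D sep linear_mapD(1)[OF flip t]])
    fix f assume f: "f \<in> D"
    have "slice_right F B f (flip t) = slice_left F B f t"
      by (rule tensor_ext[OF A B B _ _ _ t])
        (auto intro!: linear_map_comp[OF linear_slice_right[OF B A D[OF f]] flip]
          linear_slice_left[OF A B D[OF f]]
          simp: flip_pure slice_right_pure[OF B A D[OF f]] slice_left_pure[OF A B D[OF f]])
    then show "slice_right F B f (flip t) = \<zero>\<^bsub>B\<^esub>" using zero[OF f] by simp
  qed
  ultimately show ?thesis
    using linear_map_zero[OF BA AB flop] by simp
qed

section \<open>Subspaces of finite codimension\<close>

text \<open>\<open>N\<close> and \<open>E\<close> together span \<open>V\<close>, expressed through the submodules that contain both; this form
  matches the definition of generated submodules and avoids linear combinations.\<close>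

definition spans_modulo ::
  "('k, 'r) ring_scheme \<Rightarrow> ('k, 'a, 'm) module_scheme \<Rightarrow> 'a set \<Rightarrow> 'a set \<Rightarrow> bool" where
  "spans_modulo F V N E \<longleftrightarrow>
     (\<forall>S. submodule S F V \<longrightarrow> N \<subseteq> S \<longrightarrow> E \<subseteq> S \<longrightarrow> S = carrier V)"

text \<open>A submodule \<open>N\<close> for which \<open>V / N\<close> is finite-dimensional, stated without the quotient.\<close>

definition finite_codim ::
  "('k, 'r) ring_scheme \<Rightarrow> ('k, 'a, 'm) module_scheme \<Rightarrow> 'a set \<Rightarrow> bool" where
  "finite_codim F V N \<longleftrightarrow>
     submodule N F V \<and> (\<exists>E. finite E \<and> E \<subseteq> carrier V \<and> spans_modulo F V N E)"

lemma (in module) finite_dimensional_quotient_iff: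
  assumes N: "submodule N R M"
  shows "finite_dimensional R (quotient_module M N) \<longleftrightarrow> finite_codim R M N"
proof
  let ?Q = "quotient_module M N" and ?c = "\<lambda>x. N +>\<^bsub>M\<^esub> x"
  interpret Q: module R ?Q by (rule module_quotient[OF N])
  note lin = linear_map_coset[OF N]
  {
    assume "finite_dimensional R ?Q"
    then obtain X where X: "finite X" "X \<subseteq> carrier ?Q" "generated_submodule R ?Q X = carrier ?Q"
      by (auto simp: finite_dimensional_def)
    have "\<forall>S \<in> X. \<exists>x. x \<in> carrier M \<and> S = ?c x"
      using X(2) quotient_carrier_iff by blast
    then obtain r where r: "\<And>S. S \<in> X \<Longrightarrow> r S \<in> carrier M" "\<And>S. S \<in> X \<Longrightarrow> S = ?c (r S)"
      by metis
    have "spans_modulo R M N (r ` X)"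
      unfolding spans_modulo_def
    proof (intro allI impI)
      fix S assume S: "submodule S R M" "N \<subseteq> S" "r ` X \<subseteq> S"
      have "submodule (?c ` S) R ?Q"
        by (rule linear_map_submodule_image[OF Q.module_axioms lin S(1)])
      moreover have "X \<subseteq> ?c ` S" using r(2) S(3) by blast
      ultimately have "carrier ?Q \<subseteq> ?c ` S"
        using X(3) unfolding generated_submodule_def by blast
      then have *: "\<exists>s \<in> S. ?c x = ?c s" if "x \<in> carrier M" for x
        using linear_mapD(1)[OF lin that] by blast
      have SM: "S \<subseteq> carrier M" by (rule submoduleE(1)[OF S(1)])
      have "x \<in> S" if x: "x \<in> carrier M" for x
      proof -
        obtain s where s: "s \<in> S" "?c x = ?c s" using *[OF x] by blast
        then have "x \<ominus>\<^bsub>M\<^esub> s \<in> S" using coset_eq_iff[OF N x, of s] SM S(2) by blast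
        then have "(x \<ominus>\<^bsub>M\<^esub> s) \<oplus>\<^bsub>M\<^esub> s \<in> S" using s(1) by (rule submoduleE(5)[OF S(1)])
        then show ?thesis
          using x s(1) SM by (simp add: a_minus_def M.a_assoc M.l_neg subset_iff)
      qed
      then show "S = carrier M" using SM by blast
    qed
    then show "finite_codim R M N"
      unfolding finite_codim_def using N X(1) r(1) by blast
  }
  assume "finite_codim R M N"
  then obtain E where E: "finite E" "E \<subseteq> carrier M" "spans_modulo R M N E"
    by (auto simp: finite_codim_def)
  have "carrier ?Q \<subseteq> T" if T: "submodule T R ?Q" "?c ` E \<subseteq> T" for T
  proof -
    have "{x \<in> carrier M. ?c x \<in> T} = carrier M"
    proof (rule E(3)[unfolded spans_modulo_def, rule_format])
      show "submodule {x \<in> carrier M. ?c x \<in> T} R M"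
        by (rule linear_map_submodule_vimage[OF Q.module_axioms lin T(1)])
      have "?c x = \<zero>\<^bsub>?Q\<^esub>" if "x \<in> N" for x
        using abelian_subgroup.a_rcos_const[OF submodule_abelian_subgroup[OF N] that]
        by (simp add: quotient_module_simps)
      then show "N \<subseteq> {x \<in> carrier M. ?c x \<in> T}"
        using submoduleE(1)[OF N] Q.submodule_zero[OF T(1)] by auto
    qed (use E T in auto)
    then show ?thesis by (auto simp: quotient_carrier_iff)
  qed
  moreover have "?c ` E \<subseteq> carrier ?Q" using linear_mapD(1)[OF lin] E(2) by blast
  ultimately have "generated_submodule R ?Q (?c ` E) = carrier ?Q"
    unfolding generated_submodule_def using Q.carrier_is_submodule by blast
  then show "finite_dimensional R ?Q"
    unfolding finite_dimensional_def using E(1) \<open>?c ` E \<subseteq> carrier ?Q\<close> by blast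
qed

context module
begin

lemma finite_codim_carrier: "finite_codim R M (carrier M)"
  unfolding finite_codim_def spans_modulo_def
  using carrier_is_submodule submoduleE(1) by blast

lemma submodule_zero_singleton: "submodule {\<zero>\<^bsub>M\<^esub>} R M"
  by (rule submoduleI) auto

lemma submodule_kernel:
  assumes "linear_map R M (self_module R) \<phi>"
  shows "submodule {x \<in> carrier M. \<phi> x = \<zero>} R M"
proof -
  interpret K: module R "self_module R" by (rule R.module_self_module)
  show ?thesis
    using linear_map_submodule_vimage[OF K.module_axioms assms K.submodule_zero_singleton] by simp
qed

lemma submodule_Int: "submodule N R M \<Longrightarrow> submodule S R M \<Longrightarrow> submodule (N \<inter> S) R M"
  using submodule_Inter[of "{N, S}"] by auto

text \<open>Cutting by one more functional needs at most one more vector: some \<open>u\<close> in \<open>N\<close> on which the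
  functional does not vanish.\<close>

lemma finite_codim_Int_kernel:
  assumes F: "field R" and N: "finite_codim R M N" and \<phi>: "linear_map R M (self_module R) \<phi>"
  shows "finite_codim R M (N \<inter> {x \<in> carrier M. \<phi> x = \<zero>})"
proof -
  interpret field R by fact
  obtain E where E: "finite E" "E \<subseteq> carrier M" "spans_modulo R M N E" and sub: "submodule N R M"
    using N by (auto simp: finite_codim_def)
  have NM: "N \<subseteq> carrier M" by (rule submoduleE(1)[OF sub])
  let ?K = "N \<inter> {x \<in> carrier M. \<phi> x = \<zero>}"
  have K: "submodule ?K R M"
    by (rule submodule_Int[OF sub submodule_kernel[OF \<phi>]])
  show ?thesis
  proof (cases "\<forall>x \<in> N. \<phi> x = \<zero>")
    case True
    then have "?K = N" using NM by auto
    then show ?thesis using N by simp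
  next
    case False
    then obtain u where u: "u \<in> N" "\<phi> u \<noteq> \<zero>" by blast
    have uM: "u \<in> carrier M" using u NM by blast
    have \<phi>u: "\<phi> u \<in> carrier R" using linear_mapD(1)[OF \<phi> uM] by simp
    then have unit: "\<phi> u \<in> Units R" using u(2) field_Units by blast
    have "spans_modulo R M ?K (insert u E)"
      unfolding spans_modulo_def
    proof (intro allI impI)
      fix S assume S: "submodule S R M" "?K \<subseteq> S" "insert u E \<subseteq> S"
      have "N \<subseteq> S"
      proof
        fix x assume x: "x \<in> N"
        have xM: "x \<in> carrier M" using x NM by blast
        have \<phi>x: "\<phi> x \<in> carrier R" using linear_mapD(1)[OF \<phi> xM] by simp
        let ?c = "\<phi> x \<otimes> inv (\<phi> u)"
        have c: "?c \<in> carrier R" using \<phi>x unit by simp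
        have cu: "?c \<odot>\<^bsub>M\<^esub> u \<in> carrier M" using c uM by simp
        have "\<phi> (x \<ominus>\<^bsub>M\<^esub> ?c \<odot>\<^bsub>M\<^esub> u) = \<phi> x \<ominus>\<^bsub>self_module R\<^esub> ?c \<otimes> \<phi> u"
          using linear_map_diff[OF module_axioms R.module_self_module \<phi> xM cu]
            linear_mapD(3)[OF \<phi> c uM] by simp
        also have "?c \<otimes> \<phi> u = \<phi> x" using \<phi>x \<phi>u unit by (simp add: m_assoc)
        also have "\<phi> x \<ominus>\<^bsub>self_module R\<^esub> \<phi> x = \<zero>"
        proof -
          interpret K: module R "self_module R" by (rule R.module_self_module)
          show ?thesis using K.M.diff_eq_zero_iff[of "\<phi> x" "\<phi> x"] \<phi>x by simp
        qed
        finally have "x \<ominus>\<^bsub>M\<^esub> ?c \<odot>\<^bsub>M\<^esub> u \<in> ?K"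
          using xM cu submodule_diff[OF sub x submoduleE(4)[OF sub c u(1)]] by simp
        then have "x \<ominus>\<^bsub>M\<^esub> ?c \<odot>\<^bsub>M\<^esub> u \<in> S" using S(2) by blast
        moreover have "?c \<odot>\<^bsub>M\<^esub> u \<in> S" using submoduleE(4)[OF S(1) c] S(3) by blast
        ultimately have "(x \<ominus>\<^bsub>M\<^esub> ?c \<odot>\<^bsub>M\<^esub> u) \<oplus>\<^bsub>M\<^esub> ?c \<odot>\<^bsub>M\<^esub> u \<in> S"
          by (rule submoduleE(5)[OF S(1)])
        then show "x \<in> S"
          using xM cu by (simp add: a_minus_def M.a_assoc M.l_neg)
      qed
      then show "S = carrier M"
        using E(3) S(1,3) by (simp add: spans_modulo_def)
    qed
    then show ?thesis
      unfolding finite_codim_def using K E(1,2) uM by blast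
  qed
qed

lemma finite_codim_Int_kernels:
  assumes F: "field R" and N: "finite_codim R M N"
    and "\<And>\<phi>. \<phi> \<in> set \<phi>s \<Longrightarrow> linear_map R M (self_module R) \<phi>"
  shows "finite_codim R M (N \<inter> {x \<in> carrier M. \<forall>\<phi> \<in> set \<phi>s. \<phi> x = \<zero>})"
  using assms(3)
proof (induction \<phi>s)
  case Nil
  have "N \<inter> carrier M = N"
    using N submoduleE(1) unfolding finite_codim_def by blast
  then show ?case using N by simp
next
  case (Cons \<phi> \<phi>s)
  have "N \<inter> {x \<in> carrier M. \<forall>\<psi> \<in> set (\<phi> # \<phi>s). \<psi> x = \<zero>} =
      (N \<inter> {x \<in> carrier M. \<forall>\<psi> \<in> set \<phi>s. \<psi> x = \<zero>}) \<inter> {x \<in> carrier M. \<phi> x = \<zero>}"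
    by auto
  then show ?case
    using Cons finite_codim_Int_kernel[OF F] by simp
qed

text \<open>Coordinates modulo a subspace of finite codimension: linear functionals \<open>\<phi>\<^sub>i\<close> vanishing on
  \<open>N\<close> and vectors \<open>e\<^sub>i\<close> with \<open>h \<equiv> \<Sum> \<phi>\<^sub>i(h) e\<^sub>i\<close> modulo \<open>N\<close>. The induction removes one vector \<open>u\<close> from
  the spanning set and enlarges \<open>N\<close> to \<open>N + \<Bbbk>u\<close>; if \<open>u \<notin> N\<close>, the new coordinate of \<open>h\<close> is the
  \<open>u\<close>-coefficient of what the other coordinates leave over.\<close>

lemma finite_codim_coordinates:
  assumes F: "field R" and N: "finite_codim R M N"
  shows "\<exists>xs. (\<forall>e \<phi>. (e, \<phi>) \<in> set xs \<longrightarrow> e \<in> carrier M \<and> linear_map R M (self_module R) \<phi> \<and>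
      (\<forall>x \<in> N. \<phi> x = \<zero>)) \<and>
    (\<forall>h \<in> carrier M. h \<ominus>\<^bsub>M\<^esub> lsum M (\<lambda>e \<phi>. \<phi> h \<odot>\<^bsub>M\<^esub> e) xs \<in> N)"
proof -
  interpret field R by fact
  have "module R M" by (rule module_axioms)
  obtain E where "finite E" "E \<subseteq> carrier M" "spans_modulo R M N E" "submodule N R M"
    using N by (auto simp: finite_codim_def)
  then show ?thesis
  proof (induction E arbitrary: N rule: finite_induct)
    case empty
    then have "N = carrier M" by (simp add: spans_modulo_def)
    then show ?case by (intro exI[of _ "[]"]) (simp add: a_minus_def)
  next
    case (insert u E)
    note sub = insert.prems(3)
    have u: "u \<in> carrier M" and EM: "E \<subseteq> carrier M" using insert.prems(1) by auto
    have NM: "N \<subseteq> carrier M" by (rule submoduleE(1)[OF sub])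
    show ?case
    proof (cases "u \<in> N")
      case True
      then have "spans_modulo R M N E"
        using insert.prems(2) unfolding spans_modulo_def by blast
      then show ?thesis using insert.IH[OF EM _ sub] by blast
    next
      case False
      let ?in = "\<lambda>x c. c \<in> carrier R \<and> x \<ominus>\<^bsub>M\<^esub> c \<odot>\<^bsub>M\<^esub> u \<in> N"
      \<comment> \<open>\<open>?in x c\<close> says that \<open>c\<close> is the coefficient of \<open>u\<close> in \<open>x \<in> N + \<Bbbk>u\<close>.\<close>
      define N' where "N' = {x \<in> carrier M. \<exists>c. ?in x c}"
      have add: "?in (x \<oplus>\<^bsub>M\<^esub> y) (c \<oplus> d)"
        if "x \<in> carrier M" "y \<in> carrier M" "?in x c" "?in y d" for x y c d
      proof -
        have "(x \<oplus>\<^bsub>M\<^esub> y) \<ominus>\<^bsub>M\<^esub> (c \<oplus> d) \<odot>\<^bsub>M\<^esub> u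
            = (x \<ominus>\<^bsub>M\<^esub> c \<odot>\<^bsub>M\<^esub> u) \<oplus>\<^bsub>M\<^esub> (y \<ominus>\<^bsub>M\<^esub> d \<odot>\<^bsub>M\<^esub> u)"
          using that u by (simp add: a_minus_def smult_l_distr M.minus_add M.a_ac)
        then show ?thesis using that submoduleE(5)[OF sub] by simp
      qed
      have smult: "?in (k \<odot>\<^bsub>M\<^esub> x) (k \<otimes> c)"
        if "x \<in> carrier M" "?in x c" "k \<in> carrier R" for x c k
      proof -
        have "k \<odot>\<^bsub>M\<^esub> x \<ominus>\<^bsub>M\<^esub> (k \<otimes> c) \<odot>\<^bsub>M\<^esub> u = k \<odot>\<^bsub>M\<^esub> (x \<ominus>\<^bsub>M\<^esub> c \<odot>\<^bsub>M\<^esub> u)"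
          using that u by (simp add: a_minus_def smult_assoc1 smult_r_distr smult_r_minus)
        then show ?thesis using that submoduleE(4)[OF sub] by simp
      qed
      have N_in: "?in x \<zero>" if "x \<in> N" for x
        using that NM u M.diff_zero by auto
      have u_in: "?in u \<one>"
        using u submodule_zero[OF sub] by (simp add: a_minus_def M.r_neg)
      have unique: "c = d" if "?in x c" "?in x d" "x \<in> carrier M" for x c d
      proof (rule ccontr)
        assume "c \<noteq> d"
        have "(x \<ominus>\<^bsub>M\<^esub> c \<odot>\<^bsub>M\<^esub> u) \<ominus>\<^bsub>M\<^esub> (x \<ominus>\<^bsub>M\<^esub> d \<odot>\<^bsub>M\<^esub> u) \<in> N"
          using submodule_diff[OF sub] that by blast
        moreover have "(x \<ominus>\<^bsub>M\<^esub> c \<odot>\<^bsub>M\<^esub> u) \<ominus>\<^bsub>M\<^esub> (x \<ominus>\<^bsub>M\<^esub> d \<odot>\<^bsub>M\<^esub> u)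
            = (d \<ominus> c) \<odot>\<^bsub>M\<^esub> u"
        proof -
          have "(x \<oplus>\<^bsub>M\<^esub> \<ominus>\<^bsub>M\<^esub> p) \<oplus>\<^bsub>M\<^esub> \<ominus>\<^bsub>M\<^esub> (x \<oplus>\<^bsub>M\<^esub> \<ominus>\<^bsub>M\<^esub> q)
              = q \<oplus>\<^bsub>M\<^esub> \<ominus>\<^bsub>M\<^esub> p" if "p \<in> carrier M" "q \<in> carrier M" for p q
          proof -
            have "(x \<oplus>\<^bsub>M\<^esub> \<ominus>\<^bsub>M\<^esub> p) \<oplus>\<^bsub>M\<^esub> \<ominus>\<^bsub>M\<^esub> (x \<oplus>\<^bsub>M\<^esub> \<ominus>\<^bsub>M\<^esub> q)
              = (x \<oplus>\<^bsub>M\<^esub> \<ominus>\<^bsub>M\<^esub> x) \<oplus>\<^bsub>M\<^esub> (q \<oplus>\<^bsub>M\<^esub> \<ominus>\<^bsub>M\<^esub> p)"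
              using that \<open>x \<in> carrier M\<close> by (simp add: M.minus_add M.a_ac)
            then show ?thesis using that \<open>x \<in> carrier M\<close> by (simp add: M.r_neg)
          qed
          then show ?thesis
            using that u by (simp add: a_minus_def smult_l_distr smult_l_minus)
        qed
        ultimately have "(d \<ominus> c) \<odot>\<^bsub>M\<^esub> u \<in> N" by simp
        moreover have dc: "d \<ominus> c \<in> carrier R" "d \<ominus> c \<noteq> \<zero>"
          using that \<open>c \<noteq> d\<close> R.diff_eq_zero_iff[of d c] by auto
        then have unit: "d \<ominus> c \<in> Units R" using field_Units by blast
        ultimately have "inv (d \<ominus> c) \<odot>\<^bsub>M\<^esub> ((d \<ominus> c) \<odot>\<^bsub>M\<^esub> u) \<in> N"
          using submoduleE(4)[OF sub Units_inv_closed] by blast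
        moreover have "inv (d \<ominus> c) \<odot>\<^bsub>M\<^esub> ((d \<ominus> c) \<odot>\<^bsub>M\<^esub> u) = u"
          using unit dc(1) u by (simp add: smult_assoc1[symmetric] del: minus_closed)
        ultimately show False using False by simp
      qed
      have N'_sub: "submodule N' R M"
      proof (rule submoduleI)
        show "\<zero>\<^bsub>M\<^esub> \<in> N'"
          using N_in[OF submodule_zero[OF sub]] unfolding N'_def by blast
        show *: "k \<odot>\<^bsub>M\<^esub> x \<in> N'" if "k \<in> carrier R" "x \<in> N'" for k x
          using that smult[of x _ k] unfolding N'_def by blast
        show "\<ominus>\<^bsub>M\<^esub> x \<in> N'" if x: "x \<in> N'" for x
        proof -
          have "\<ominus>\<^bsub>M\<^esub> x = (\<ominus> \<one>) \<odot>\<^bsub>M\<^esub> x"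
            using x by (simp add: N'_def smult_l_minus)
          then show ?thesis using *[OF _ x, of "\<ominus> \<one>"] by simp
        qed
        show "x \<oplus>\<^bsub>M\<^esub> y \<in> N'" if "x \<in> N'" "y \<in> N'" for x y
          using that add[of x y] unfolding N'_def by blast
      qed (auto simp: N'_def)
      have NN': "N \<subseteq> N'" using N_in NM unfolding N'_def by blast
      have uN': "u \<in> N'" using u_in u unfolding N'_def by blast
      have "spans_modulo R M N' E"
        unfolding spans_modulo_def
      proof (intro allI impI)
        fix S assume "submodule S R M" "N' \<subseteq> S" "E \<subseteq> S"
        then show "S = carrier M"
          using NN' uN' insert.prems(2) unfolding spans_modulo_def by blast
      qed
      from insert.IH[OF EM this N'_sub] obtain xs where
        xs: "\<And>e \<phi>. (e, \<phi>) \<in> set xs \<Longrightarrow> e \<in> carrier M \<and> linear_map R M (self_module R) \<phi> \<and>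
          (\<forall>x \<in> N'. \<phi> x = \<zero>)"
        and rep: "\<And>h. h \<in> carrier M \<Longrightarrow> h \<ominus>\<^bsub>M\<^esub> lsum M (\<lambda>e \<phi>. \<phi> h \<odot>\<^bsub>M\<^esub> e) xs \<in> N'"
        by blast
      let ?L = "\<lambda>h. lsum M (\<lambda>e \<phi>. \<phi> h \<odot>\<^bsub>M\<^esub> e) xs"
      let ?r = "\<lambda>h. h \<ominus>\<^bsub>M\<^esub> ?L h"
      have L: "linear_map R M M ?L"
        by (rule linear_map_lsum_param[OF module_axioms])
          (use xs in \<open>auto intro!: linear_map_comp[OF bilinear_mapD(2)[OF bilinear_map_smult[OF module_axioms]]]\<close>)
      have r: "linear_map R M M ?r"
        by (rule linear_map_cong[OF module_axioms linear_map_add[OF module_axioms linear_map_id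
              linear_map_scale[OF module_axioms L, of "\<ominus> \<one>"]]])
          (use linear_mapD(1)[OF L] in \<open>simp_all add: a_minus_def smult_l_minus\<close>)
      define \<psi> where "\<psi> h = (THE c. ?in (?r h) c)" for h
      have \<psi>: "?in (?r h) (\<psi> h)" if h: "h \<in> carrier M" for h
      proof -
        obtain c where c: "?in (?r h) c" using rep[OF h] unfolding N'_def by blast
        have "\<exists>!c. ?in (?r h) c"
        proof (rule ex1I)
          show "?in (?r h) c" by (rule c)
          show "d = c" if "?in (?r h) d" for d
            by (rule unique[OF that c linear_mapD(1)[OF r h]])
        qed
        then show ?thesis unfolding \<psi>_def by (rule theI')
      qed
      have \<psi>_eq: "\<psi> h = c" if "h \<in> carrier M" "?in (?r h) c" for h c
        using unique[OF \<psi>[OF that(1)] that(2)] linear_mapD(1)[OF r that(1)] by simp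
      have \<psi>_lin: "linear_map R M (self_module R) \<psi>"
      proof (rule linear_mapI)
        show "\<psi> x \<in> carrier (self_module R)" if "x \<in> carrier M" for x
          using \<psi>[OF that] by simp
        show "\<psi> (x \<oplus>\<^bsub>M\<^esub> y) = \<psi> x \<oplus>\<^bsub>self_module R\<^esub> \<psi> y"
          if "x \<in> carrier M" "y \<in> carrier M" for x y
          using that add[OF linear_mapD(1)[OF r that(1)] linear_mapD(1)[OF r that(2)] \<psi>[OF that(1)] \<psi>[OF that(2)]]
          by (intro \<psi>_eq) (simp_all only: linear_mapD(2)[OF r that] self_module_simps M.a_closed)
        show "\<psi> (k \<odot>\<^bsub>M\<^esub> x) = k \<odot>\<^bsub>self_module R\<^esub> \<psi> x"
          if "k \<in> carrier R" "x \<in> carrier M" for k x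
          using that smult[OF linear_mapD(1)[OF r that(2)] \<psi>[OF that(2)] that(1)]
          by (intro \<psi>_eq) (simp_all only: linear_mapD(3)[OF r that] self_module_simps smult_closed)
      qed
      have \<psi>_N: "\<psi> x = \<zero>" if x: "x \<in> N" for x
      proof (rule \<psi>_eq)
        show xM: "x \<in> carrier M" using x NM by blast
        have "?L x = lsum M (\<lambda>e \<phi>. \<zero>\<^bsub>M\<^esub>) xs"
        proof (rule lsum_cong)
          fix e \<phi> assume "(e, \<phi>) \<in> set xs"
          from xs[OF this] show "\<phi> x \<odot>\<^bsub>M\<^esub> e = \<zero>\<^bsub>M\<^esub>" using x NN' by auto
        qed
        also have "\<dots> = \<zero>\<^bsub>M\<^esub>" by (induction xs) auto
        finally show "?in (?r x) \<zero>"
          using N_in[OF x] xM by (simp add: M.diff_zero)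
      qed
      show ?thesis
      proof (intro exI[of _ "(u, \<psi>) # xs"] conjI allI impI ballI)
        fix h assume h: "h \<in> carrier M"
        have "h \<ominus>\<^bsub>M\<^esub> lsum M (\<lambda>e \<phi>. \<phi> h \<odot>\<^bsub>M\<^esub> e) ((u, \<psi>) # xs) = ?r h \<ominus>\<^bsub>M\<^esub> \<psi> h \<odot>\<^bsub>M\<^esub> u"
          using h u \<psi>[OF h] linear_mapD(1)[OF L h] by (simp add: a_minus_def M.minus_add M.a_ac)
        then show "h \<ominus>\<^bsub>M\<^esub> lsum M (\<lambda>e \<phi>. \<phi> h \<odot>\<^bsub>M\<^esub> e) ((u, \<psi>) # xs) \<in> N"
          using \<psi>[OF h] by simp
      qed (use xs u \<psi>_lin \<psi>_N NN' in auto)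
    qed
  qed
qed

text \<open>By coordinates modulo \<open>S\<close>, the subspace \<open>S\<close> is a finite intersection of kernels.\<close>

lemma finite_codim_Int:
  assumes F: "field R" and N: "finite_codim R M N" and S: "finite_codim R M S"
  shows "finite_codim R M (N \<inter> S)"
proof -
  obtain xs where
    xs: "\<And>e \<phi>. (e, \<phi>) \<in> set xs \<Longrightarrow> e \<in> carrier M \<and> linear_map R M (self_module R) \<phi> \<and>
      (\<forall>x \<in> S. \<phi> x = \<zero>)"
    and rep: "\<And>h. h \<in> carrier M \<Longrightarrow> h \<ominus>\<^bsub>M\<^esub> lsum M (\<lambda>e \<phi>. \<phi> h \<odot>\<^bsub>M\<^esub> e) xs \<in> S"
    using finite_codim_coordinates[OF F S] by blast
  have "h \<in> S" if h: "h \<in> carrier M" "\<forall>\<phi> \<in> set (map snd xs). \<phi> h = \<zero>" for h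
  proof -
    have "lsum M (\<lambda>e \<phi>. \<phi> h \<odot>\<^bsub>M\<^esub> e) xs = lsum M (\<lambda>e \<phi>. \<zero>\<^bsub>M\<^esub>) xs"
      by (rule lsum_cong) (use xs h in force)
    also have "\<dots> = \<zero>\<^bsub>M\<^esub>" by (induction xs) auto
    finally show ?thesis using rep[OF h(1)] h(1) by (simp add: M.diff_zero)
  qed
  moreover have "S \<subseteq> carrier M" using S submoduleE(1) unfolding finite_codim_def by blast
  ultimately have "N \<inter> {x \<in> carrier M. \<forall>\<phi> \<in> set (map snd xs). \<phi> x = \<zero>} = N \<inter> S"
    using xs by fastforce
  moreover have "finite_codim R M (N \<inter> {x \<in> carrier M. \<forall>\<phi> \<in> set (map snd xs). \<phi> x = \<zero>})"
    by (rule finite_codim_Int_kernels[OF F N]) (use xs in force)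
  ultimately show ?thesis by simp
qed

end

section \<open>The finite dual\<close>

lemma finite_dual_simps [simp]:
  "carrier (finite_dual F H) = carrier (finite_dual_algebra F H)"
  "add (finite_dual F H) = add (finite_dual_algebra F H)"
  "zero (finite_dual F H) = zero (finite_dual_algebra F H)"
  "smult (finite_dual F H) = smult (finite_dual_algebra F H)"
  "mult (finite_dual F H) = mult (finite_dual_algebra F H)"
  "one (finite_dual F H) = one (finite_dual_algebra F H)"
  by (simp_all add: finite_dual_def module.extend_def)

lemma finite_dual_algebra_simps:
  "mult (finite_dual_algebra F H) f g = (\<lambda>h \<in> carrier H.
     tensor_lift F (self_module F) (\<lambda>x y. f x \<otimes>\<^bsub>F\<^esub> g y) (comult H h))"
  "one (finite_dual_algebra F H) = (\<lambda>h \<in> carrier H. counit H h)"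
  "zero (finite_dual_algebra F H) = (\<lambda>h \<in> carrier H. \<zero>\<^bsub>F\<^esub>)"
  "add (finite_dual_algebra F H) f g = (\<lambda>h \<in> carrier H. f h \<oplus>\<^bsub>F\<^esub> g h)"
  "smult (finite_dual_algebra F H) c f = (\<lambda>h \<in> carrier H. c \<otimes>\<^bsub>F\<^esub> f h)"
  by (simp_all add: finite_dual_algebra_def)

lemma (in cring) scalar_laws:
  "x \<in> carrier R \<Longrightarrow> \<ominus> x \<oplus> x = \<zero>"
  "x \<in> carrier R \<Longrightarrow> y \<in> carrier R \<Longrightarrow> z \<in> carrier R \<Longrightarrow> x \<oplus> y \<oplus> z = x \<oplus> (y \<oplus> z)"
  "x \<in> carrier R \<Longrightarrow> y \<in> carrier R \<Longrightarrow> x \<oplus> y = y \<oplus> x"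
  "x \<in> carrier R \<Longrightarrow> y \<in> carrier R \<Longrightarrow> z \<in> carrier R \<Longrightarrow> (x \<oplus> y) \<otimes> z = x \<otimes> z \<oplus> y \<otimes> z"
  "x \<in> carrier R \<Longrightarrow> y \<in> carrier R \<Longrightarrow> z \<in> carrier R \<Longrightarrow> z \<otimes> (x \<oplus> y) = z \<otimes> x \<oplus> z \<otimes> y"
  "x \<in> carrier R \<Longrightarrow> y \<in> carrier R \<Longrightarrow> z \<in> carrier R \<Longrightarrow> x \<otimes> y \<otimes> z = x \<otimes> (y \<otimes> z)"
  "x \<in> carrier R \<Longrightarrow> y \<in> carrier R \<Longrightarrow> x \<otimes> y = y \<otimes> x"
  "x \<in> carrier R \<Longrightarrow> y \<in> carrier R \<Longrightarrow> \<ominus> x \<otimes> y = \<ominus> (x \<otimes> y)"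
  by (simp_all add: l_neg a_ac m_ac l_distr r_distr l_minus r_minus r_neg)

context hopf_algebra
begin

lemmas field_F = field_axioms
lemmas module_H = module_axioms
lemmas module_F = module_self_module

lemma assoc_algebra_H: "assoc_algebra F H" ..

lemma ideal_submodule:
  assumes "ideal I H"
  shows "submodule I F H"
proof -
  interpret I: ideal I H by fact
  show ?thesis
  proof (rule submoduleI)
    fix c x assume c: "c \<in> carrier F" and x: "x \<in> I"
    have "c \<odot>\<^bsub>H\<^esub> x = (c \<odot>\<^bsub>H\<^esub> \<one>\<^bsub>H\<^esub>) \<otimes>\<^bsub>H\<^esub> x"
      using c x by (simp add: smult_mult_left)
    then show "c \<odot>\<^bsub>H\<^esub> x \<in> I"
      using I.I_l_closed[OF x, of "c \<odot>\<^bsub>H\<^esub> \<one>\<^bsub>H\<^esub>"] c by simp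
  qed (use I.a_subset in auto)
qed

abbreviation (input) "dual \<equiv> finite_dual_algebra F H"

lemma dual_mem_iff:
  "f \<in> carrier dual \<longleftrightarrow> f \<in> carrier H \<rightarrow>\<^sub>E carrier F \<and> linear_map F H (self_module F) f \<and>
     (\<exists>I. ideal I H \<and> finite_codim F H I \<and> (\<forall>x \<in> I. f x = \<zero>))"
  using finite_dimensional_quotient_iff[OF ideal_submodule]
  by (auto simp: finite_dual_algebra_def)

lemma dual_memI:
  assumes "linear_map F H (self_module F) f" "ideal I H" "finite_codim F H I"
    and "\<And>x. x \<in> I \<Longrightarrow> f x = \<zero>"
  shows "restrict f (carrier H) \<in> carrier dual"
proof -
  interpret I: ideal I H by fact
  have "linear_map F H (self_module F) (restrict f (carrier H))"
    by (rule linear_map_cong[OF module_H assms(1)]) simp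
  moreover have "\<forall>x \<in> I. restrict f (carrier H) x = \<zero>"
    using assms(4) by simp
  ultimately show ?thesis
    using linear_mapD(1)[OF assms(1)] assms(2,3) by (auto simp: dual_mem_iff)
qed

lemma dual_linear: "f \<in> carrier dual \<Longrightarrow> linear_map F H (self_module F) f"
  by (simp add: dual_mem_iff)

lemma dual_eval_closed [simp]: "f \<in> carrier dual \<Longrightarrow> h \<in> carrier H \<Longrightarrow> f h \<in> carrier F"
  using linear_mapD(1)[OF dual_linear] by simp

lemma dual_extI:
  assumes "f \<in> extensional (carrier H)" "g \<in> extensional (carrier H)"
    and "\<And>h. h \<in> carrier H \<Longrightarrow> f h = g h"
  shows "f = g"
  using assms by (rule extensionalityI)

lemma dual_extensional: "f \<in> carrier dual \<Longrightarrow> f \<in> extensional (carrier H)"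
  by (auto simp: dual_mem_iff PiE_def)

lemma dual_add_closed:
  assumes "f \<in> carrier dual" "g \<in> carrier dual"
  shows "f \<oplus>\<^bsub>dual\<^esub> g \<in> carrier dual"
proof -
  obtain I J where I: "ideal I H" "finite_codim F H I" "\<forall>x \<in> I. f x = \<zero>"
    and J: "ideal J H" "finite_codim F H J" "\<forall>x \<in> J. g x = \<zero>"
    using assms by (auto simp: dual_mem_iff)
  show ?thesis
    unfolding finite_dual_algebra_simps
  proof (rule dual_memI)
    show "linear_map F H (self_module F) (\<lambda>h. f h \<oplus> g h)"
      using linear_map_add[OF module_F dual_linear[OF assms(1)] dual_linear[OF assms(2)]] by simp
    show "ideal (I \<inter> J) H" by (rule i_intersect[OF I(1) J(1)])
    show "finite_codim F H (I \<inter> J)" by (rule finite_codim_Int[OF field_F I(2) J(2)])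
  qed (use I(3) J(3) in auto)
qed

lemma dual_smult_closed:
  assumes "c \<in> carrier F" "f \<in> carrier dual"
  shows "c \<odot>\<^bsub>dual\<^esub> f \<in> carrier dual"
proof -
  obtain I where I: "ideal I H" "finite_codim F H I" "\<forall>x \<in> I. f x = \<zero>"
    using assms by (auto simp: dual_mem_iff)
  show ?thesis
    unfolding finite_dual_algebra_simps
    by (rule dual_memI[OF _ I(1,2)])
      (use linear_map_scale[OF module_F dual_linear[OF assms(2)] assms(1)] I(3) assms(1) in auto)
qed

lemma dual_zero_closed: "\<zero>\<^bsub>dual\<^esub> \<in> carrier dual"
  unfolding finite_dual_algebra_simps
  by (rule dual_memI[OF _ oneideal finite_codim_carrier])
    (use linear_map_const_zero[OF module_F] in auto)

lemma module_dual: "module F dual"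
proof (rule moduleI)
  show "abelian_group dual"
  proof (rule abelian_groupI)
    fix f assume f: "f \<in> carrier dual"
    have "(\<ominus> \<one>) \<odot>\<^bsub>dual\<^esub> f \<in> carrier dual" using f by (intro dual_smult_closed) auto
    moreover have "(\<ominus> \<one>) \<odot>\<^bsub>dual\<^esub> f \<oplus>\<^bsub>dual\<^esub> f = \<zero>\<^bsub>dual\<^esub>"
      by (rule dual_extI) (use f in \<open>auto simp: finite_dual_algebra_simps scalar_laws(1,8)\<close>)
    ultimately show "\<exists>g \<in> carrier dual. g \<oplus>\<^bsub>dual\<^esub> f = \<zero>\<^bsub>dual\<^esub>" by blast
    show "\<zero>\<^bsub>dual\<^esub> \<oplus>\<^bsub>dual\<^esub> f = f"
      by (rule dual_extI) (use f dual_extensional in \<open>auto simp: finite_dual_algebra_simps\<close>)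
  next
    fix f g k assume fgk: "f \<in> carrier dual" "g \<in> carrier dual" "k \<in> carrier dual"
    show "f \<oplus>\<^bsub>dual\<^esub> g \<oplus>\<^bsub>dual\<^esub> k = f \<oplus>\<^bsub>dual\<^esub> (g \<oplus>\<^bsub>dual\<^esub> k)"
      by (rule dual_extI) (use fgk in \<open>auto simp: finite_dual_algebra_simps scalar_laws(2)\<close>)
  next
    fix f g assume fg: "f \<in> carrier dual" "g \<in> carrier dual"
    show "f \<oplus>\<^bsub>dual\<^esub> g = g \<oplus>\<^bsub>dual\<^esub> f"
      by (rule dual_extI) (use fg in \<open>auto simp: finite_dual_algebra_simps scalar_laws(3)\<close>)
  qed (use dual_zero_closed dual_add_closed in auto)
  show "\<one> \<odot>\<^bsub>dual\<^esub> f = f" if "f \<in> carrier dual" for f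
    by (rule dual_extI) (use that dual_extensional in \<open>auto simp: finite_dual_algebra_simps\<close>)
next
  fix c d f assume *: "c \<in> carrier F" "d \<in> carrier F" "f \<in> carrier dual"
  show "(c \<oplus> d) \<odot>\<^bsub>dual\<^esub> f = c \<odot>\<^bsub>dual\<^esub> f \<oplus>\<^bsub>dual\<^esub> d \<odot>\<^bsub>dual\<^esub> f"
    by (rule dual_extI) (use * in \<open>auto simp: finite_dual_algebra_simps scalar_laws(4)\<close>)
  show "(c \<otimes> d) \<odot>\<^bsub>dual\<^esub> f = c \<odot>\<^bsub>dual\<^esub> (d \<odot>\<^bsub>dual\<^esub> f)"
    by (rule dual_extI) (use * in \<open>auto simp: finite_dual_algebra_simps scalar_laws(6)\<close>)
next
  fix c f g assume *: "c \<in> carrier F" "f \<in> carrier dual" "g \<in> carrier dual"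
  show "c \<odot>\<^bsub>dual\<^esub> (f \<oplus>\<^bsub>dual\<^esub> g) = c \<odot>\<^bsub>dual\<^esub> f \<oplus>\<^bsub>dual\<^esub> c \<odot>\<^bsub>dual\<^esub> g"
    by (rule dual_extI) (use * in \<open>auto simp: finite_dual_algebra_simps scalar_laws(5)\<close>)
qed (use dual_smult_closed is_cring in auto)

lemma linear_eval:
  assumes "h \<in> carrier H"
  shows "linear_map F dual (self_module F) (\<lambda>f. f h)"
  by (rule linear_mapI) (use assms in \<open>auto simp: finite_dual_algebra_simps\<close>)

lemma bilinear_functional_product:
  assumes "linear_map F V (self_module F) f" "linear_map F W (self_module F) g"
  shows "bilinear_map F V W (self_module F) (\<lambda>x y. f x \<otimes> g y)"
  using bilinear_map_comp[OF bilinear_map_smult[OF module_F] assms] by simp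

lemma bilinear_eval2:
  assumes "x \<in> carrier H" "y \<in> carrier H"
  shows "bilinear_map F dual dual (self_module F) (\<lambda>u v. u x \<otimes> v y)"
  by (rule bilinear_functional_product[OF linear_eval linear_eval]) (rule assms)+

lemma dual_counit: "\<one>\<^bsub>dual\<^esub> \<in> carrier dual"
proof -
  have "finite_codim F H (carrier H \<inter> {x \<in> carrier H. counit H x = \<zero>})"
    by (rule finite_codim_Int_kernel[OF field_F finite_codim_carrier counit_linear])
  then have codim: "finite_codim F H {x \<in> carrier H. counit H x = \<zero>}"
    by (simp add: Int_def conj_commute cong: conj_cong)
  have sub: "submodule {x \<in> carrier H. counit H x = \<zero>} F H"
    by (rule submodule_kernel[OF counit_linear])
  have "counit H x \<in> carrier F" if "x \<in> carrier H" for x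
    using linear_mapD(1)[OF counit_linear that] by simp
  then have "ideal {x \<in> carrier H. counit H x = \<zero>} H"
    using submodule.axioms(1)[OF sub] by (intro idealI ring_axioms) (auto simp: counit_mult)
  then show ?thesis
    unfolding finite_dual_algebra_simps by (rule dual_memI[OF counit_linear _ codim]) simp
qed

text \<open>The pairing of \<open>H\<^sup>0 \<otimes> H\<^sup>0\<close> with \<open>H \<times> H\<close> is nondegenerate on the left, because the
  evaluations at elements of \<open>H\<close> separate the points of \<open>H\<^sup>0\<close>.\<close>

lemma dual_pairing_unique:
  assumes t: "t \<in> carrier (tensor F dual dual)"
    and zero: "\<And>x y. x \<in> carrier H \<Longrightarrow> y \<in> carrier H \<Longrightarrow>
      tensor_lift F (self_module F) (\<lambda>u v. u x \<otimes> v y) t = \<zero>"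
  shows "t = \<zero>\<^bsub>tensor F dual dual\<^esub>"
proof (rule slice_right_separates[OF module_dual module_dual field_F _ _ t])
  fix e :: "('c \<Rightarrow> 'a) \<Rightarrow> 'a" assume "e \<in> (\<lambda>y f. f y) ` carrier H"
  then obtain y where y: "y \<in> carrier H" "e = (\<lambda>f. f y)" by blast
  note lin = linear_eval[OF y(1)]
  show "linear_map F dual (self_module F) e" unfolding y(2) by (rule lin)
  note slice = linear_slice_right[OF module_dual module_dual lin]
  show "slice_right F dual e t = \<zero>\<^bsub>dual\<^esub>"
    unfolding y(2)
  proof (rule dual_extI)
    fix x assume x: "x \<in> carrier H"
    have "(slice_right F dual (\<lambda>f. f y) t) x = tensor_lift F (self_module F) (\<lambda>u v. u x \<otimes> v y) t"
      by (rule tensor_ext[OF module_dual module_dual module_F _ _ _ t])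
        (auto intro!: linear_map_comp[OF linear_eval[OF x] slice]
          linear_map_tensor_lift[OF module_dual module_dual module_F bilinear_eval2[OF x y(1)]]
          simp: slice_right_pure[OF module_dual module_dual lin]
            tensor_lift_pure[OF module_dual module_dual module_F bilinear_eval2[OF x y(1)]]
            finite_dual_algebra_simps x y(1) scalar_laws(7))
    then show "(slice_right F dual (\<lambda>f. f y) t) x = \<zero>\<^bsub>dual\<^esub> x"
      using zero[OF x y(1)] x by (simp add: finite_dual_algebra_simps)
  qed (use linear_mapD(1)[OF slice t] dual_zero_closed dual_extensional in auto)
next
  fix f assume f: "f \<in> carrier dual" "\<And>e. e \<in> (\<lambda>y f. f y) ` carrier H \<Longrightarrow> e f = \<zero>"
  show "f = \<zero>\<^bsub>dual\<^esub>"
    by (rule dual_extI) (use f dual_extensional in \<open>auto simp: finite_dual_algebra_simps\<close>)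
qed

lemma dual_product_representation:
  assumes f: "f \<in> carrier dual"
  shows "\<exists>xs. set xs \<subseteq> carrier dual \<times> carrier dual \<and>
    (\<forall>x \<in> carrier H. \<forall>y \<in> carrier H.
      f (x \<otimes>\<^bsub>H\<^esub> y) = lsum (self_module F) (\<lambda>u v. u x \<otimes> v y) xs)"
proof -
  note lin = dual_linear[OF f]
  obtain I where I: "ideal I H" "finite_codim F H I" "\<forall>x \<in> I. f x = \<zero>"
    using f by (auto simp: dual_mem_iff)
  interpret I: ideal I H by (rule I(1))
  obtain es where
    es: "\<And>e \<phi>. (e, \<phi>) \<in> set es \<Longrightarrow> e \<in> carrier H \<and> linear_map F H (self_module F) \<phi> \<and>
      (\<forall>x \<in> I. \<phi> x = \<zero>)"
    and rep: "\<And>h. h \<in> carrier H \<Longrightarrow> h \<ominus>\<^bsub>H\<^esub> lsum H (\<lambda>e \<phi>. \<phi> h \<odot>\<^bsub>H\<^esub> e) es \<in> I"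
    using finite_codim_coordinates[OF field_F I(2)] by blast
  note mult = assoc_algebraD(3)[OF assoc_algebra_H]
  define xs where "xs = map (\<lambda>p. (\<lambda>x \<in> carrier H. f (x \<otimes>\<^bsub>H\<^esub> fst p), restrict (snd p) (carrier H))) es"
  have "(\<lambda>x \<in> carrier H. f (x \<otimes>\<^bsub>H\<^esub> e)) \<in> carrier dual" if "e \<in> carrier H" for e
    by (rule dual_memI[OF linear_map_comp[OF lin bilinear_mapD(2)[OF mult that]] I(1,2)])
      (use I(3) I.I_r_closed that in auto)
  moreover have "restrict \<phi> (carrier H) \<in> carrier dual" if "(e, \<phi>) \<in> set es" for e \<phi>
    by (rule dual_memI[OF _ I(1,2)]) (use es[OF that] in auto)
  ultimately have "set xs \<subseteq> carrier dual \<times> carrier dual"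
    using es by (auto simp: xs_def)
  moreover have "f (x \<otimes>\<^bsub>H\<^esub> y) = lsum (self_module F) (\<lambda>u v. u x \<otimes> v y) xs"
    if x: "x \<in> carrier H" and y: "y \<in> carrier H" for x y
  proof -
    let ?L = "lsum H (\<lambda>e \<phi>. \<phi> y \<odot>\<^bsub>H\<^esub> e) es"
    have \<phi>y: "\<phi> y \<in> carrier F" if "(e, \<phi>) \<in> set es" for e \<phi>
      using es[OF that] linear_mapD(1)[of F H "self_module F" \<phi> y] y by simp
    have L: "?L \<in> carrier H"
      by (rule lsum_closed[OF module_H]) (use es \<phi>y in auto)
    have y_eq: "y = (y \<ominus>\<^bsub>H\<^esub> ?L) \<oplus>\<^bsub>H\<^esub> ?L"
      using y L by (simp add: a_minus_def M.a_assoc M.l_neg)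
    have in_I: "x \<otimes>\<^bsub>H\<^esub> (y \<ominus>\<^bsub>H\<^esub> ?L) \<in> I"
      by (rule I.I_l_closed[OF rep[OF y] x])
    have "f (x \<otimes>\<^bsub>H\<^esub> y) = f (x \<otimes>\<^bsub>H\<^esub> (y \<ominus>\<^bsub>H\<^esub> ?L) \<oplus>\<^bsub>H\<^esub> x \<otimes>\<^bsub>H\<^esub> ?L)"
      using bilinear_map_simps(3)[OF mult x, of "y \<ominus>\<^bsub>H\<^esub> ?L" ?L] y_eq y L by simp
    also have "\<dots> = f (x \<otimes>\<^bsub>H\<^esub> (y \<ominus>\<^bsub>H\<^esub> ?L)) \<oplus> f (x \<otimes>\<^bsub>H\<^esub> ?L)"
      using linear_mapD(2)[OF lin, of "x \<otimes>\<^bsub>H\<^esub> (y \<ominus>\<^bsub>H\<^esub> ?L)" "x \<otimes>\<^bsub>H\<^esub> ?L"] x y L by simp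
    also have "\<dots> = f (x \<otimes>\<^bsub>H\<^esub> ?L)"
      using I(3) in_I f x L by simp
    also have "\<dots> = lsum (self_module F) (\<lambda>e \<phi>. f (x \<otimes>\<^bsub>H\<^esub> (\<phi> y \<odot>\<^bsub>H\<^esub> e))) es"
      by (rule linear_map_lsum[OF module_H module_F linear_map_comp[OF lin bilinear_mapD(1)[OF mult x]]])
        (use es \<phi>y in auto)
    also have "\<dots> = lsum (self_module F) (\<lambda>e \<phi>. f (x \<otimes>\<^bsub>H\<^esub> e) \<otimes> \<phi> y) es"
      by (rule lsum_cong)
        (use es \<phi>y x f linear_mapD(3)[OF lin] in \<open>simp add: smult_mult_right scalar_laws(7)\<close>)
    also have "\<dots> = lsum (self_module F) (\<lambda>u v. u x \<otimes> v y) xs"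
      unfolding xs_def by (induction es) (use x y in auto)
    finally show ?thesis .
  qed
  ultimately show ?thesis by blast
qed

text \<open>The comultiplication of \<open>H\<^sup>0\<close>, which is a definite description, in usable form: for some
  decomposition \<open>f(xy) = \<Sum> u(x) v(y)\<close> with \<open>u\<close>, \<open>v\<close> in \<open>H\<^sup>0\<close>, lifting a bilinear map \<open>\<beta>\<close> and
  evaluating it at the comultiplication of \<open>f\<close> gives \<open>\<Sum> \<beta>(u, v)\<close>.\<close>

lemma comult_finite_dual:
  fixes V :: "('a, 'v, 'n) module_scheme"
  assumes f: "f \<in> carrier dual" and V: "module F V"
  shows "\<exists>xs. set xs \<subseteq> carrier dual \<times> carrier dual \<and>
    (\<forall>x \<in> carrier H. \<forall>y \<in> carrier H.
      f (x \<otimes>\<^bsub>H\<^esub> y) = lsum (self_module F) (\<lambda>u v. u x \<otimes> v y) xs) \<and>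
    (\<forall>\<beta>. bilinear_map F dual dual V \<beta> \<longrightarrow>
      tensor_lift F V \<beta> (comult (finite_dual F H) f) = lsum V \<beta> xs)"
proof -
  obtain xs where xs: "set xs \<subseteq> carrier dual \<times> carrier dual"
    and eq: "\<And>x y. x \<in> carrier H \<Longrightarrow> y \<in> carrier H \<Longrightarrow>
      f (x \<otimes>\<^bsub>H\<^esub> y) = lsum (self_module F) (\<lambda>u v. u x \<otimes> v y) xs"
    using dual_product_representation[OF f] by blast
  let ?t = "lsum (tensor F dual dual) (pure_tensor F dual dual) xs"
  note T = module_tensor[OF module_dual module_dual]
  interpret T: module F "tensor F dual dual" by (rule T)
  interpret FF: module F "self_module F" by (rule module_F)
  have t: "?t \<in> carrier (tensor F dual dual)"
    by (rule lsum_closed[OF T])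
      (use xs bilinear_map_simps(1)[OF bilinear_pure_tensor[OF module_dual module_dual]] in auto)
  have "comult (finite_dual F H) f = ?t"
    unfolding finite_dual_def module.extend_def hopf.fields_def
  proof (simp del: tensor_simps, rule the_equality)
    let ?p = "\<lambda>x y s. tensor_lift F (self_module F) (\<lambda>u v. u x \<otimes> v y) s"
    have t_eq: "?p x y ?t = f (x \<otimes>\<^bsub>H\<^esub> y)" if "x \<in> carrier H" "y \<in> carrier H" for x y
      unfolding eq[OF that]
      by (rule tensor_lift_lsum[OF module_dual module_dual module_F bilinear_eval2[OF that] xs])
    then show "?t \<in> carrier (tensor F dual dual) \<and>
        (\<forall>x \<in> carrier H. \<forall>y \<in> carrier H. ?p x y ?t = f (x \<otimes>\<^bsub>H\<^esub> y))"
      using t by blast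
    fix s assume s: "s \<in> carrier (tensor F dual dual) \<and>
        (\<forall>x \<in> carrier H. \<forall>y \<in> carrier H. ?p x y s = f (x \<otimes>\<^bsub>H\<^esub> y))"
    have "s \<ominus>\<^bsub>tensor F dual dual\<^esub> ?t = \<zero>\<^bsub>tensor F dual dual\<^esub>"
    proof (rule dual_pairing_unique)
      show "s \<ominus>\<^bsub>tensor F dual dual\<^esub> ?t \<in> carrier (tensor F dual dual)"
        using s t by (auto simp del: tensor_simps)
      fix x y assume xy: "x \<in> carrier H" "y \<in> carrier H"
      have "?p x y (s \<ominus>\<^bsub>tensor F dual dual\<^esub> ?t) = ?p x y s \<ominus>\<^bsub>self_module F\<^esub> ?p x y ?t"
        by (rule linear_map_diff[OF T module_F linear_map_tensor_lift[OF module_dual module_dual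
          module_F bilinear_eval2[OF xy]]]) (use s t in auto)
      also have "\<dots> = \<zero>"
        using s xy t_eq[OF xy] f FF.M.diff_eq_zero_iff[of "f (x \<otimes>\<^bsub>H\<^esub> y)" "f (x \<otimes>\<^bsub>H\<^esub> y)"] by simp
      finally show "?p x y (s \<ominus>\<^bsub>tensor F dual dual\<^esub> ?t) = \<zero>" .
    qed
    then show "s = ?t" using s t T.M.diff_eq_zero_iff by blast
  qed
  then have "tensor_lift F V \<beta> (comult (finite_dual F H) f) = lsum V \<beta> xs"
    if "bilinear_map F dual dual V \<beta>" for \<beta>
    using tensor_lift_lsum[OF module_dual module_dual V that xs] by simp
  then show ?thesis using xs eq by blast
qed

section \<open>Convolution of functionals\<close>

text \<open>The convolution product of arbitrary functionals on \<open>H\<close>. The product of \<open>H\<^sup>0\<close> is its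
  restriction to \<open>carrier H\<close>; the computations below do not use that \<open>H\<^sup>0\<close> is closed under it.\<close>

definition convolution :: "('c \<Rightarrow> 'a) \<Rightarrow> ('c \<Rightarrow> 'a) \<Rightarrow> 'c \<Rightarrow> 'a" where
  "convolution f g h = tensor_lift F (self_module F) (\<lambda>x y. f x \<otimes> g y) (comult H h)"

lemma linear_pairing:
  assumes "linear_map F H (self_module F) f" "linear_map F H (self_module F) g"
  shows "linear_map F (tensor F H H) (self_module F)
    (tensor_lift F (self_module F) (\<lambda>x y. f x \<otimes> g y))"
  by (rule linear_map_tensor_lift[OF module_H module_H module_F bilinear_functional_product[OF assms]])

lemma pairing_pure:
  assumes "linear_map F H (self_module F) f" "linear_map F H (self_module F) g"
    and "x \<in> carrier H" "y \<in> carrier H"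
  shows "tensor_lift F (self_module F) (\<lambda>x y. f x \<otimes> g y) (pure_tensor F H H x y) = f x \<otimes> g y"
  by (rule tensor_lift_pure[OF module_H module_H module_F bilinear_functional_product[OF assms(1,2)]
    assms(3,4)])

lemma convolution_linear:
  assumes "linear_map F H (self_module F) f" "linear_map F H (self_module F) g"
  shows "linear_map F H (self_module F) (convolution f g)"
  using linear_map_comp[OF linear_pairing[OF assms] comult_linear]
  by (simp add: convolution_def[abs_def])

lemma pairing_slice_right:
  assumes f: "linear_map F H (self_module F) f" and g: "linear_map F H (self_module F) g"
    and t: "t \<in> carrier (tensor F H H)"
  shows "tensor_lift F (self_module F) (\<lambda>x y. f x \<otimes> g y) t = f (slice_right F H g t)"
  by (rule tensor_ext[OF module_H module_H module_F linear_pairing[OF f g]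
      linear_map_comp[OF f linear_slice_right[OF module_H module_H g]] _ t])
    (use linear_mapD[OF f] linear_mapD(1)[OF g] in
      \<open>simp add: pairing_pure[OF f g] slice_right_pure[OF module_H module_H g] scalar_laws(7)\<close>)

lemma pairing_slice_left:
  assumes f: "linear_map F H (self_module F) f" and g: "linear_map F H (self_module F) g"
    and t: "t \<in> carrier (tensor F H H)"
  shows "tensor_lift F (self_module F) (\<lambda>x y. f x \<otimes> g y) t = g (slice_left F H f t)"
  by (rule tensor_ext[OF module_H module_H module_F linear_pairing[OF f g]
      linear_map_comp[OF g linear_slice_left[OF module_H module_H f]] _ t])
    (use linear_mapD[OF g] linear_mapD(1)[OF f] in
      \<open>simp add: pairing_pure[OF f g] slice_left_pure[OF module_H module_H f]\<close>)

lemma comult_closed: "h \<in> carrier H \<Longrightarrow> comult H h \<in> carrier (tensor F H H)"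
  by (rule linear_mapD(1)[OF comult_linear])

lemma convolution_counit_right:
  assumes "linear_map F H (self_module F) f" "h \<in> carrier H"
  shows "convolution f (counit H) h = f h"
  unfolding convolution_def
  using pairing_slice_right[OF assms(1) counit_linear comult_closed[OF assms(2)]]
    counit_right[OF assms(2)] by simp

lemma convolution_counit_left:
  assumes "linear_map F H (self_module F) f" "h \<in> carrier H"
  shows "convolution (counit H) f h = f h"
  unfolding convolution_def
  using pairing_slice_left[OF counit_linear assms(1) comult_closed[OF assms(2)]]
    counit_left[OF assms(2)] by simp

lemma convolution_linear_left:
  assumes g: "linear_map F H (self_module F) g" and h: "h \<in> carrier H"
  shows "linear_map F dual (self_module F) (\<lambda>u. convolution u g h)"
  unfolding convolution_def
proof (rule linear_map_tensor_lift_param[OF module_H module_H module_F module_dual _ _ comult_closed[OF h]])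
  show "bilinear_map F H H (self_module F) (\<lambda>x y. u x \<otimes> g y)" if "u \<in> carrier dual" for u
    by (rule bilinear_functional_product[OF dual_linear[OF that] g])
  show "linear_map F dual (self_module F) (\<lambda>u. u x \<otimes> g y)"
    if "x \<in> carrier H" "y \<in> carrier H" for x y
    using bilinear_mapD(2)[OF bilinear_functional_product[OF linear_eval[OF that(1)] g] that(2)] .
qed

lemma convolution_linear_right:
  assumes f: "linear_map F H (self_module F) f" and h: "h \<in> carrier H"
  shows "linear_map F dual (self_module F) (\<lambda>v. convolution f v h)"
  unfolding convolution_def
proof (rule linear_map_tensor_lift_param[OF module_H module_H module_F module_dual _ _ comult_closed[OF h]])
  show "bilinear_map F H H (self_module F) (\<lambda>x y. f x \<otimes> v y)" if "v \<in> carrier dual" for v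
    by (rule bilinear_functional_product[OF f dual_linear[OF that]])
  show "linear_map F dual (self_module F) (\<lambda>v. f x \<otimes> v y)"
    if "x \<in> carrier H" "y \<in> carrier H" for x y
    using bilinear_mapD(1)[OF bilinear_functional_product[OF f linear_eval[OF that(2)]] that(1)] .
qed

lemma dual_mult_eq: "f \<otimes>\<^bsub>dual\<^esub> g = restrict (convolution f g) (carrier H)"
  by (simp add: finite_dual_algebra_simps convolution_def[abs_def])

end

section \<open>Tensor products of linear maps and the associator\<close>

text \<open>From here on the carrier and the vector space operations of \<open>tensor F A B\<close> are no longer
  rewritten to those of \<open>tensor_space F A B\<close>, so that the facts about iterated tensor products match.\<close>

declare tensor_simps [simp del]

lemma linear_tensor_map:
  assumes A: "module F A" and B: "module F B" and C: "module F C" and D: "module F D"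
    and \<phi>: "linear_map F A C \<phi>" and \<psi>: "linear_map F B D \<psi>"
  shows "linear_map F (tensor F A B) (tensor F C D) (tensor_map F C D \<phi> \<psi>)"
  unfolding tensor_map_def
  by (rule linear_map_tensor_lift[OF A B module_tensor[OF C D]
    bilinear_map_comp[OF bilinear_pure_tensor[OF C D] \<phi> \<psi>]])

lemma tensor_map_pure:
  assumes A: "module F A" and B: "module F B" and C: "module F C" and D: "module F D"
    and \<phi>: "linear_map F A C \<phi>" and \<psi>: "linear_map F B D \<psi>"
    and "a \<in> carrier A" "b \<in> carrier B"
  shows "tensor_map F C D \<phi> \<psi> (pure_tensor F A B a b) = pure_tensor F C D (\<phi> a) (\<psi> b)"
  unfolding tensor_map_def
  by (rule tensor_lift_pure[OF A B module_tensor[OF C D]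
    bilinear_map_comp[OF bilinear_pure_tensor[OF C D] \<phi> \<psi>] assms(7,8)])

context
  fixes F :: "('k, 'r) ring_scheme" and A :: "('k, 'a, 'm) module_scheme"
    and B :: "('k, 'b, 'n) module_scheme" and C :: "('k, 'c, 'l) module_scheme"
  assumes A: "module F A" and B: "module F B" and C: "module F C"
begin

private lemmas AB = module_tensor[OF A B]
private lemmas BC = module_tensor[OF B C]
private lemmas ABC = module_tensor[OF A BC]
private lemmas pure_BC = bilinear_pure_tensor[OF B C]
private lemmas pure_ABC = bilinear_pure_tensor[OF A BC]

lemma bilinear_assoc_inner:
  assumes "c \<in> carrier C"
  shows "bilinear_map F A B (tensor F A (tensor F B C))
    (\<lambda>a b. pure_tensor F A (tensor F B C) a (pure_tensor F B C b c))"
  by (rule bilinear_map_comp[OF pure_ABC linear_map_id bilinear_mapD(2)[OF pure_BC assms]])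

lemma bilinear_assoc_outer:
  "bilinear_map F (tensor F A B) C (tensor F A (tensor F B C))
    (\<lambda>t c. tensor_lift F (tensor F A (tensor F B C))
      (\<lambda>a b. pure_tensor F A (tensor F B C) a (pure_tensor F B C b c)) t)"
proof (rule bilinear_mapI)
  fix t assume t: "t \<in> carrier (tensor F A B)"
  show "linear_map F C (tensor F A (tensor F B C))
      (\<lambda>c. tensor_lift F (tensor F A (tensor F B C))
        (\<lambda>a b. pure_tensor F A (tensor F B C) a (pure_tensor F B C b c)) t)"
    by (rule linear_map_tensor_lift_param[OF A B ABC C bilinear_assoc_inner _ t])
      (auto intro!: linear_map_comp[OF bilinear_mapD(1)[OF pure_ABC] bilinear_mapD(1)[OF pure_BC]])
qed (rule linear_map_tensor_lift[OF A B ABC bilinear_assoc_inner])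

lemma linear_tensor_assoc:
  "linear_map F (tensor F (tensor F A B) C) (tensor F A (tensor F B C)) (tensor_assoc F A B C)"
  unfolding tensor_assoc_def by (rule linear_map_tensor_lift[OF AB C ABC bilinear_assoc_outer])

lemma tensor_assoc_pure:
  assumes "a \<in> carrier A" "b \<in> carrier B" "c \<in> carrier C"
  shows "tensor_assoc F A B C (pure_tensor F (tensor F A B) C (pure_tensor F A B a b) c) =
    pure_tensor F A (tensor F B C) a (pure_tensor F B C b c)"
  using tensor_lift_pure[OF AB C ABC bilinear_assoc_outer, of "pure_tensor F A B a b" c]
    tensor_lift_pure[OF A B ABC bilinear_assoc_inner, OF assms(3,1,2)]
    bilinear_map_simps(1)[OF bilinear_pure_tensor[OF A B]] assms
  by (simp add: tensor_assoc_def)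

lemma linear_tensor_assoc_pure:
  assumes "c \<in> carrier C"
  shows "linear_map F (tensor F A B) (tensor F A (tensor F B C))
    (\<lambda>t. tensor_assoc F A B C (pure_tensor F (tensor F A B) C t c))"
  by (rule linear_map_comp[OF linear_tensor_assoc bilinear_mapD(2)[OF bilinear_pure_tensor[OF AB C] assms]])

end

section \<open>Separating families of linear maps\<close>

lemma separating_family_eqI:
  assumes V: "module F V" and W: "module F W"
    and lin: "\<And>\<phi>. \<phi> \<in> \<Phi> \<Longrightarrow> linear_map F V W \<phi>"
    and sep: "\<And>t. t \<in> carrier V \<Longrightarrow> (\<And>\<phi>. \<phi> \<in> \<Phi> \<Longrightarrow> \<phi> t = \<zero>\<^bsub>W\<^esub>) \<Longrightarrow> t = \<zero>\<^bsub>V\<^esub>"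
    and s: "s \<in> carrier V" and t: "t \<in> carrier V"
    and eq: "\<And>\<phi>. \<phi> \<in> \<Phi> \<Longrightarrow> \<phi> s = \<phi> t"
  shows "s = t"
proof -
  interpret V: module F V by fact
  interpret W: module F W by fact
  have "s \<ominus>\<^bsub>V\<^esub> t = \<zero>\<^bsub>V\<^esub>"
  proof (rule sep)
    show "s \<ominus>\<^bsub>V\<^esub> t \<in> carrier V" using s t by simp
    fix \<phi> assume \<phi>: "\<phi> \<in> \<Phi>"
    show "\<phi> (s \<ominus>\<^bsub>V\<^esub> t) = \<zero>\<^bsub>W\<^esub>"
      using linear_map_diff[OF V W lin[OF \<phi>] s t] eq[OF \<phi>] linear_mapD(1)[OF lin[OF \<phi>] t]
        W.M.diff_eq_zero_iff by simp
  qed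
  then show ?thesis using s t V.M.diff_eq_zero_iff by simp
qed

section \<open>Slices of coactions\<close>

context hopf_algebra
begin

abbreviation functional :: "('c \<Rightarrow> 'a) \<Rightarrow> bool" where
  "functional f \<equiv> linear_map F H (self_module F) f"

text \<open>\<open>xs\<close> lists pairs \<open>(u, v)\<close> of functionals with \<open>f(xy) = \<Sum> u(x) v(y)\<close>: the comultiplication of
  \<open>f\<close> without reference to \<open>H\<^sup>0 \<otimes> H\<^sup>0\<close>.\<close>

definition product_decomposition :: "('c \<Rightarrow> 'a) \<Rightarrow> (('c \<Rightarrow> 'a) \<times> ('c \<Rightarrow> 'a)) list \<Rightarrow> bool" where
  "product_decomposition f xs \<longleftrightarrow>
     (\<forall>u v. (u, v) \<in> set xs \<longrightarrow> functional u \<and> functional v) \<and>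
     (\<forall>x \<in> carrier H. \<forall>y \<in> carrier H.
       f (x \<otimes>\<^bsub>H\<^esub> y) = lsum (self_module F) (\<lambda>u v. u x \<otimes> v y) xs)"

lemma module_HH: "module F (tensor F H H)"
  by (rule module_tensor[OF module_H module_H])

context
  fixes A :: "('a, 'e, 'f) module_scheme"
  assumes alg_A: "assoc_algebra F A"
begin

private lemmas A = assoc_algebraD(2)[OF alg_A]
private lemmas mult_A = assoc_algebraD(3)[OF alg_A]
private lemmas mult_H = assoc_algebraD(3)[OF assoc_algebra_H]

private abbreviation (input) "HH \<equiv> tensor F H H"
private abbreviation (input) "AH \<equiv> tensor F A H"
private abbreviation (input) "HA \<equiv> tensor F H A"
private abbreviation (input) "AHH \<equiv> tensor F A HH"
private abbreviation (input) "HHA \<equiv> tensor F H HA"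
private abbreviation (input) "HAH \<equiv> tensor F H AH"

private lemmas AH = module_tensor[OF A module_H]
private lemmas HA = module_tensor[OF module_H A]
private lemmas AHH = module_tensor[OF A module_HH]

private lemmas alg_HH = assoc_algebra_tensor[OF assoc_algebra_H assoc_algebra_H]
private lemmas alg_AH = assoc_algebra_tensor[OF alg_A assoc_algebra_H]
private lemmas alg_HA = assoc_algebra_tensor[OF assoc_algebra_H alg_A]
private lemmas alg_AHH = assoc_algebra_tensor[OF alg_A alg_HH]
private lemmas alg_HHA = assoc_algebra_tensor[OF assoc_algebra_H alg_HA]

private lemmas mult_AH = assoc_algebraD(3)[OF alg_AH]
private lemmas mult_HA = assoc_algebraD(3)[OF alg_HA]
private lemmas mult_HH = assoc_algebraD(3)[OF alg_HH]
private lemmas mult_AHH = assoc_algebraD(3)[OF alg_AHH]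
private lemmas mult_HHA = assoc_algebraD(3)[OF alg_HHA]

private lemmas pure_HH = bilinear_pure_tensor[OF module_H module_H]
private lemmas pure_AH = bilinear_pure_tensor[OF A module_H]
private lemmas pure_HA = bilinear_pure_tensor[OF module_H A]
private lemmas pure_AHH = bilinear_pure_tensor[OF A module_HH]
private lemmas pure_HHA = bilinear_pure_tensor[OF module_H HA]
private lemmas pure_HAH = bilinear_pure_tensor[OF module_H AH]

private lemmas closed [simp] =
  bilinear_map_simps(1)[OF mult_AH] bilinear_map_simps(1)[OF mult_HA]
  bilinear_map_simps(1)[OF mult_HH] bilinear_map_simps(1)[OF mult_A]
  bilinear_map_simps(1)[OF mult_AHH] bilinear_map_simps(1)[OF mult_HHA]
  bilinear_map_simps(1)[OF pure_HH] bilinear_map_simps(1)[OF pure_AH]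
  bilinear_map_simps(1)[OF pure_HA] bilinear_map_simps(1)[OF pure_AHH]
  bilinear_map_simps(1)[OF pure_HHA] bilinear_map_simps(1)[OF pure_HAH]

private lemmas smult_A [simp] = module.smult_closed[OF A]

private lemma functional_closed [simp]: "functional f \<Longrightarrow> h \<in> carrier H \<Longrightarrow> f h \<in> carrier F"
  using linear_mapD(1)[of F H "self_module F" f h] by simp

text \<open>The map \<open>R\<^sub>g = I \<otimes> (I \<otimes> g) : A \<otimes> (H \<otimes> H) \<rightarrow> A \<otimes> H\<close>.\<close>

definition slice_last :: "('c \<Rightarrow> 'a) \<Rightarrow> ('a, 'e, ('a, 'c, 'c) tensor) tensor \<Rightarrow> ('a, 'e, 'c) tensor"
  where "slice_last g = tensor_map F A H id (slice_right F H g)"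

private lemma linear_id: "linear_map F V V id"
  using linear_map_id by (simp add: id_def)

private lemmas slice_HH = linear_slice_right[OF module_H module_H]
private lemmas slice_AH = linear_slice_right[OF A module_H]
private lemmas slice_HA = linear_slice_left[OF module_H A]
private lemmas slice_HHA = linear_slice_left[OF module_H HA]
private lemmas slice_HAH = linear_slice_left[OF module_H AH]

private lemmas slice_pure =
  slice_right_pure[OF module_H module_H] slice_right_pure[OF A module_H]
  slice_left_pure[OF module_H A] slice_left_pure[OF module_H HA] slice_left_pure[OF module_H AH]

lemma linear_slice_last: "functional g \<Longrightarrow> linear_map F AHH AH (slice_last g)"
  unfolding slice_last_def
  by (rule linear_tensor_map[OF A module_HH A module_H linear_id slice_HH])

lemma slice_last_pure:
  "functional g \<Longrightarrow> a \<in> carrier A \<Longrightarrow> z \<in> carrier HH \<Longrightarrow>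
    slice_last g (pure_tensor F A HH a z) = pure_tensor F A H a (slice_right F H g z)"
  unfolding slice_last_def
  using tensor_map_pure[OF A module_HH A module_H linear_id slice_HH, of g a z] by simp

lemma slice_last_assoc_pure:
  assumes g: "functional g" and h: "h \<in> carrier H" and s: "s \<in> carrier AH"
  shows "slice_last g (tensor_assoc F A H H (pure_tensor F AH H s h)) = g h \<odot>\<^bsub>AH\<^esub> s"
  by (rule tensor_ext[OF A module_H AH _ _ _ s])
    (use g h in \<open>auto intro!: linear_map_comp[OF linear_slice_last linear_tensor_assoc_pure[OF A module_H module_H]]
        linear_map_scale[OF AH linear_map_id]
      simp: tensor_assoc_pure[OF A module_H module_H] slice_last_pure slice_pure
        bilinear_map_simps(5)[OF pure_AH]\<close>)

lemma slice_last_coaction: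
  assumes g: "functional g" and \<rho>: "linear_map F A AH \<rho>" and t: "t \<in> carrier AH"
  shows "slice_last g (tensor_assoc F A H H (tensor_map F AH H \<rho> id t)) = \<rho> (slice_right F A g t)"
proof (rule tensor_ext[OF A module_H AH _ _ _ t])
  note map = linear_tensor_map[OF A module_H AH module_H \<rho> linear_id]
  show "linear_map F AH AH (\<lambda>t. slice_last g (tensor_assoc F A H H (tensor_map F AH H \<rho> id t)))"
    by (rule linear_map_comp[OF linear_slice_last[OF g]
      linear_map_comp[OF linear_tensor_assoc[OF A module_H module_H] map]])
  show "linear_map F AH AH (\<lambda>t. \<rho> (slice_right F A g t))"
    by (rule linear_map_comp[OF \<rho> slice_AH[OF g]])
  fix a h assume ah: "a \<in> carrier A" "h \<in> carrier H"
  show "slice_last g (tensor_assoc F A H H (tensor_map F AH H \<rho> id (pure_tensor F A H a h))) =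
      \<rho> (slice_right F A g (pure_tensor F A H a h))"
    using ah g linear_mapD[OF \<rho>]
    by (simp add: tensor_map_pure[OF A module_H AH module_H \<rho> linear_id] slice_last_assoc_pure slice_pure)
qed

lemma slice_last_comult:
  assumes f: "functional f" and g: "functional g" and t: "t \<in> carrier AH"
  shows "slice_right F A f (slice_last g (tensor_map F A HH id (comult H) t)) =
    slice_right F A (convolution f g) t"
proof (rule tensor_ext[OF A module_H A _ _ _ t])
  note map = linear_tensor_map[OF A module_H A module_HH linear_id comult_linear]
  note conv = convolution_linear[OF f g]
  show "linear_map F AH A (\<lambda>t. slice_right F A f (slice_last g (tensor_map F A HH id (comult H) t)))"
    by (rule linear_map_comp[OF slice_AH[OF f] linear_map_comp[OF linear_slice_last[OF g] map]])
  show "linear_map F AH A (slice_right F A (convolution f g))"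
    by (rule slice_AH[OF conv])
  fix a h assume ah: "a \<in> carrier A" "h \<in> carrier H"
  show "slice_right F A f (slice_last g (tensor_map F A HH id (comult H) (pure_tensor F A H a h))) =
      slice_right F A (convolution f g) (pure_tensor F A H a h)"
    using ah g f conv comult_closed[OF ah(2)] linear_mapD(1)[OF slice_HH[OF g]]
    by (simp add: tensor_map_pure[OF A module_H A module_HH linear_id comult_linear] slice_last_pure
        slice_pure pairing_slice_right[symmetric] convolution_def)
qed

lemma slice_last_mult:
  assumes g: "functional g" and s: "s \<in> carrier AH" and w: "w \<in> carrier AHH"
  shows "slice_last g (tensor_assoc F A H H (pure_tensor F AH H s \<one>\<^bsub>H\<^esub>) \<otimes>\<^bsub>AHH\<^esub> w) =
    s \<otimes>\<^bsub>AH\<^esub> slice_last g w"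
proof -
  note last = linear_slice_last[OF g] and slice = slice_HH[OF g]
  note last_closed = linear_mapD(1)[OF last] and slice_closed = linear_mapD(1)[OF slice]
  note assoc = linear_tensor_assoc_pure[OF A module_H module_H one_closed]
  note assoc_closed = linear_mapD(1)[OF assoc]
  note mults = tensor_mult_pure[OF alg_A assoc_algebra_H] tensor_mult_pure[OF alg_A alg_HH]
    tensor_mult_pure[OF assoc_algebra_H assoc_algebra_H]
  let ?a = "\<lambda>s. tensor_assoc F A H H (pure_tensor F AH H s \<one>\<^bsub>H\<^esub>)"
  let ?p = "pure_tensor F A H" and ?q = "pure_tensor F A HH"
  have 1: "slice_last g (?a (?p a h) \<otimes>\<^bsub>AHH\<^esub> ?q b z) = ?p a h \<otimes>\<^bsub>AH\<^esub> slice_last g (?q b z)"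
    if "a \<in> carrier A" "h \<in> carrier H" "b \<in> carrier A" "z \<in> carrier HH" for a h b z
    by (rule tensor_ext[OF module_H module_H AH _ _ _ that(4)])
      (use that g in \<open>auto intro!: linear_map_comp[OF last linear_map_comp[OF bilinear_mapD(1)[OF mult_AHH]
          bilinear_mapD(1)[OF pure_AHH]]] linear_map_comp[OF bilinear_mapD(1)[OF mult_AH]
          linear_map_comp[OF last bilinear_mapD(1)[OF pure_AHH]]] assoc_closed
        simp: tensor_assoc_pure[OF A module_H module_H] mults slice_last_pure slice_pure
          bilinear_map_simps(5)[OF mult_H]\<close>)
  have 2: "slice_last g (?a (?p a h) \<otimes>\<^bsub>AHH\<^esub> w) = ?p a h \<otimes>\<^bsub>AH\<^esub> slice_last g w"
    if "a \<in> carrier A" "h \<in> carrier H" for a h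
    by (rule tensor_ext[OF A module_HH AH _ _ _ w])
      (use that in \<open>auto intro!: linear_map_comp[OF last bilinear_mapD(1)[OF mult_AHH]]
          linear_map_comp[OF bilinear_mapD(1)[OF mult_AH] last] assoc_closed simp: 1\<close>)
  show ?thesis
    by (rule tensor_ext[OF A module_H AH _ _ _ s])
      (use w in \<open>auto intro!: linear_map_comp[OF last linear_map_comp[OF bilinear_mapD(2)[OF mult_AHH] assoc]]
          bilinear_mapD(2)[OF mult_AH] last_closed simp: 2\<close>)
qed

lemma product_decomposition_functional:
  assumes "product_decomposition f xs" "(u, v) \<in> set xs"
  shows "functional u" "functional v"
  using assms unfolding product_decomposition_def by blast+

lemma product_decomposition_smult:
  assumes xs: "product_decomposition f xs"
    and "h \<in> carrier H" "k \<in> carrier H" "x \<in> carrier A"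
  shows "f (h \<otimes>\<^bsub>H\<^esub> k) \<odot>\<^bsub>A\<^esub> x = lsum A (\<lambda>u v. (u h \<otimes> v k) \<odot>\<^bsub>A\<^esub> x) xs"
proof -
  have "f (h \<otimes>\<^bsub>H\<^esub> k) \<odot>\<^bsub>A\<^esub> x = lsum (self_module F) (\<lambda>u v. u h \<otimes> v k) xs \<odot>\<^bsub>A\<^esub> x"
    using assms unfolding product_decomposition_def by simp
  also have "\<dots> = lsum A (\<lambda>u v. (u h \<otimes> v k) \<odot>\<^bsub>A\<^esub> x) xs"
    by (rule linear_map_lsum[OF module_F A bilinear_mapD(2)[OF bilinear_map_smult[OF A]]])
      (use assms product_decomposition_functional[OF xs] in auto)
  finally show ?thesis .
qed

lemma slice_right_mult:
  assumes f: "functional f" and xs: "product_decomposition f xs"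
    and s: "s \<in> carrier AH" and r: "r \<in> carrier AH"
  shows "slice_right F A f (s \<otimes>\<^bsub>AH\<^esub> r) =
    lsum A (\<lambda>u v. slice_right F A u s \<otimes>\<^bsub>A\<^esub> slice_right F A v r) xs"
proof -
  note uv = product_decomposition_functional[OF xs]
  note slice = slice_AH and slice_closed = linear_mapD(1)[OF slice_AH]
  let ?p = "pure_tensor F A H"
  have 1: "slice_right F A f (?p a h \<otimes>\<^bsub>AH\<^esub> ?p b k) =
      lsum A (\<lambda>u v. slice_right F A u (?p a h) \<otimes>\<^bsub>A\<^esub> slice_right F A v (?p b k)) xs"
    if ab: "a \<in> carrier A" "h \<in> carrier H" "b \<in> carrier A" "k \<in> carrier H" for a h b k
  proof -
    have "slice_right F A f (?p a h \<otimes>\<^bsub>AH\<^esub> ?p b k) = f (h \<otimes>\<^bsub>H\<^esub> k) \<odot>\<^bsub>A\<^esub> (a \<otimes>\<^bsub>A\<^esub> b)"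
      using ab f by (simp add: tensor_mult_pure[OF alg_A assoc_algebra_H] slice_pure)
    also have "\<dots> = lsum A (\<lambda>u v. (u h \<otimes> v k) \<odot>\<^bsub>A\<^esub> (a \<otimes>\<^bsub>A\<^esub> b)) xs"
      using product_decomposition_smult[OF xs] ab by simp
    also have "\<dots> = lsum A (\<lambda>u v. slice_right F A u (?p a h) \<otimes>\<^bsub>A\<^esub> slice_right F A v (?p b k)) xs"
      by (rule lsum_cong)
        (use ab uv in \<open>simp add: slice_pure bilinear_map_simps(4,5)[OF mult_A]
          module.smult_assoc1[OF A, symmetric] scalar_laws(7)\<close>)
    finally show ?thesis .
  qed
  have 2: "slice_right F A f (?p a h \<otimes>\<^bsub>AH\<^esub> r) =
      lsum A (\<lambda>u v. slice_right F A u (?p a h) \<otimes>\<^bsub>A\<^esub> slice_right F A v r) xs"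
    if "a \<in> carrier A" "h \<in> carrier H" for a h
    by (rule tensor_ext[OF A module_H A _ _ _ r])
      (use that f in \<open>auto intro!: linear_map_comp[OF slice bilinear_mapD(1)[OF mult_AH]]
          linear_map_lsum_param[OF A] linear_map_comp[OF bilinear_mapD(1)[OF mult_A] slice] slice_closed
          simp: 1 dest: uv\<close>)
  show ?thesis
    by (rule tensor_ext[OF A module_H A _ _ _ s])
      (use r f in \<open>auto intro!: linear_map_comp[OF slice bilinear_mapD(2)[OF mult_AH]]
          linear_map_lsum_param[OF A] linear_map_comp[OF bilinear_mapD(2)[OF mult_A] slice] slice_closed
          simp: 2 dest: uv\<close>)
qed

lemma slice_left_mult:
  assumes f: "functional f" and xs: "product_decomposition f xs"
    and s: "s \<in> carrier HA" and r: "r \<in> carrier HA"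
  shows "slice_left F A f (s \<otimes>\<^bsub>HA\<^esub> r) =
    lsum A (\<lambda>u v. slice_left F A u s \<otimes>\<^bsub>A\<^esub> slice_left F A v r) xs"
proof -
  note uv = product_decomposition_functional[OF xs]
  note slice = slice_HA and slice_closed = linear_mapD(1)[OF slice_HA]
  let ?p = "pure_tensor F H A"
  have 1: "slice_left F A f (?p h a \<otimes>\<^bsub>HA\<^esub> ?p k b) =
      lsum A (\<lambda>u v. slice_left F A u (?p h a) \<otimes>\<^bsub>A\<^esub> slice_left F A v (?p k b)) xs"
    if ab: "a \<in> carrier A" "h \<in> carrier H" "b \<in> carrier A" "k \<in> carrier H" for a h b k
  proof -
    have "slice_left F A f (?p h a \<otimes>\<^bsub>HA\<^esub> ?p k b) = f (h \<otimes>\<^bsub>H\<^esub> k) \<odot>\<^bsub>A\<^esub> (a \<otimes>\<^bsub>A\<^esub> b)"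
      using ab f by (simp add: tensor_mult_pure[OF assoc_algebra_H alg_A] slice_pure)
    also have "\<dots> = lsum A (\<lambda>u v. (u h \<otimes> v k) \<odot>\<^bsub>A\<^esub> (a \<otimes>\<^bsub>A\<^esub> b)) xs"
      using product_decomposition_smult[OF xs] ab by simp
    also have "\<dots> = lsum A (\<lambda>u v. slice_left F A u (?p h a) \<otimes>\<^bsub>A\<^esub> slice_left F A v (?p k b)) xs"
      by (rule lsum_cong)
        (use ab uv in \<open>simp add: slice_pure bilinear_map_simps(4,5)[OF mult_A]
          module.smult_assoc1[OF A, symmetric] scalar_laws(7)\<close>)
    finally show ?thesis .
  qed
  have 2: "slice_left F A f (?p h a \<otimes>\<^bsub>HA\<^esub> r) =
      lsum A (\<lambda>u v. slice_left F A u (?p h a) \<otimes>\<^bsub>A\<^esub> slice_left F A v r) xs"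
    if "a \<in> carrier A" "h \<in> carrier H" for a h
    by (rule tensor_ext[OF module_H A A _ _ _ r])
      (use that f in \<open>auto intro!: linear_map_comp[OF slice bilinear_mapD(1)[OF mult_HA]]
          linear_map_lsum_param[OF A] linear_map_comp[OF bilinear_mapD(1)[OF mult_A] slice] slice_closed
          simp: 1 dest: uv\<close>)
  show ?thesis
    by (rule tensor_ext[OF module_H A A _ _ _ s])
      (use r f in \<open>auto intro!: linear_map_comp[OF slice bilinear_mapD(2)[OF mult_HA]]
          linear_map_lsum_param[OF A] linear_map_comp[OF bilinear_mapD(2)[OF mult_A] slice] slice_closed
          simp: 2 dest: uv\<close>)
qed

lemma slice_left_tensor_map:
  assumes W: "module F W" and g: "functional g" and \<psi>: "linear_map F A W \<psi>" and t: "t \<in> carrier HA"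
  shows "slice_left F W g (tensor_map F H W id \<psi> t) = \<psi> (slice_left F A g t)"
proof (rule tensor_ext[OF module_H A W _ _ _ t])
  note map = linear_tensor_map[OF module_H A module_H W linear_id \<psi>]
  show "linear_map F HA W (\<lambda>t. slice_left F W g (tensor_map F H W id \<psi> t))"
    by (rule linear_map_comp[OF linear_slice_left[OF module_H W g] map])
  show "linear_map F HA W (\<lambda>t. \<psi> (slice_left F A g t))"
    by (rule linear_map_comp[OF \<psi> slice_HA[OF g]])
  fix h a assume "h \<in> carrier H" "a \<in> carrier A"
  then show "slice_left F W g (tensor_map F H W id \<psi> (pure_tensor F H A h a)) =
      \<psi> (slice_left F A g (pure_tensor F H A h a))"
    using g linear_mapD[OF \<psi>]
    by (simp add: tensor_map_pure[OF module_H A module_H W linear_id \<psi>]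
        slice_left_pure[OF module_H W] slice_pure)
qed

lemma slice_left_comult:
  assumes f: "functional f" and g: "functional g" and t: "t \<in> carrier HA"
  shows "slice_left F A f (slice_left F HA g (tensor_assoc F H H A (tensor_map F HH A (comult H) id t))) =
    slice_left F A (convolution g f) t"
proof (rule tensor_ext[OF module_H A A _ _ _ t])
  note map = linear_tensor_map[OF module_H A module_HH A comult_linear linear_id]
  note conv = convolution_linear[OF g f]
  note slices = linear_map_comp[OF slice_HA[OF f] slice_HHA[OF g]]
  show "linear_map F HA A (\<lambda>t. slice_left F A f (slice_left F HA g
      (tensor_assoc F H H A (tensor_map F HH A (comult H) id t))))"
    by (rule linear_map_comp[OF slices linear_map_comp[OF linear_tensor_assoc[OF module_H module_H A] map]])
  show "linear_map F HA A (slice_left F A (convolution g f))"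
    by (rule slice_HA[OF conv])
  have *: "slice_left F A f (slice_left F HA g (tensor_assoc F H H A (pure_tensor F HH A z a))) =
      tensor_lift F (self_module F) (\<lambda>x y. g x \<otimes> f y) z \<odot>\<^bsub>A\<^esub> a"
    if "a \<in> carrier A" "z \<in> carrier HH" for a z
  proof (rule tensor_ext[OF module_H module_H A _ _ _ that(2)])
    show "linear_map F HH A (\<lambda>z. slice_left F A f (slice_left F HA g
        (tensor_assoc F H H A (pure_tensor F HH A z a))))"
      by (rule linear_map_comp[OF slices linear_tensor_assoc_pure[OF module_H module_H A that(1)]])
    show "linear_map F HH A (\<lambda>z. tensor_lift F (self_module F) (\<lambda>x y. g x \<otimes> f y) z \<odot>\<^bsub>A\<^esub> a)"
      by (rule linear_map_comp[OF bilinear_mapD(2)[OF bilinear_map_smult[OF A] that(1)] linear_pairing[OF g f]])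
    fix x y assume "x \<in> carrier H" "y \<in> carrier H"
    then show "slice_left F A f (slice_left F HA g (tensor_assoc F H H A
        (pure_tensor F HH A (pure_tensor F H H x y) a))) =
        tensor_lift F (self_module F) (\<lambda>x y. g x \<otimes> f y) (pure_tensor F H H x y) \<odot>\<^bsub>A\<^esub> a"
      using that(1) f g
      by (simp add: tensor_assoc_pure[OF module_H module_H A] slice_pure pairing_pure
          linear_mapD(3)[OF slice_HA] module.smult_assoc1[OF A])
  qed
  fix h a assume "h \<in> carrier H" "a \<in> carrier A"
  then show "slice_left F A f (slice_left F HA g (tensor_assoc F H H A
      (tensor_map F HH A (comult H) id (pure_tensor F H A h a)))) =
      slice_left F A (convolution g f) (pure_tensor F H A h a)"
    using conv
    by (simp add: tensor_map_pure[OF module_H A module_HH A comult_linear linear_id] slice_pure *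
        comult_closed convolution_def)
qed

lemma slice_left_mult_pure:
  assumes g: "functional g" and s: "s \<in> carrier HA" and w: "w \<in> carrier HHA"
  shows "slice_left F HA g (w \<otimes>\<^bsub>HHA\<^esub> pure_tensor F H HA \<one>\<^bsub>H\<^esub> s) = slice_left F HA g w \<otimes>\<^bsub>HA\<^esub> s"
  by (rule tensor_ext[OF module_H HA HA _ _ _ w])
    (use g s in \<open>auto intro!: linear_map_comp[OF slice_HHA bilinear_mapD(2)[OF mult_HHA]]
        linear_map_comp[OF bilinear_mapD(2)[OF mult_HA] slice_HHA]
      simp: tensor_mult_pure[OF assoc_algebra_H alg_HA] slice_pure bilinear_map_simps(4)[OF mult_HA]\<close>)

lemma slice_both_coactions:
  assumes f: "functional f" and g: "functional g" and \<kappa>: "linear_map F A HA \<kappa>"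
    and t: "t \<in> carrier AH"
  shows "slice_right F A f (slice_left F AH g (tensor_assoc F H A H (tensor_map F HA H \<kappa> id t))) =
    slice_left F A g (\<kappa> (slice_right F A f t))"
proof (rule tensor_ext[OF A module_H A _ _ _ t])
  note map = linear_tensor_map[OF A module_H HA module_H \<kappa> linear_id]
  note slices = linear_map_comp[OF slice_AH[OF f] slice_HAH[OF g]]
  show "linear_map F AH A (\<lambda>t. slice_right F A f (slice_left F AH g
      (tensor_assoc F H A H (tensor_map F HA H \<kappa> id t))))"
    by (rule linear_map_comp[OF slices linear_map_comp[OF linear_tensor_assoc[OF module_H A module_H] map]])
  show "linear_map F AH A (\<lambda>t. slice_left F A g (\<kappa> (slice_right F A f t)))"
    by (rule linear_map_comp[OF slice_HA[OF g] linear_map_comp[OF \<kappa> slice_AH[OF f]]])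
  have *: "slice_right F A f (slice_left F AH g (tensor_assoc F H A H (pure_tensor F HA H s h))) =
      f h \<odot>\<^bsub>A\<^esub> slice_left F A g s"
    if h: "h \<in> carrier H" and s: "s \<in> carrier HA" for h s
  proof (rule tensor_ext[OF module_H A A _ _ _ s])
    show "linear_map F HA A (\<lambda>s. slice_right F A f (slice_left F AH g
        (tensor_assoc F H A H (pure_tensor F HA H s h))))"
      by (rule linear_map_comp[OF slices linear_tensor_assoc_pure[OF module_H A module_H h]])
    show "linear_map F HA A (\<lambda>s. f h \<odot>\<^bsub>A\<^esub> slice_left F A g s)"
      using linear_map_scale[OF A slice_HA[OF g]] f h by simp
    fix x b assume "x \<in> carrier H" "b \<in> carrier A"
    then show "slice_right F A f (slice_left F AH g (tensor_assoc F H A H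
        (pure_tensor F HA H (pure_tensor F H A x b) h))) =
        f h \<odot>\<^bsub>A\<^esub> slice_left F A g (pure_tensor F H A x b)"
      using f g h
      by (simp add: tensor_assoc_pure[OF module_H A module_H] slice_pure linear_mapD(3)[OF slice_AH]
          module.smult_assoc1[OF A, symmetric] scalar_laws(7))
  qed
  fix a h assume ah: "a \<in> carrier A" "h \<in> carrier H"
  then show "slice_right F A f (slice_left F AH g (tensor_assoc F H A H
      (tensor_map F HA H \<kappa> id (pure_tensor F A H a h)))) =
      slice_left F A g (\<kappa> (slice_right F A f (pure_tensor F A H a h)))"
    using f g linear_mapD[OF \<kappa>]
    by (simp add: tensor_map_pure[OF A module_H HA module_H \<kappa> linear_id] slice_pure *
        linear_mapD(3)[OF slice_HA])
qed

text \<open>Slicing twice is slicing by one functional on \<open>H \<otimes> H\<close>.\<close>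

lemma slice_functional_HH:
  assumes f: "functional f" and g: "functional g" and w: "w \<in> carrier AHH"
  shows "slice_right F A (\<lambda>z. f (slice_right F H g z)) w = slice_right F A f (slice_last g w)"
proof (rule tensor_ext[OF A module_HH A _ _ _ w])
  note fg = linear_map_comp[OF f slice_HH[OF g]]
  show "linear_map F AHH A (slice_right F A (\<lambda>z. f (slice_right F H g z)))"
    by (rule linear_slice_right[OF A module_HH fg])
  show "linear_map F AHH A (\<lambda>w. slice_right F A f (slice_last g w))"
    by (rule linear_map_comp[OF slice_AH[OF f] linear_slice_last[OF g]])
  fix a z assume "a \<in> carrier A" "z \<in> carrier HH"
  then show "slice_right F A (\<lambda>z. f (slice_right F H g z)) (pure_tensor F A HH a z) =
      slice_right F A f (slice_last g (pure_tensor F A HH a z))"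
    using f g linear_mapD(1)[OF slice_HH[OF g]]
    by (simp add: slice_right_pure[OF A module_HH fg] slice_last_pure slice_pure)
qed

section \<open>Separation by the finite dual\<close>

context
  assumes sep: "finite_dual_separates_points F H"
begin

private lemma sep_H:
  "h \<in> carrier H \<Longrightarrow> (\<And>f. f \<in> carrier dual \<Longrightarrow> f h = \<zero>) \<Longrightarrow> h = \<zero>\<^bsub>H\<^esub>"
  using sep by (auto simp: finite_dual_separates_points_def)

lemma slices_AH_eqI:
  assumes "s \<in> carrier AH" "t \<in> carrier AH"
    and "\<And>f. f \<in> carrier dual \<Longrightarrow> slice_right F A f s = slice_right F A f t"
  shows "s = t"
proof (rule separating_family_eqI[OF AH A, of "slice_right F A ` carrier dual"])
  fix t assume "t \<in> carrier AH" "\<And>\<phi>. \<phi> \<in> slice_right F A ` carrier dual \<Longrightarrow> \<phi> t = \<zero>\<^bsub>A\<^esub>"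
  then show "t = \<zero>\<^bsub>AH\<^esub>"
    by (intro slice_right_separates[OF A module_H field_F dual_linear sep_H]) auto
qed (use assms in \<open>auto intro!: slice_AH dual_linear\<close>)

lemma slice_left_eqI:
  assumes W: "module F W" and "s \<in> carrier (tensor F H W)" "t \<in> carrier (tensor F H W)"
    and "\<And>g. g \<in> carrier dual \<Longrightarrow> slice_left F W g s = slice_left F W g t"
  shows "s = t"
proof (rule separating_family_eqI[OF module_tensor[OF module_H W] W, of "slice_left F W ` carrier dual"])
  fix t assume "t \<in> carrier (tensor F H W)"
    "\<And>\<phi>. \<phi> \<in> slice_left F W ` carrier dual \<Longrightarrow> \<phi> t = \<zero>\<^bsub>W\<^esub>"
  then show "t = \<zero>\<^bsub>tensor F H W\<^esub>"
    by (intro slice_left_separates[OF module_H W field_F dual_linear sep_H]) auto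
qed (use assms in \<open>auto intro!: linear_slice_left[OF module_H W] dual_linear\<close>)

lemma slices_HHA_eqI:
  assumes "s \<in> carrier HHA" "t \<in> carrier HHA"
    and "\<And>f g. f \<in> carrier dual \<Longrightarrow> g \<in> carrier dual \<Longrightarrow>
      slice_left F A f (slice_left F HA g s) = slice_left F A f (slice_left F HA g t)"
  shows "s = t"
  by (rule slice_left_eqI[OF HA assms(1,2)], rule slice_left_eqI[OF A])
    (use assms linear_mapD(1)[OF slice_HHA[OF dual_linear]] in auto)

lemma slices_HAH_eqI:
  assumes "s \<in> carrier HAH" "t \<in> carrier HAH"
    and "\<And>f g. f \<in> carrier dual \<Longrightarrow> g \<in> carrier dual \<Longrightarrow>
      slice_right F A f (slice_left F AH g s) = slice_right F A f (slice_left F AH g t)"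
  shows "s = t"
  by (rule slice_left_eqI[OF AH assms(1,2)], rule slices_AH_eqI)
    (use assms linear_mapD(1)[OF slice_HAH[OF dual_linear]] in auto)

lemma slices_AHH_eqI:
  assumes s: "s \<in> carrier AHH" and t: "t \<in> carrier AHH"
    and eq: "\<And>f g. f \<in> carrier dual \<Longrightarrow> g \<in> carrier dual \<Longrightarrow>
      slice_right F A f (slice_last g s) = slice_right F A f (slice_last g t)"
  shows "s = t"
proof -
  define D where "D = {\<lambda>z. f (slice_right F H g z) | f g. f \<in> carrier dual \<and> g \<in> carrier dual}"
  have D: "linear_map F HH (self_module F) \<phi>" if "\<phi> \<in> D" for \<phi>
    using that linear_map_comp[OF dual_linear slice_HH[OF dual_linear]] unfolding D_def by blast
  have sep_HH: "z = \<zero>\<^bsub>HH\<^esub>" if z: "z \<in> carrier HH" "\<And>\<phi>. \<phi> \<in> D \<Longrightarrow> \<phi> z = \<zero>" for z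
  proof (rule slice_right_separates[OF module_H module_H field_F dual_linear sep_H z(1)])
    fix g assume g: "g \<in> carrier dual"
    show "slice_right F H g z = \<zero>\<^bsub>H\<^esub>"
    proof (rule sep_H[OF linear_mapD(1)[OF slice_HH[OF dual_linear[OF g]] z(1)]])
      fix f assume "f \<in> carrier dual"
      then show "f (slice_right F H g z) = \<zero>"
        using z(2)[of "\<lambda>z. f (slice_right F H g z)"] g unfolding D_def by blast
    qed
  qed
  show ?thesis
  proof (rule separating_family_eqI[OF AHH A, of "slice_right F A ` D"])
    show "linear_map F AHH A \<phi>" if "\<phi> \<in> slice_right F A ` D" for \<phi>
      using that linear_slice_right[OF A module_HH D] by blast
    show "w = \<zero>\<^bsub>AHH\<^esub>"
      if "w \<in> carrier AHH" "\<And>\<phi>. \<phi> \<in> slice_right F A ` D \<Longrightarrow> \<phi> w = \<zero>\<^bsub>A\<^esub>" for w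
      by (rule slice_right_separates[OF A module_HH field_F D sep_HH that(1)])
        (use that(2) in auto)
    show "\<phi> s = \<phi> t" if \<phi>: "\<phi> \<in> slice_right F A ` D" for \<phi>
    proof -
      obtain f g where fg: "f \<in> carrier dual" "g \<in> carrier dual"
        "\<phi> = slice_right F A (\<lambda>z. f (slice_right F H g z))"
        using \<phi> unfolding D_def by blast
      show ?thesis
        unfolding fg(3) slice_functional_HH[OF dual_linear[OF fg(1)] dual_linear[OF fg(2)] s]
          slice_functional_HH[OF dual_linear[OF fg(1)] dual_linear[OF fg(2)] t]
        by (rule eq[OF fg(1,2)])
    qed
  qed (use s t in auto)
qed

end

section \<open>Actions of the finite dual induced by coactions\<close>

lemma convolution_cong:
  assumes "functional f'" "functional g'" "h \<in> carrier H"
    and "\<And>x. x \<in> carrier H \<Longrightarrow> f x = f' x" "\<And>x. x \<in> carrier H \<Longrightarrow> g x = g' x"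
  shows "convolution f g h = convolution f' g' h"
  unfolding convolution_def
  by (rule tensor_lift_cong[OF module_H module_H module_F
        bilinear_functional_product[OF assms(1,2)] _ comult_closed[OF assms(3)]])
    (simp add: assms(4,5))

lemma functional_restrict: "functional f \<Longrightarrow> functional (restrict f (carrier H))"
  by (erule linear_map_cong[OF module_H]) simp

lemma dual_mult_functional:
  "functional f \<Longrightarrow> functional g \<Longrightarrow> functional (f \<otimes>\<^bsub>dual\<^esub> g)"
  unfolding dual_mult_eq by (intro functional_restrict convolution_linear)

lemma dual_mult_one:
  assumes f: "f \<in> carrier dual"
  shows "f \<otimes>\<^bsub>dual\<^esub> \<one>\<^bsub>dual\<^esub> = f" and "\<one>\<^bsub>dual\<^esub> \<otimes>\<^bsub>dual\<^esub> f = f"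
proof -
  note lin = dual_linear[OF f]
  have one: "\<one>\<^bsub>dual\<^esub> x = counit H x" if "x \<in> carrier H" for x
    using that by (simp add: finite_dual_algebra_simps)
  show "f \<otimes>\<^bsub>dual\<^esub> \<one>\<^bsub>dual\<^esub> = f"
    by (rule dual_extI)
      (use f dual_extensional convolution_cong[OF lin counit_linear _ refl one]
        convolution_counit_right[OF lin] in \<open>auto simp: dual_mult_eq\<close>)
  show "\<one>\<^bsub>dual\<^esub> \<otimes>\<^bsub>dual\<^esub> f = f"
    by (rule dual_extI)
      (use f dual_extensional convolution_cong[OF counit_linear lin _ one refl]
        convolution_counit_left[OF lin] in \<open>auto simp: dual_mult_eq\<close>)
qed

lemma dual_decomposition:
  assumes f: "f \<in> carrier dual"
  obtains xs where "set xs \<subseteq> carrier dual \<times> carrier dual" "product_decomposition f xs"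
    "\<And>\<beta>. bilinear_map F dual dual A \<beta> \<Longrightarrow>
      tensor_lift F A \<beta> (comult (finite_dual F H) f) = lsum A \<beta> xs"
proof -
  obtain xs where xs: "set xs \<subseteq> carrier dual \<times> carrier dual"
    and eq: "\<forall>x \<in> carrier H. \<forall>y \<in> carrier H.
      f (x \<otimes>\<^bsub>H\<^esub> y) = lsum (self_module F) (\<lambda>u v. u x \<otimes> v y) xs"
    and lift: "\<forall>\<beta>. bilinear_map F dual dual A \<beta> \<longrightarrow>
      tensor_lift F A \<beta> (comult (finite_dual F H) f) = lsum A \<beta> xs"
    using comult_finite_dual[OF f A] by blast
  have "product_decomposition f xs"
    unfolding product_decomposition_def using xs eq dual_linear by blast
  then show thesis using that xs lift by blast
qed

lemma linear_slice_right_param: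
  assumes C: "module F C" and \<phi>: "\<And>c. c \<in> carrier C \<Longrightarrow> functional (\<phi> c)"
    and lin: "\<And>h. h \<in> carrier H \<Longrightarrow> linear_map F C (self_module F) (\<lambda>c. \<phi> c h)"
    and t: "t \<in> carrier AH"
  shows "linear_map F C A (\<lambda>c. slice_right F A (\<phi> c) t)"
  unfolding slice_right_def
  by (rule linear_map_tensor_lift_param[OF A module_H A C bilinear_slice_right[OF A module_H \<phi>] _ t])
    (auto intro!: linear_map_comp[OF bilinear_mapD(2)[OF bilinear_map_smult[OF A]]] lin)

lemma linear_slice_left_param:
  assumes C: "module F C" and \<phi>: "\<And>c. c \<in> carrier C \<Longrightarrow> functional (\<phi> c)"
    and lin: "\<And>h. h \<in> carrier H \<Longrightarrow> linear_map F C (self_module F) (\<lambda>c. \<phi> c h)"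
    and t: "t \<in> carrier HA"
  shows "linear_map F C A (\<lambda>c. slice_left F A (\<phi> c) t)"
  unfolding slice_left_def
  by (rule linear_map_tensor_lift_param[OF module_H A A C bilinear_slice_left[OF module_H A \<phi>] _ t])
    (auto intro!: linear_map_comp[OF bilinear_mapD(2)[OF bilinear_map_smult[OF A]]] lin)

lemma dual_mult_linear:
  assumes "functional g" "h \<in> carrier H"
  shows "linear_map F dual (self_module F) (\<lambda>u. (u \<otimes>\<^bsub>dual\<^esub> g) h)"
    and "linear_map F dual (self_module F) (\<lambda>v. (g \<otimes>\<^bsub>dual\<^esub> v) h)"
  using convolution_linear_left[OF assms] convolution_linear_right[OF assms] assms(2)
  by (simp_all add: dual_mult_eq)

private lemma lact_linear: "t \<in> carrier AH \<Longrightarrow> linear_map F dual A (\<lambda>f. slice_right F A f t)"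
  by (rule linear_slice_right_param[OF module_dual dual_linear linear_eval])

private lemma ract_linear: "t \<in> carrier HA \<Longrightarrow> linear_map F dual A (\<lambda>f. slice_left F A f t)"
  by (rule linear_slice_left_param[OF module_dual dual_linear linear_eval])

private lemma bilinear_product:
  assumes "linear_map F V A \<phi>" "linear_map F W A \<psi>"
  shows "bilinear_map F V W A (\<lambda>x y. \<phi> x \<otimes>\<^bsub>A\<^esub> \<psi> y)"
  by (rule bilinear_map_comp[OF mult_A assms])

lemma slice_right_mult_comult:
  assumes f: "f \<in> carrier dual" and s: "s \<in> carrier AH" and r: "r \<in> carrier AH"
  shows "tensor_lift F A (\<lambda>u v. slice_right F A u s \<otimes>\<^bsub>A\<^esub> slice_right F A v r) (comult (finite_dual F H) f) =
    slice_right F A f (s \<otimes>\<^bsub>AH\<^esub> r)"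
proof -
  obtain xs where xs: "product_decomposition f xs"
    and lift: "\<And>\<beta>. bilinear_map F dual dual A \<beta> \<Longrightarrow>
      tensor_lift F A \<beta> (comult (finite_dual F H) f) = lsum A \<beta> xs"
    using dual_decomposition[OF f] by metis
  show ?thesis
    using lift[OF bilinear_product[OF lact_linear[OF s] lact_linear[OF r]]]
      slice_right_mult[OF dual_linear[OF f] xs s r] by simp
qed

lemma slice_left_mult_comult:
  assumes f: "f \<in> carrier dual" and s: "s \<in> carrier HA" and r: "r \<in> carrier HA"
  shows "tensor_lift F A (\<lambda>u v. slice_left F A u s \<otimes>\<^bsub>A\<^esub> slice_left F A v r) (comult (finite_dual F H) f) =
    slice_left F A f (s \<otimes>\<^bsub>HA\<^esub> r)"
proof -
  obtain xs where xs: "product_decomposition f xs"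
    and lift: "\<And>\<beta>. bilinear_map F dual dual A \<beta> \<Longrightarrow>
      tensor_lift F A \<beta> (comult (finite_dual F H) f) = lsum A \<beta> xs"
    using dual_decomposition[OF f] by metis
  show ?thesis
    using lift[OF bilinear_product[OF ract_linear[OF s] ract_linear[OF r]]]
      slice_left_mult[OF dual_linear[OF f] xs s r] by simp
qed

private lemmas comult_right = linear_tensor_map[OF A module_H A module_HH linear_id comult_linear]
private lemmas comult_left = linear_map_comp[OF linear_tensor_assoc[OF module_H module_H A]
  linear_tensor_map[OF module_H A module_HH A comult_linear linear_id]]

lemma slice_right_dual_mult:
  assumes f: "functional f" and g: "functional g" and t: "t \<in> carrier AH"
  shows "slice_right F A (f \<otimes>\<^bsub>dual\<^esub> g) t =
    slice_right F A f (slice_last g (tensor_map F A HH id (comult H) t))"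
  unfolding slice_last_comult[OF f g t]
  by (rule slice_right_cong[OF A module_H convolution_linear[OF f g] _ t]) (simp add: dual_mult_eq)

lemma slice_left_dual_mult:
  assumes f: "functional f" and g: "functional g" and t: "t \<in> carrier HA"
  shows "slice_left F A (g \<otimes>\<^bsub>dual\<^esub> f) t =
    slice_left F A f (slice_left F HA g (tensor_assoc F H H A (tensor_map F HH A (comult H) id t)))"
  unfolding slice_left_comult[OF f g t]
  by (rule slice_left_cong[OF module_H A convolution_linear[OF g f] _ t]) (simp add: dual_mult_eq)

text \<open>The right-hand side of the partial action axiom; \<open>s\<close> and \<open>r\<close> will be \<open>\<rho>(a)\<close> and \<open>\<rho>(b)\<close>.\<close>

lemma slice_right_mult_comult_mult:
  assumes f: "f \<in> carrier dual" and g: "functional g" and s: "s \<in> carrier AH" and r: "r \<in> carrier AH"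
  shows "tensor_lift F A (\<lambda>u v. slice_right F A u s \<otimes>\<^bsub>A\<^esub> slice_right F A (v \<otimes>\<^bsub>dual\<^esub> g) r)
      (comult (finite_dual F H) f) =
    slice_right F A f (s \<otimes>\<^bsub>AH\<^esub> slice_last g (tensor_map F A HH id (comult H) r))"
proof -
  obtain xs where sub: "set xs \<subseteq> carrier dual \<times> carrier dual" and xs: "product_decomposition f xs"
    and lift: "\<And>\<beta>. bilinear_map F dual dual A \<beta> \<Longrightarrow>
      tensor_lift F A \<beta> (comult (finite_dual F H) f) = lsum A \<beta> xs"
    using dual_decomposition[OF f] by metis
  let ?q = "slice_last g (tensor_map F A HH id (comult H) r)"
  have q: "?q \<in> carrier AH"
    by (rule linear_mapD(1)[OF linear_slice_last[OF g] linear_mapD(1)[OF comult_right r]])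
  have "linear_map F dual A (\<lambda>v. slice_right F A (v \<otimes>\<^bsub>dual\<^esub> g) r)"
    by (rule linear_slice_right_param[OF module_dual dual_mult_functional[OF dual_linear g]
      dual_mult_linear(1)[OF g] r])
  then have "tensor_lift F A (\<lambda>u v. slice_right F A u s \<otimes>\<^bsub>A\<^esub> slice_right F A (v \<otimes>\<^bsub>dual\<^esub> g) r)
      (comult (finite_dual F H) f) =
      lsum A (\<lambda>u v. slice_right F A u s \<otimes>\<^bsub>A\<^esub> slice_right F A (v \<otimes>\<^bsub>dual\<^esub> g) r) xs"
    by (intro lift bilinear_product lact_linear s)
  also have "\<dots> = lsum A (\<lambda>u v. slice_right F A u s \<otimes>\<^bsub>A\<^esub> slice_right F A v ?q) xs"
    by (rule lsum_cong) (use sub in \<open>auto simp: slice_right_dual_mult[OF dual_linear g r]\<close>)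
  also have "\<dots> = slice_right F A f (s \<otimes>\<^bsub>AH\<^esub> ?q)"
    by (rule slice_right_mult[OF dual_linear[OF f] xs s q, symmetric])
  finally show ?thesis .
qed

lemma slice_left_mult_comult_mult:
  assumes f: "f \<in> carrier dual" and g: "functional g" and s: "s \<in> carrier HA" and r: "r \<in> carrier HA"
  shows "tensor_lift F A (\<lambda>u v. slice_left F A (g \<otimes>\<^bsub>dual\<^esub> u) s \<otimes>\<^bsub>A\<^esub> slice_left F A v r)
      (comult (finite_dual F H) f) =
    slice_left F A f
      (slice_left F HA g (tensor_assoc F H H A (tensor_map F HH A (comult H) id s)) \<otimes>\<^bsub>HA\<^esub> r)"
proof -
  obtain xs where sub: "set xs \<subseteq> carrier dual \<times> carrier dual" and xs: "product_decomposition f xs"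
    and lift: "\<And>\<beta>. bilinear_map F dual dual A \<beta> \<Longrightarrow>
      tensor_lift F A \<beta> (comult (finite_dual F H) f) = lsum A \<beta> xs"
    using dual_decomposition[OF f] by metis
  let ?q = "slice_left F HA g (tensor_assoc F H H A (tensor_map F HH A (comult H) id s))"
  have q: "?q \<in> carrier HA"
    by (rule linear_mapD(1)[OF slice_HHA[OF g] linear_mapD(1)[OF comult_left s]])
  have "linear_map F dual A (\<lambda>u. slice_left F A (g \<otimes>\<^bsub>dual\<^esub> u) s)"
    by (rule linear_slice_left_param[OF module_dual dual_mult_functional[OF g dual_linear]
      dual_mult_linear(2)[OF g] s])
  then have "tensor_lift F A (\<lambda>u v. slice_left F A (g \<otimes>\<^bsub>dual\<^esub> u) s \<otimes>\<^bsub>A\<^esub> slice_left F A v r)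
      (comult (finite_dual F H) f) =
      lsum A (\<lambda>u v. slice_left F A (g \<otimes>\<^bsub>dual\<^esub> u) s \<otimes>\<^bsub>A\<^esub> slice_left F A v r) xs"
    by (intro lift bilinear_product ract_linear r)
  also have "\<dots> = lsum A (\<lambda>u v. slice_left F A u ?q \<otimes>\<^bsub>A\<^esub> slice_left F A v r) xs"
    by (rule lsum_cong) (use sub in \<open>auto simp: slice_left_dual_mult[OF dual_linear g s]\<close>)
  also have "\<dots> = slice_left F A f (?q \<otimes>\<^bsub>HA\<^esub> r)"
    by (rule slice_left_mult[OF dual_linear[OF f] xs q r, symmetric])
  finally show ?thesis .
qed

context
  fixes \<rho> :: "'e \<Rightarrow> ('a, 'e, 'c) tensor" and \<kappa> :: "'e \<Rightarrow> ('a, 'c, 'e) tensor"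
  assumes unital_A: "unital_algebra F A"
    and \<rho>: "linear_map F A AH \<rho>" and \<kappa>: "linear_map F A HA \<kappa>"
begin

text \<open>\<open>\<rho>\<close> is the right and \<open>\<kappa>\<close> the left coaction; \<open>la\<close> and \<open>ra\<close> are the induced left and right
  actions.\<close>

private abbreviation (input) "la \<equiv> induced_lact F A \<rho>"
private abbreviation (input) "ra \<equiv> induced_ract F A \<kappa>"

private lemmas act_defs = induced_lact_def[of F A \<rho>] induced_ract_def[of F A \<kappa>]

private lemmas \<rho>_closed [simp] = linear_mapD(1)[OF \<rho>]
private lemmas \<kappa>_closed [simp] = linear_mapD(1)[OF \<kappa>]

private lemma one_A: "\<one>\<^bsub>A\<^esub> \<in> carrier A" and one_mult_A: "\<And>a. a \<in> carrier A \<Longrightarrow> \<one>\<^bsub>A\<^esub> \<otimes>\<^bsub>A\<^esub> a = a"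
  "\<And>a. a \<in> carrier A \<Longrightarrow> a \<otimes>\<^bsub>A\<^esub> \<one>\<^bsub>A\<^esub> = a"
proof -
  interpret A: unital_algebra F A by (rule unital_A)
  show "\<one>\<^bsub>A\<^esub> \<in> carrier A" "\<And>a. a \<in> carrier A \<Longrightarrow> \<one>\<^bsub>A\<^esub> \<otimes>\<^bsub>A\<^esub> a = a"
    "\<And>a. a \<in> carrier A \<Longrightarrow> a \<otimes>\<^bsub>A\<^esub> \<one>\<^bsub>A\<^esub> = a" by simp_all
qed

private lemma la_closed [simp]: "functional f \<Longrightarrow> a \<in> carrier A \<Longrightarrow> la f a \<in> carrier A"
  unfolding act_defs by (intro linear_mapD(1)[OF slice_AH]) auto

private lemma ra_closed [simp]: "functional f \<Longrightarrow> a \<in> carrier A \<Longrightarrow> ra a f \<in> carrier A"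
  unfolding act_defs by (intro linear_mapD(1)[OF slice_HA]) auto

lemma bilinear_map_finite_dual:
  "bilinear_map F (finite_dual F H) V W \<beta> \<longleftrightarrow> bilinear_map F dual V W \<beta>"
  "bilinear_map F V (finite_dual F H) W \<gamma> \<longleftrightarrow> bilinear_map F V dual W \<gamma>"
  by (simp_all add: bilinear_map_def linear_map_def)

lemma induced_lact_bilinear: "bilinear_map F (finite_dual F H) A A la"
  unfolding bilinear_map_finite_dual act_defs
  by (rule bilinear_mapI)
    (auto intro!: linear_map_comp[OF slice_AH[OF dual_linear] \<rho>] lact_linear)

lemma induced_ract_bilinear: "bilinear_map F A (finite_dual F H) A ra"
  unfolding bilinear_map_finite_dual act_defs
  by (rule bilinear_mapI)
    (auto intro!: linear_map_comp[OF slice_HA[OF dual_linear] \<kappa>] ract_linear)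

lemma induced_lact_one:
  assumes "a \<in> carrier A"
  shows "la \<one>\<^bsub>dual\<^esub> a = slice_right F A (counit H) (\<rho> a)"
  unfolding act_defs
  by (rule slice_right_cong[OF A module_H counit_linear]) (use assms in \<open>simp_all add: finite_dual_algebra_simps\<close>)

lemma induced_ract_one:
  assumes "a \<in> carrier A"
  shows "ra a \<one>\<^bsub>dual\<^esub> = slice_left F A (counit H) (\<kappa> a)"
  unfolding act_defs
  by (rule slice_left_cong[OF module_H A counit_linear]) (use assms in \<open>simp_all add: finite_dual_algebra_simps\<close>)

text \<open>The two sides of each axiom on triple tensor products, at an element \<open>a\<close> of \<open>A\<close>, without the
  factor \<open>\<rho>(1) \<otimes> 1\<close> or \<open>1 \<otimes> \<kappa>(1)\<close> of the partial ones.\<close>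

private abbreviation (input) "coact2_right a \<equiv> tensor_assoc F A H H (tensor_map F AH H \<rho> id (\<rho> a))"
private abbreviation (input) "comult_right a \<equiv> tensor_map F A HH id (comult H) (\<rho> a)"
private abbreviation (input) "coact2_left a \<equiv> tensor_map F H HA id \<kappa> (\<kappa> a)"
private abbreviation (input) "comult_left a \<equiv> tensor_assoc F H H A (tensor_map F HH A (comult H) id (\<kappa> a))"
private abbreviation (input) "coact_lr a \<equiv> tensor_map F H AH id \<rho> (\<kappa> a)"
private abbreviation (input) "coact_rl a \<equiv> tensor_assoc F H A H (tensor_map F HA H \<kappa> id (\<rho> a))"

private lemma coact_closed [simp]:
  assumes "a \<in> carrier A"
  shows "coact2_right a \<in> carrier AHH" "comult_right a \<in> carrier AHH"
    "coact2_left a \<in> carrier HHA" "comult_left a \<in> carrier HHA"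
    "coact_lr a \<in> carrier HAH" "coact_rl a \<in> carrier HAH"
    "tensor_assoc F A H H (pure_tensor F AH H (\<rho> \<one>\<^bsub>A\<^esub>) \<one>\<^bsub>H\<^esub>) \<in> carrier AHH"
proof -
  show "coact2_right a \<in> carrier AHH"
    by (intro linear_mapD(1)[OF linear_tensor_assoc[OF A module_H module_H]]
        linear_mapD(1)[OF linear_tensor_map[OF A module_H AH module_H \<rho> linear_id]] \<rho>_closed assms)
  show "comult_right a \<in> carrier AHH"
    by (intro linear_mapD(1)[OF comult_right] \<rho>_closed assms)
  show "coact2_left a \<in> carrier HHA"
    by (intro linear_mapD(1)[OF linear_tensor_map[OF module_H A module_H HA linear_id \<kappa>]] \<kappa>_closed assms)
  show "comult_left a \<in> carrier HHA"
    by (intro linear_mapD(1)[OF comult_left] \<kappa>_closed assms)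
  show "coact_lr a \<in> carrier HAH"
    by (intro linear_mapD(1)[OF linear_tensor_map[OF module_H A module_H AH linear_id \<rho>]] \<kappa>_closed assms)
  show "coact_rl a \<in> carrier HAH"
    by (intro linear_mapD(1)[OF linear_tensor_assoc[OF module_H A module_H]]
        linear_mapD(1)[OF linear_tensor_map[OF A module_H HA module_H \<kappa> linear_id]] \<rho>_closed assms)
  show "tensor_assoc F A H H (pure_tensor F AH H (\<rho> \<one>\<^bsub>A\<^esub>) \<one>\<^bsub>H\<^esub>) \<in> carrier AHH"
    by (intro linear_mapD(1)[OF linear_tensor_assoc_pure[OF A module_H module_H]] \<rho>_closed one_A one_closed)
qed

text \<open>The slices of both sides of each comodule axiom, where possible in terms of the induced actions.\<close>

private lemmas slice_last_coact2 = slice_last_coaction[OF _ \<rho> \<rho>_closed, folded act_defs]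

private lemmas slice_left_coact2 = slice_left_tensor_map[OF HA _ \<kappa> \<kappa>_closed, folded act_defs]

private lemma slices_coact_lr:
  assumes "functional f" "functional g" "a \<in> carrier A"
  shows "slice_right F A f (slice_left F AH g (coact_lr a)) = la f (ra a g)"
  unfolding act_defs slice_left_tensor_map[OF AH assms(2) \<rho> \<kappa>_closed[OF assms(3)]] ..

private lemma slices_coact_rl:
  assumes "functional f" "functional g" "a \<in> carrier A"
  shows "slice_right F A f (slice_left F AH g (coact_rl a)) = ra (la f a) g"
  unfolding act_defs slice_both_coactions[OF assms(1,2) \<kappa> \<rho>_closed[OF assms(3)]] ..

private lemmas slice_last_partial = slice_last_mult[OF _ \<rho>_closed[OF one_A] coact_closed(2)]
private lemmas slice_left_partial = slice_left_mult_pure[OF _ \<kappa>_closed[OF one_A] coact_closed(4)]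
private lemmas la_mult = slice_right_dual_mult[OF _ _ \<rho>_closed, folded act_defs]
private lemmas ra_mult = slice_left_dual_mult[OF _ _ \<kappa>_closed, folded act_defs]
private lemmas la_comult = slice_right_mult_comult[OF _ \<rho>_closed \<rho>_closed, folded act_defs]
private lemmas ra_comult = slice_left_mult_comult[OF _ \<kappa>_closed \<kappa>_closed, folded act_defs]
private lemmas la_comult_mult =
  slice_right_mult_comult_mult[OF _ _ \<rho>_closed \<rho>_closed, folded act_defs]
private lemmas ra_comult_mult =
  slice_left_mult_comult_mult[OF _ _ \<kappa>_closed \<kappa>_closed, folded act_defs]

text \<open>For \<open>g = \<epsilon>\<close>, the right-hand side of the partial action axiom is that of the axiom for
  products.\<close>

private lemma la_comult_one:
  assumes f: "f \<in> carrier dual" and a: "a \<in> carrier A" and b: "b \<in> carrier A"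
  shows "slice_right F A f (\<rho> a \<otimes>\<^bsub>AH\<^esub> slice_last \<one>\<^bsub>dual\<^esub> (comult_right b)) =
    slice_right F A f (\<rho> a \<otimes>\<^bsub>AH\<^esub> \<rho> b)"
proof -
  obtain xs where sub: "set xs \<subseteq> carrier dual \<times> carrier dual" and xs: "product_decomposition f xs"
    using dual_decomposition[OF f] by metis
  note one = dual_linear[OF dual_counit]
  have q: "slice_last \<one>\<^bsub>dual\<^esub> (comult_right b) \<in> carrier AH"
    by (rule linear_mapD(1)[OF linear_slice_last[OF one]]) (use b in simp)
  show ?thesis
    unfolding slice_right_mult[OF dual_linear[OF f] xs \<rho>_closed[OF a] q]
      slice_right_mult[OF dual_linear[OF f] xs \<rho>_closed[OF a] \<rho>_closed[OF b]]
    by (rule lsum_cong)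
      (use sub b in \<open>auto simp: slice_right_dual_mult[OF dual_linear one, symmetric] dual_mult_one\<close>)
qed

private lemma ra_comult_one:
  assumes f: "f \<in> carrier dual" and a: "a \<in> carrier A" and b: "b \<in> carrier A"
  shows "slice_left F A f (slice_left F HA \<one>\<^bsub>dual\<^esub> (comult_left b) \<otimes>\<^bsub>HA\<^esub> \<kappa> a) =
    slice_left F A f (\<kappa> b \<otimes>\<^bsub>HA\<^esub> \<kappa> a)"
proof -
  obtain xs where sub: "set xs \<subseteq> carrier dual \<times> carrier dual" and xs: "product_decomposition f xs"
    using dual_decomposition[OF f] by metis
  note one = dual_linear[OF dual_counit]
  have q: "slice_left F HA \<one>\<^bsub>dual\<^esub> (comult_left b) \<in> carrier HA"
    by (rule linear_mapD(1)[OF slice_HHA[OF one]]) (use b in simp)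
  show ?thesis
    unfolding slice_left_mult[OF dual_linear[OF f] xs q \<kappa>_closed[OF a]]
      slice_left_mult[OF dual_linear[OF f] xs \<kappa>_closed[OF b] \<kappa>_closed[OF a]]
    by (rule lsum_cong)
      (use sub b in \<open>auto simp: slice_left_dual_mult[OF dual_linear one, symmetric] dual_mult_one\<close>)
qed

private lemma coact_lr_eq_rl:
  assumes sep: "finite_dual_separates_points F H" and a: "a \<in> carrier A"
    and eq: "\<And>f g. f \<in> carrier dual \<Longrightarrow> g \<in> carrier dual \<Longrightarrow> la f (ra a g) = ra (la f a) g"
  shows "coact_lr a = coact_rl a"
  by (rule slices_HAH_eqI[OF sep])
    (use a eq slices_coact_lr[OF dual_linear dual_linear a] slices_coact_rl[OF dual_linear dual_linear a]
      in simp_all)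

section \<open>Coactions and actions\<close>

lemma partial_bimodule_of_partial_bicomodule:
  assumes "partial_bicomodule_algebra F H \<kappa> A \<rho>"
  shows "partial_bimodule_algebra F (finite_dual F H) la A ra"
proof (rule partial_bimodule_algebra.intro[OF alg_A partial_bimodule_algebra_axioms.intro])
  interpret P: partial_bicomodule_algebra F H \<kappa> A \<rho> by (rule assms)
  show "bilinear_map F (finite_dual F H) A A la" "bilinear_map F A (finite_dual F H) A ra"
    by (rule induced_lact_bilinear induced_ract_bilinear)+
  fix a assume a: "a \<in> carrier A"
  show "la \<one>\<^bsub>finite_dual F H\<^esub> a = a" "ra a \<one>\<^bsub>finite_dual F H\<^esub> = a"
    using a by (simp_all add: induced_lact_one induced_ract_one P.rcoact_counit P.lcoact_counit)
  fix g f assume gf: "g \<in> carrier (finite_dual F H)" "f \<in> carrier (finite_dual F H)"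
  then have K: "g \<in> carrier dual" "f \<in> carrier dual" by simp_all
  note fg [simp] = dual_linear[OF K(1)] dual_linear[OF K(2)]
  show "la f (ra a g) = ra (la f a) g"
    using slices_coact_lr[OF fg(2,1) a] slices_coact_rl[OF fg(2,1) a] P.coact_compat[OF a] by simp
  fix b assume b: "b \<in> carrier A"
  have q: "slice_last g (comult_right b) \<in> carrier AH"
    by (rule linear_mapD(1)[OF linear_slice_last[OF fg(1)]]) (use b in simp)
  \<comment> \<open>The factor \<open>\<rho>(1)\<close> of partial coassociativity is absorbed, since \<open>\<rho>(a) \<rho>(1) = \<rho>(a)\<close>.\<close>
  have "\<rho> (a \<otimes>\<^bsub>A\<^esub> la g b) = \<rho> a \<otimes>\<^bsub>AH\<^esub> (\<rho> \<one>\<^bsub>A\<^esub> \<otimes>\<^bsub>AH\<^esub> slice_last g (comult_right b))"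
    using P.rcoact_mult[OF a la_closed[OF fg(1) b]] slice_last_coact2[OF fg(1) b]
      P.rcoact_partial[OF b] slice_last_partial[OF fg(1) b] by simp
  also have "\<dots> = \<rho> (a \<otimes>\<^bsub>A\<^esub> \<one>\<^bsub>A\<^esub>) \<otimes>\<^bsub>AH\<^esub> slice_last g (comult_right b)"
    using assoc_algebraD(4)[OF alg_AH \<rho>_closed[OF a] \<rho>_closed[OF one_A] q] P.rcoact_mult[OF a one_A]
    by simp
  finally show "la f (a \<otimes>\<^bsub>A\<^esub> la g b) =
      tensor_lift F A (\<lambda>u v. la u a \<otimes>\<^bsub>A\<^esub> la (v \<otimes>\<^bsub>finite_dual F H\<^esub> g) b) (comult (finite_dual F H) f)"
    using la_comult_mult[OF K(2) fg(1) a b] one_mult_A a by (simp add: induced_lact_def)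
  have q': "slice_left F HA g (comult_left b) \<in> carrier HA"
    by (rule linear_mapD(1)[OF slice_HHA[OF fg(1)]]) (use b in simp)
  have "\<kappa> (ra b g \<otimes>\<^bsub>A\<^esub> a) = (slice_left F HA g (comult_left b) \<otimes>\<^bsub>HA\<^esub> \<kappa> \<one>\<^bsub>A\<^esub>) \<otimes>\<^bsub>HA\<^esub> \<kappa> a"
    using P.lcoact_mult[OF ra_closed[OF fg(1) b] a] slice_left_coact2[OF fg(1) b]
      P.lcoact_partial[OF b] slice_left_partial[OF fg(1) b] by simp
  also have "\<dots> = slice_left F HA g (comult_left b) \<otimes>\<^bsub>HA\<^esub> \<kappa> (\<one>\<^bsub>A\<^esub> \<otimes>\<^bsub>A\<^esub> a)"
    using assoc_algebraD(4)[OF alg_HA q' \<kappa>_closed[OF one_A] \<kappa>_closed[OF a]] P.lcoact_mult[OF one_A a]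
    by simp
  finally show "ra (ra b g \<otimes>\<^bsub>A\<^esub> a) f =
      tensor_lift F A (\<lambda>u v. ra b (g \<otimes>\<^bsub>finite_dual F H\<^esub> u) \<otimes>\<^bsub>A\<^esub> ra a v) (comult (finite_dual F H) f)"
    using ra_comult_mult[OF K(2) fg(1) b a] one_mult_A a by (simp add: induced_ract_def)
qed

lemma global_bimodule_of_global_bicomodule:
  assumes "global_bicomodule_algebra F H \<kappa> A \<rho>"
  shows "global_bimodule_algebra F (finite_dual F H) la A ra"
proof (rule global_bimodule_algebra.intro[OF alg_A global_bimodule_algebra_axioms.intro])
  interpret P: global_bicomodule_algebra F H \<kappa> A \<rho> by (rule assms)
  show "bilinear_map F (finite_dual F H) A A la" "bilinear_map F A (finite_dual F H) A ra"
    by (rule induced_lact_bilinear induced_ract_bilinear)+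
  fix a assume a: "a \<in> carrier A"
  show "la \<one>\<^bsub>finite_dual F H\<^esub> a = a" "ra a \<one>\<^bsub>finite_dual F H\<^esub> = a"
    using a by (simp_all add: induced_lact_one induced_ract_one P.rcoact_counit P.lcoact_counit)
  {
    fix g f assume gf: "g \<in> carrier (finite_dual F H)" "f \<in> carrier (finite_dual F H)"
    then have K: "g \<in> carrier dual" "f \<in> carrier dual" by simp_all
    note fg = dual_linear[OF K(1)] dual_linear[OF K(2)]
    show "la f (ra a g) = ra (la f a) g"
      using slices_coact_lr[OF fg(2,1) a] slices_coact_rl[OF fg(2,1) a] P.coact_compat[OF a] by simp
    show "la f (la g a) = la (f \<otimes>\<^bsub>finite_dual F H\<^esub> g) a"
      using la_mult[OF fg(2,1) a] slice_last_coact2[OF fg(1) a] P.rcoact_coassoc[OF a]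
      by (simp add: induced_lact_def)
    show "ra (ra a g) f = ra a (g \<otimes>\<^bsub>finite_dual F H\<^esub> f)"
      using ra_mult[OF fg(2,1) a] slice_left_coact2[OF fg(1) a] P.lcoact_coassoc[OF a]
      by (simp add: induced_ract_def)
  }
  fix b f assume b: "b \<in> carrier A" and "f \<in> carrier (finite_dual F H)"
  then have f: "f \<in> carrier dual" by simp
  show "la f (a \<otimes>\<^bsub>A\<^esub> b) = tensor_lift F A (\<lambda>u v. la u a \<otimes>\<^bsub>A\<^esub> la v b) (comult (finite_dual F H) f)"
    using la_comult[OF f a b] P.rcoact_mult[OF a b] by (simp add: induced_lact_def)
  show "ra (a \<otimes>\<^bsub>A\<^esub> b) f = tensor_lift F A (\<lambda>u v. ra a u \<otimes>\<^bsub>A\<^esub> ra b v) (comult (finite_dual F H) f)"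
    using ra_comult[OF f a b] P.lcoact_mult[OF a b] by (simp add: induced_ract_def)
qed

lemma partial_bicomodule_of_partial_bimodule:
  assumes sep: "finite_dual_separates_points F H"
    and "partial_bimodule_algebra F (finite_dual F H) la A ra"
  shows "partial_bicomodule_algebra F H \<kappa> A \<rho>"
proof (rule partial_bicomodule_algebra.intro[OF unital_A partial_bicomodule_algebra_axioms.intro])
  interpret P: partial_bimodule_algebra F "finite_dual F H" la A ra by (rule assms(2))
  show "linear_map F A AH \<rho>" "linear_map F A HA \<kappa>" by (rule \<rho> \<kappa>)+
  fix a assume a: "a \<in> carrier A"
  show "slice_right F A (counit H) (\<rho> a) = a"
    using P.lact_one[OF a] a by (simp add: induced_lact_one)
  show "slice_left F A (counit H) (\<kappa> a) = a"
    using P.ract_one[OF a] a by (simp add: induced_ract_one)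
  show "coact2_right a =
      tensor_assoc F A H H (pure_tensor F AH H (\<rho> \<one>\<^bsub>A\<^esub>) \<one>\<^bsub>H\<^esub>) \<otimes>\<^bsub>AHH\<^esub> comult_right a"
  proof (rule slices_AHH_eqI[OF sep])
    fix f g assume f: "f \<in> carrier dual" and g: "g \<in> carrier dual"
    note fg = dual_linear[OF f] dual_linear[OF g]
    have "slice_right F A f (slice_last g (coact2_right a)) = la f (\<one>\<^bsub>A\<^esub> \<otimes>\<^bsub>A\<^esub> la g a)"
      using slice_last_coact2[OF fg(2) a] one_mult_A(1)[OF la_closed[OF fg(2) a]]
      by (simp add: induced_lact_def)
    also have "\<dots> = slice_right F A f (\<rho> \<one>\<^bsub>A\<^esub> \<otimes>\<^bsub>AH\<^esub> slice_last g (comult_right a))"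
      using P.lact_partial[OF one_A a, of g f] f g la_comult_mult[OF f fg(2) one_A a] by simp
    finally show "slice_right F A f (slice_last g (coact2_right a)) = slice_right F A f (slice_last g
        (tensor_assoc F A H H (pure_tensor F AH H (\<rho> \<one>\<^bsub>A\<^esub>) \<one>\<^bsub>H\<^esub>) \<otimes>\<^bsub>AHH\<^esub> comult_right a))"
      using slice_last_partial[OF fg(2) a] by simp
  qed (use a one_A in simp_all)
  show "coact2_left a = comult_left a \<otimes>\<^bsub>HHA\<^esub> pure_tensor F H HA \<one>\<^bsub>H\<^esub> (\<kappa> \<one>\<^bsub>A\<^esub>)"
  proof (rule slices_HHA_eqI[OF sep])
    fix f g assume f: "f \<in> carrier dual" and g: "g \<in> carrier dual"
    note fg = dual_linear[OF f] dual_linear[OF g]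
    have "slice_left F A f (slice_left F HA g (coact2_left a)) = ra (ra a g \<otimes>\<^bsub>A\<^esub> \<one>\<^bsub>A\<^esub>) f"
      using slice_left_coact2[OF fg(2) a] one_mult_A(2)[OF ra_closed[OF fg(2) a]]
      by (simp add: induced_ract_def)
    also have "\<dots> = slice_left F A f (slice_left F HA g (comult_left a) \<otimes>\<^bsub>HA\<^esub> \<kappa> \<one>\<^bsub>A\<^esub>)"
      using P.ract_partial[OF one_A a, of g f] f g ra_comult_mult[OF f fg(2) a one_A] by simp
    finally show "slice_left F A f (slice_left F HA g (coact2_left a)) = slice_left F A f
        (slice_left F HA g (comult_left a \<otimes>\<^bsub>HHA\<^esub> pure_tensor F H HA \<one>\<^bsub>H\<^esub> (\<kappa> \<one>\<^bsub>A\<^esub>)))"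
      using slice_left_partial[OF fg(2) a] by simp
  qed (use a one_A in simp_all)
  show "coact_lr a = coact_rl a"
    by (rule coact_lr_eq_rl[OF sep a]) (use P.lact_ract[OF a] in simp)
  fix b assume b: "b \<in> carrier A"
  note one = dual_linear[OF dual_counit]
  show "\<rho> (a \<otimes>\<^bsub>A\<^esub> b) = \<rho> a \<otimes>\<^bsub>AH\<^esub> \<rho> b"
  proof (rule slices_AH_eqI[OF sep])
    fix f assume f: "f \<in> carrier dual"
    have "la f (a \<otimes>\<^bsub>A\<^esub> la \<one>\<^bsub>dual\<^esub> b) = slice_right F A f (\<rho> a \<otimes>\<^bsub>AH\<^esub> \<rho> b)"
      using P.lact_partial[OF a b, of "\<one>\<^bsub>dual\<^esub>" f] f dual_counit
        la_comult_mult[OF f one a b] la_comult_one[OF f a b] by simp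
    then show "slice_right F A f (\<rho> (a \<otimes>\<^bsub>A\<^esub> b)) = slice_right F A f (\<rho> a \<otimes>\<^bsub>AH\<^esub> \<rho> b)"
      using P.lact_one[OF b] by (simp add: induced_lact_def)
  qed (use a b in simp_all)
  show "\<kappa> (a \<otimes>\<^bsub>A\<^esub> b) = \<kappa> a \<otimes>\<^bsub>HA\<^esub> \<kappa> b"
  proof (rule slice_left_eqI[OF sep A])
    fix f assume f: "f \<in> carrier dual"
    have "ra (ra a \<one>\<^bsub>dual\<^esub> \<otimes>\<^bsub>A\<^esub> b) f = slice_left F A f (\<kappa> a \<otimes>\<^bsub>HA\<^esub> \<kappa> b)"
      using P.ract_partial[OF b a, of "\<one>\<^bsub>dual\<^esub>" f] f dual_counit
        ra_comult_mult[OF f one a b] ra_comult_one[OF f b a] by simp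
    then show "slice_left F A f (\<kappa> (a \<otimes>\<^bsub>A\<^esub> b)) = slice_left F A f (\<kappa> a \<otimes>\<^bsub>HA\<^esub> \<kappa> b)"
      using P.ract_one[OF a] by (simp add: induced_ract_def)
  qed (use a b in simp_all)
qed

lemma global_bicomodule_of_global_bimodule:
  assumes sep: "finite_dual_separates_points F H"
    and "global_bimodule_algebra F (finite_dual F H) la A ra"
  shows "global_bicomodule_algebra F H \<kappa> A \<rho>"
proof (rule global_bicomodule_algebra.intro[OF unital_A global_bicomodule_algebra_axioms.intro])
  interpret P: global_bimodule_algebra F "finite_dual F H" la A ra by (rule assms(2))
  show "linear_map F A AH \<rho>" "linear_map F A HA \<kappa>" by (rule \<rho> \<kappa>)+
  fix a assume a: "a \<in> carrier A"
  show "slice_right F A (counit H) (\<rho> a) = a"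
    using P.lact_one[OF a] a by (simp add: induced_lact_one)
  show "slice_left F A (counit H) (\<kappa> a) = a"
    using P.ract_one[OF a] a by (simp add: induced_ract_one)
  show "coact2_right a = comult_right a"
  proof (rule slices_AHH_eqI[OF sep])
    fix f g assume f: "f \<in> carrier dual" and g: "g \<in> carrier dual"
    note fg = dual_linear[OF f] dual_linear[OF g]
    show "slice_right F A f (slice_last g (coact2_right a)) = slice_right F A f (slice_last g (comult_right a))"
      using P.lact_assoc[OF a, of g f] f g la_mult[OF fg a] slice_last_coact2[OF fg(2) a]
      by (simp add: induced_lact_def)
  qed (use a in simp_all)
  show "coact2_left a = comult_left a"
  proof (rule slices_HHA_eqI[OF sep])
    fix f g assume f: "f \<in> carrier dual" and g: "g \<in> carrier dual"
    note fg = dual_linear[OF f] dual_linear[OF g]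
    show "slice_left F A f (slice_left F HA g (coact2_left a)) =
        slice_left F A f (slice_left F HA g (comult_left a))"
      using P.ract_assoc[OF a, of g f] f g ra_mult[OF fg a] slice_left_coact2[OF fg(2) a]
      by (simp add: induced_ract_def)
  qed (use a in simp_all)
  show "coact_lr a = coact_rl a"
    by (rule coact_lr_eq_rl[OF sep a]) (use P.lact_ract[OF a] in simp)
  fix b assume b: "b \<in> carrier A"
  show "\<rho> (a \<otimes>\<^bsub>A\<^esub> b) = \<rho> a \<otimes>\<^bsub>AH\<^esub> \<rho> b"
  proof (rule slices_AH_eqI[OF sep])
    fix f assume f: "f \<in> carrier dual"
    show "slice_right F A f (\<rho> (a \<otimes>\<^bsub>A\<^esub> b)) = slice_right F A f (\<rho> a \<otimes>\<^bsub>AH\<^esub> \<rho> b)"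
      using P.lact_mult[OF a b, of f] f la_comult[OF f a b] by (simp add: induced_lact_def)
  qed (use a b in simp_all)
  show "\<kappa> (a \<otimes>\<^bsub>A\<^esub> b) = \<kappa> a \<otimes>\<^bsub>HA\<^esub> \<kappa> b"
  proof (rule slice_left_eqI[OF sep A])
    fix f assume f: "f \<in> carrier dual"
    show "slice_left F A f (\<kappa> (a \<otimes>\<^bsub>A\<^esub> b)) = slice_left F A f (\<kappa> a \<otimes>\<^bsub>HA\<^esub> \<kappa> b)"
      using P.ract_mult[OF a b, of f] f ra_comult[OF f a b] by (simp add: induced_ract_def)
  qed (use a b in simp_all)
qed

end

end

end

theorem proposition3p14:
  fixes F :: "'k ring"
    and H :: "('k, 'h) hopf"
    and A :: "('k, 'a) module"
    and rcoact :: "'a \<Rightarrow> ('k, 'a, 'h) tensor"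
    and lcoact :: "'a \<Rightarrow> ('k, 'h, 'a) tensor"
    and lact :: "('h \<Rightarrow> 'k) \<Rightarrow> 'a \<Rightarrow> 'a"
    and ract :: "'a \<Rightarrow> ('h \<Rightarrow> 'k) \<Rightarrow> 'a"
  assumes "field F"
    and "hopf_algebra F H"
    and "unital_algebra F A"
    and "linear_map F A (tensor F A H) rcoact"
    and "linear_map F A (tensor F H A) lcoact"
    and "lact = induced_lact F A rcoact"
    and "ract = induced_ract F A lcoact"
  shows
    "(partial_bicomodule_algebra F H lcoact A rcoact \<longrightarrow>
        partial_bimodule_algebra F (finite_dual F H) lact A ract) \<and>
     (global_bicomodule_algebra F H lcoact A rcoact \<longrightarrow>
        global_bimodule_algebra F (finite_dual F H) lact A ract) \<and>
     (finite_dual_separates_points F H \<longrightarrow>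
        (partial_bimodule_algebra F (finite_dual F H) lact A ract \<longrightarrow>
           partial_bicomodule_algebra F H lcoact A rcoact) \<and>
        (global_bimodule_algebra F (finite_dual F H) lact A ract \<longrightarrow>
           global_bicomodule_algebra F H lcoact A rcoact))"
proof -
  interpret hopf_algebra F H by (rule assms(2))
  have alg_A: "assoc_algebra F A"
    using assms(3) by (simp add: unital_algebra_def)
  note thms = partial_bimodule_of_partial_bicomodule global_bimodule_of_global_bicomodule
    partial_bicomodule_of_partial_bimodule global_bicomodule_of_global_bimodule
  show ?thesis
    unfolding assms(6,7) using thms[OF alg_A assms(3-5)] by blast
qed

end
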